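(* Let $n\geq 5$, and let $\mathbb S_n$ and $\mathbb A_n$ be the symmetric and alternating groups on $n$ letters. For every subgroup $S\subseteq\mathbb S_n$ and every non-degenerate 2-cocycle $\alpha$ on $S$ with values in $k^*$, with associated twist $J$, the twisting deformation $(k\mathbb S_n)^J$ is a simple Hopf algebra if and only if $S\not\subseteq\mathbb A_n$.
   Context: $k$ is an algebraically closed field of characteristic zero. For a 2-cocycle $\alpha$ on a finite group $S$ (trivial action on $k^*$), $k_\alpha S$ is the twisted group algebra with basis $(x_s)_{s\in S}$, $x_sx_t=\alpha(s,t)x_{st}$; $\alpha$ is non-degenerate if $1$ is the only $s\in S$ with $\alpha(s,t)=\alpha(t,s)$ for all $t\in C_S(s)$. For a finite group $G$, a subgroup $S$ and $\alpha$ non-degenerate on $S$, the $k^G$-Galois object associated to $(S,\alpha)$ is $A(G,S,\alpha)=\{f:G\to k_\alpha S : f(sg)=s\rhd f(g)\ \forall s\in S,g\in G\}$ with pointwise product, $s\rhd x_t=x_sx_tx_s^{-1}$, and $G$-action $(g.f)(h)=f(hg)$, equivalently right $k^G$-coaction $\rho(a)=\sum_g g.a\otimes e_g$, $e_g(h)=\delta_{g,h}$. For a Hopf algebra $H$ and a convolution invertible normalized 2-cocycle $\sigma:H\otimes H\to k$, $H^{(\sigma)}$ denotes $H$ as a right $H$-comodule with product $h\cdot g=\sigma(h_1,g_1)h_2g_2$, and $H^\sigma$ denotes the Hopf algebra equal to $H$ as a coalgebra with product $\sigma(h_1,g_1)h_2g_2\sigma^{-1}(h_3,g_3)$. There is $\sigma$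 on $H=k^G$ with $A(G,S,\alpha)\simeq (k^G)^{(\sigma)}$ as right $k^G$-comodule algebras. The associated twist is the element $J\in kG\otimes kG$ given by $\sigma$ (it may be chosen in $kS\otimes kS$); $(kG)^J$ is the Hopf algebra equal to $kG$ as an algebra, with comultiplication $\Delta_J(x)=J\Delta(x)J^{-1}$; thus $(kG)^J\simeq((k^G)^\sigma)^*$. A Hopf subalgebra is normal if it is stable under the (left or right) adjoint action. A finite-dimensional Hopf algebra is simple if it contains no proper normal Hopf subalgebra, i.e. none other than $k$ and itself. *)

theory Defs
  imports
    "HOL-Algebra.Sym_Groups"
    "HOL-Computational_Algebra.Polynomial"
    "HOL-Library.Function_Algebras"
begin

section \<open>Vector spaces in coordinates\<close>

text \<open>
  A finite-dimensional vector space with basis indexed by a finite set \<open>B\<close> is represented by the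
  functions \<open>'b \<Rightarrow> 'k\<close> vanishing outside \<open>B\<close>; \<open>delta b\<close> is the basis vector at \<open>b\<close>. Its tensor
  square is the space of functions on \<open>'b \<times> 'b\<close> vanishing outside \<open>B \<times> B\<close>.
\<close>

definition coord_space :: "'b set \<Rightarrow> ('b \<Rightarrow> 'k::field) set" where
  "coord_space B = {f. \<forall>x. x \<notin> B \<longrightarrow> f x = 0}"

definition delta :: "'b \<Rightarrow> 'b \<Rightarrow> 'k::field" where
  "delta a = (\<lambda>x. if x = a then 1 else 0)"

definition fscale :: "'k::field \<Rightarrow> ('b \<Rightarrow> 'k) \<Rightarrow> 'b \<Rightarrow> 'k" where
  "fscale c f = (\<lambda>x. c * f x)"

definition tensor :: "('a \<Rightarrow> 'k::field) \<Rightarrow> ('b \<Rightarrow> 'k) \<Rightarrow> 'a \<times> 'b \<Rightarrow> 'k" where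
  "tensor f g = (\<lambda>(x, y). f x * g y)"

definition linear_on ::
  "('k \<Rightarrow> 'v \<Rightarrow> 'v) \<Rightarrow> ('k \<Rightarrow> 'w \<Rightarrow> 'w) \<Rightarrow> 'v::ab_group_add set \<Rightarrow> ('v \<Rightarrow> 'w::ab_group_add) \<Rightarrow> bool"
where
  "linear_on s1 s2 V f \<longleftrightarrow>
     (\<forall>x\<in>V. \<forall>y\<in>V. f (x + y) = f x + f y) \<and> (\<forall>c. \<forall>x\<in>V. f (s1 c x) = s2 c (f x))"

definition bilinear_on ::
  "('k \<Rightarrow> 'v \<Rightarrow> 'v) \<Rightarrow> ('k \<Rightarrow> 'w \<Rightarrow> 'w) \<Rightarrow> 'v::ab_group_add set \<Rightarrow> ('v \<Rightarrow> 'v \<Rightarrow> 'w::ab_group_add) \<Rightarrow> bool"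
where
  "bilinear_on s1 s2 V f \<longleftrightarrow>
     (\<forall>x\<in>V. linear_on s1 s2 V (f x)) \<and> (\<forall>y\<in>V. linear_on s1 s2 V (\<lambda>x. f x y))"


section \<open>Finite-dimensional Hopf algebras\<close>

record ('k, 'b) bialg =
  basis :: "'b set"
  bmul :: "('b \<Rightarrow> 'k) \<Rightarrow> ('b \<Rightarrow> 'k) \<Rightarrow> 'b \<Rightarrow> 'k"
  bone :: "'b \<Rightarrow> 'k"
  bcomul :: "('b \<Rightarrow> 'k) \<Rightarrow> 'b \<times> 'b \<Rightarrow> 'k"
  bcounit :: "('b \<Rightarrow> 'k) \<Rightarrow> 'k"

abbreviation vecs :: "('k::field, 'b) bialg \<Rightarrow> ('b \<Rightarrow> 'k) set" where
  "vecs H \<equiv> coord_space (basis H)"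

abbreviation vecs2 :: "('k::field, 'b) bialg \<Rightarrow> ('b \<times> 'b \<Rightarrow> 'k) set" where
  "vecs2 H \<equiv> coord_space (basis H \<times> basis H)"

text \<open>
  Sweedler notation: for bilinear \<open>F\<close>, \<open>sweedler s H h F\<close> is \<open>F(h\<^sub>1, h\<^sub>2)\<close>, where
  \<open>s\<close> is the scalar multiplication of the space in which \<open>F\<close> takes values.
\<close>

definition sweedler ::
  "('k \<Rightarrow> 'w \<Rightarrow> 'w) \<Rightarrow> ('k::field, 'b) bialg \<Rightarrow> ('b \<Rightarrow> 'k)
     \<Rightarrow> (('b \<Rightarrow> 'k) \<Rightarrow> ('b \<Rightarrow> 'k) \<Rightarrow> 'w) \<Rightarrow> 'w::comm_monoid_add"
where
  "sweedler s H h F =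
     (\<Sum>(a, b)\<in>basis H \<times> basis H. s (bcomul H h (a, b)) (F (delta a) (delta b)))"

text \<open>The algebra \<open>H \<otimes> H\<close>.\<close>

definition mul2 ::
  "('k::field, 'b) bialg \<Rightarrow> ('b \<times> 'b \<Rightarrow> 'k) \<Rightarrow> ('b \<times> 'b \<Rightarrow> 'k) \<Rightarrow> 'b \<times> 'b \<Rightarrow> 'k"
where
  "mul2 H u v =
     (\<Sum>(a, b)\<in>basis H \<times> basis H. \<Sum>(c, d)\<in>basis H \<times> basis H.
        fscale (u (a, b) * v (c, d))
          (tensor (bmul H (delta a) (delta c)) (bmul H (delta b) (delta d))))"

definition one2 :: "('k::field, 'b) bialg \<Rightarrow> 'b \<times> 'b \<Rightarrow> 'k" where
  "one2 H = tensor (bone H) (bone H)"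

definition inv2 :: "('k::field, 'b) bialg \<Rightarrow> ('b \<times> 'b \<Rightarrow> 'k) \<Rightarrow> 'b \<times> 'b \<Rightarrow> 'k" where
  "inv2 H u = (THE v. v \<in> vecs2 H \<and> mul2 H u v = one2 H \<and> mul2 H v u = one2 H)"

definition bialgebra :: "('k::field, 'b) bialg \<Rightarrow> bool" where
  "bialgebra H \<longleftrightarrow>
     finite (basis H) \<and>
     \<comment> \<open>algebra\<close>
     (\<forall>f\<in>vecs H. \<forall>g\<in>vecs H. bmul H f g \<in> vecs H) \<and>
     bilinear_on fscale fscale (vecs H) (bmul H) \<and>
     (\<forall>f\<in>vecs H. \<forall>g\<in>vecs H. \<forall>h\<in>vecs H. bmul H (bmul H f g) h = bmul H f (bmul H g h)) \<and>
     bone H \<in> vecs H \<and>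
     (\<forall>f\<in>vecs H. bmul H (bone H) f = f \<and> bmul H f (bone H) = f) \<and>
     \<comment> \<open>coalgebra\<close>
     (\<forall>h\<in>vecs H. bcomul H h \<in> vecs2 H) \<and>
     linear_on fscale fscale (vecs H) (bcomul H) \<and>
     (\<forall>h\<in>vecs H.
        sweedler fscale H h (\<lambda>h1 h2. sweedler fscale H h1 (\<lambda>x y. tensor x (tensor y h2))) =
        sweedler fscale H h (\<lambda>h1 h2. sweedler fscale H h2 (\<lambda>y z. tensor h1 (tensor y z)))) \<and>
     linear_on fscale (*) (vecs H) (bcounit H) \<and>
     (\<forall>h\<in>vecs H.
        sweedler fscale H h (\<lambda>h1 h2. fscale (bcounit H h1) h2) = h \<and>
        sweedler fscale H h (\<lambda>h1 h2. fscale (bcounit H h2) h1) = h) \<and>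
     \<comment> \<open>compatibility\<close>
     (\<forall>f\<in>vecs H. \<forall>g\<in>vecs H.
        bcomul H (bmul H f g) = mul2 H (bcomul H f) (bcomul H g) \<and>
        bcounit H (bmul H f g) = bcounit H f * bcounit H g) \<and>
     bcomul H (bone H) = one2 H \<and>
     bcounit H (bone H) = 1"

definition is_antipode :: "('k::field, 'b) bialg \<Rightarrow> (('b \<Rightarrow> 'k) \<Rightarrow> 'b \<Rightarrow> 'k) \<Rightarrow> bool" where
  "is_antipode H T \<longleftrightarrow>
     (\<forall>h\<in>vecs H. T h \<in> vecs H) \<and>
     linear_on fscale fscale (vecs H) T \<and>
     (\<forall>h\<in>vecs H.
        sweedler fscale H h (\<lambda>h1 h2. bmul H (T h1) h2) = fscale (bcounit H h) (bone H) \<and>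
        sweedler fscale H h (\<lambda>h1 h2. bmul H h1 (T h2)) = fscale (bcounit H h) (bone H))"

definition hopf_algebra :: "('k::field, 'b) bialg \<Rightarrow> bool" where
  "hopf_algebra H \<longleftrightarrow> bialgebra H \<and> (\<exists>T. is_antipode H T)"

text \<open>An antipode is unique on \<open>vecs H\<close>; its values elsewhere are irrelevant.\<close>

definition antipode :: "('k::field, 'b) bialg \<Rightarrow> ('b \<Rightarrow> 'k) \<Rightarrow> 'b \<Rightarrow> 'k" where
  "antipode H = (SOME T. is_antipode H T)"

definition hopf_subalgebra :: "('b \<Rightarrow> 'k) set \<Rightarrow> ('k::field, 'b) bialg \<Rightarrow> bool" where
  "hopf_subalgebra A H \<longleftrightarrow>
     A \<subseteq> vecs H \<and>
     module.subspace fscale A \<and>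
     bone H \<in> A \<and>
     (\<forall>x\<in>A. \<forall>y\<in>A. bmul H x y \<in> A) \<and>
     (\<forall>x\<in>A. bcomul H x \<in> module.span fscale {tensor a b |a b. a \<in> A \<and> b \<in> A}) \<and>
     (\<forall>x\<in>A. antipode H x \<in> A)"

definition left_adjoint :: "('k::field, 'b) bialg \<Rightarrow> ('b \<Rightarrow> 'k) \<Rightarrow> ('b \<Rightarrow> 'k) \<Rightarrow> 'b \<Rightarrow> 'k" where
  "left_adjoint H h a = sweedler fscale H h (\<lambda>h1 h2. bmul H h1 (bmul H a (antipode H h2)))"

definition right_adjoint :: "('k::field, 'b) bialg \<Rightarrow> ('b \<Rightarrow> 'k) \<Rightarrow> ('b \<Rightarrow> 'k) \<Rightarrow> 'b \<Rightarrow> 'k" where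
  "right_adjoint H h a = sweedler fscale H h (\<lambda>h1 h2. bmul H (antipode H h1) (bmul H a h2))"

text \<open>
  For a finite-dimensional Hopf algebra the antipode is bijective, and the two stability
  conditions on a Hopf subalgebra are equivalent.
\<close>

definition normal_hopf_subalgebra :: "('b \<Rightarrow> 'k) set \<Rightarrow> ('k::field, 'b) bialg \<Rightarrow> bool" where
  "normal_hopf_subalgebra A H \<longleftrightarrow>
     hopf_subalgebra A H \<and>
     ((\<forall>h\<in>vecs H. \<forall>a\<in>A. left_adjoint H h a \<in> A) \<or>
      (\<forall>h\<in>vecs H. \<forall>a\<in>A. right_adjoint H h a \<in> A))"

definition simple_hopf_algebra :: "('k::field, 'b) bialg \<Rightarrow> bool" where
  "simple_hopf_algebra H \<longleftrightarrow>
     hopf_algebra H \<and>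
     (\<forall>A. normal_hopf_subalgebra A H \<longrightarrow> A = module.span fscale {bone H} \<or> A = vecs H)"


section \<open>Hopf 2-cocycles, cleft objects and twists\<close>

text \<open>A linear map \<open>\<sigma> : H \<otimes> H \<rightarrow> k\<close> is represented by the corresponding bilinear form.\<close>

definition hopf_2cocycle :: "('k::field, 'b) bialg \<Rightarrow> (('b \<Rightarrow> 'k) \<Rightarrow> ('b \<Rightarrow> 'k) \<Rightarrow> 'k) \<Rightarrow> bool" where
  "hopf_2cocycle H \<sigma> \<longleftrightarrow>
     bilinear_on fscale (*) (vecs H) \<sigma> \<and>
     (\<forall>h\<in>vecs H. \<forall>g\<in>vecs H. \<forall>l\<in>vecs H.
        sweedler (*) H h (\<lambda>h1 h2. sweedler (*) H g (\<lambda>g1 g2. \<sigma> h1 g1 * \<sigma> (bmul H h2 g2) l)) =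
        sweedler (*) H g (\<lambda>g1 g2. sweedler (*) H l (\<lambda>l1 l2. \<sigma> g1 l1 * \<sigma> h (bmul H g2 l2)))) \<and>
     (\<forall>h\<in>vecs H. \<sigma> h (bone H) = bcounit H h \<and> \<sigma> (bone H) h = bcounit H h)"

definition convolution_invertible ::
  "('k::field, 'b) bialg \<Rightarrow> (('b \<Rightarrow> 'k) \<Rightarrow> ('b \<Rightarrow> 'k) \<Rightarrow> 'k) \<Rightarrow> bool"
where
  "convolution_invertible H \<sigma> \<longleftrightarrow>
     (\<exists>\<tau>. bilinear_on fscale (*) (vecs H) \<tau> \<and>
        (\<forall>h\<in>vecs H. \<forall>g\<in>vecs H.
           sweedler (*) H h (\<lambda>h1 h2. sweedler (*) H g (\<lambda>g1 g2. \<sigma> h1 g1 * \<tau> h2 g2)) =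
             bcounit H h * bcounit H g \<and>
           sweedler (*) H h (\<lambda>h1 h2. sweedler (*) H g (\<lambda>g1 g2. \<tau> h1 g1 * \<sigma> h2 g2)) =
             bcounit H h * bcounit H g))"

text \<open>
  A right comodule algebra over a Hopf algebra with basis indexed by \<open>'b\<close>. The coaction
  \<open>\<rho> : A \<rightarrow> A \<otimes> H\<close> is recorded by its components: \<open>\<rho>(a) = \<Sum>b. ca_coact a b \<otimes> delta b\<close>.
\<close>

record ('k, 'v, 'b) comod_alg =
  ca_carrier :: "'v set"
  ca_scale :: "'k \<Rightarrow> 'v \<Rightarrow> 'v"
  ca_mul :: "'v \<Rightarrow> 'v \<Rightarrow> 'v"
  ca_one :: 'v
  ca_coact :: "'v \<Rightarrow> 'b \<Rightarrow> 'v"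

definition comod_alg_iso ::
  "('k::field, 'b) bialg \<Rightarrow> ('k, 'v::ab_group_add, 'b) comod_alg
     \<Rightarrow> ('k, 'w::ab_group_add, 'b) comod_alg \<Rightarrow> bool"
where
  "comod_alg_iso H M N \<longleftrightarrow>
     (\<exists>\<phi>. bij_betw \<phi> (ca_carrier M) (ca_carrier N) \<and>
        linear_on (ca_scale M) (ca_scale N) (ca_carrier M) \<phi> \<and>
        (\<forall>x\<in>ca_carrier M. \<forall>y\<in>ca_carrier M. \<phi> (ca_mul M x y) = ca_mul N (\<phi> x) (\<phi> y)) \<and>
        \<phi> (ca_one M) = ca_one N \<and>
        (\<forall>x\<in>ca_carrier M. \<forall>b\<in>basis H. ca_coact N (\<phi> x) b = \<phi> (ca_coact M x b)))"

text \<open>\<open>H\<^sup>(\<^sup>\<sigma>\<^sup>)\<close>, whose coaction is the comultiplication of \<open>H\<close>\<close>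

definition cleft_object ::
  "('k::field, 'b) bialg \<Rightarrow> (('b \<Rightarrow> 'k) \<Rightarrow> ('b \<Rightarrow> 'k) \<Rightarrow> 'k) \<Rightarrow> ('k, 'b \<Rightarrow> 'k, 'b) comod_alg"
where
  "cleft_object H \<sigma> = \<lparr>
     ca_carrier = vecs H,
     ca_scale = fscale,
     ca_mul = (\<lambda>h g. sweedler fscale H h (\<lambda>h1 h2. sweedler fscale H g (\<lambda>g1 g2.
                 fscale (\<sigma> h1 g1) (bmul H h2 g2)))),
     ca_one = bone H,
     ca_coact = (\<lambda>h b a. bcomul H h (a, b)) \<rparr>"

text \<open>\<open>H\<^sup>J\<close> for \<open>J \<in> H \<otimes> H\<close>\<close>

definition twist_bialg :: "('k::field, 'b) bialg \<Rightarrow> ('b \<times> 'b \<Rightarrow> 'k) \<Rightarrow> ('k, 'b) bialg" where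
  "twist_bialg H J = H \<lparr> bcomul := (\<lambda>x. mul2 H (mul2 H J (bcomul H x)) (inv2 H J)) \<rparr>"


section \<open>Group algebras and their duals\<close>

definition group_2cocycle :: "('g, 'm) monoid_scheme \<Rightarrow> ('g \<Rightarrow> 'g \<Rightarrow> 'k::field) \<Rightarrow> bool" where
  "group_2cocycle K \<alpha> \<longleftrightarrow>
     (\<forall>s\<in>carrier K. \<forall>t\<in>carrier K. \<alpha> s t \<noteq> 0) \<and>
     (\<forall>s\<in>carrier K. \<forall>t\<in>carrier K. \<forall>u\<in>carrier K.
        \<alpha> s t * \<alpha> (s \<otimes>\<^bsub>K\<^esub> t) u = \<alpha> t u * \<alpha> s (t \<otimes>\<^bsub>K\<^esub> u))"

definition nondegenerate_cocycle :: "('g, 'm) monoid_scheme \<Rightarrow> ('g \<Rightarrow> 'g \<Rightarrow> 'k::field) \<Rightarrow> bool" where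
  "nondegenerate_cocycle K \<alpha> \<longleftrightarrow>
     (\<forall>s\<in>carrier K.
        (\<forall>t\<in>carrier K. s \<otimes>\<^bsub>K\<^esub> t = t \<otimes>\<^bsub>K\<^esub> s \<longrightarrow> \<alpha> s t = \<alpha> t s) \<longrightarrow> s = \<one>\<^bsub>K\<^esub>)"

text \<open>The twisted group algebra \<open>k\<^sub>\<alpha>K\<close>, with \<open>delta s\<close> in the role of \<open>x\<^sub>s\<close>\<close>

definition twisted_mul ::
  "('g, 'm) monoid_scheme \<Rightarrow> ('g \<Rightarrow> 'g \<Rightarrow> 'k::field) \<Rightarrow> ('g \<Rightarrow> 'k) \<Rightarrow> ('g \<Rightarrow> 'k) \<Rightarrow> 'g \<Rightarrow> 'k"
where
  "twisted_mul K \<alpha> u v =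
     (\<Sum>s\<in>carrier K. \<Sum>t\<in>carrier K. fscale (u s * v t * \<alpha> s t) (delta (s \<otimes>\<^bsub>K\<^esub> t)))"

text \<open>The cocycle is not assumed to be normalized, whence the scalar in the unit.\<close>

definition twisted_one :: "('g, 'm) monoid_scheme \<Rightarrow> ('g \<Rightarrow> 'g \<Rightarrow> 'k::field) \<Rightarrow> 'g \<Rightarrow> 'k" where
  "twisted_one K \<alpha> = fscale (inverse (\<alpha> \<one>\<^bsub>K\<^esub> \<one>\<^bsub>K\<^esub>)) (delta \<one>\<^bsub>K\<^esub>)"

definition twisted_inv ::
  "('g, 'm) monoid_scheme \<Rightarrow> ('g \<Rightarrow> 'g \<Rightarrow> 'k::field) \<Rightarrow> ('g \<Rightarrow> 'k) \<Rightarrow> 'g \<Rightarrow> 'k"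
where
  "twisted_inv K \<alpha> u = (THE v. v \<in> coord_space (carrier K) \<and>
     twisted_mul K \<alpha> u v = twisted_one K \<alpha> \<and> twisted_mul K \<alpha> v u = twisted_one K \<alpha>)"

definition twisted_action ::
  "('g, 'm) monoid_scheme \<Rightarrow> ('g \<Rightarrow> 'g \<Rightarrow> 'k::field) \<Rightarrow> 'g \<Rightarrow> ('g \<Rightarrow> 'k) \<Rightarrow> 'g \<Rightarrow> 'k"
where
  "twisted_action K \<alpha> s u =
     twisted_mul K \<alpha> (twisted_mul K \<alpha> (delta s) u) (twisted_inv K \<alpha> (delta s))"

text \<open>The group algebra \<open>kG\<close>\<close>

definition group_alg :: "('g, 'm) monoid_scheme \<Rightarrow> ('k::field, 'g) bialg" where
  "group_alg G = \<lparr>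
     basis = carrier G,
     bmul = twisted_mul G (\<lambda>_ _. 1),
     bone = delta \<one>\<^bsub>G\<^esub>,
     bcomul = (\<lambda>f. \<Sum>g\<in>carrier G. fscale (f g) (tensor (delta g) (delta g))),
     bcounit = (\<lambda>f. \<Sum>g\<in>carrier G. f g) \<rparr>"

text \<open>The function algebra \<open>k\<^sup>G\<close>; here \<open>delta g\<close> is \<open>e\<^sub>g\<close>, and \<open>\<Delta>(f)(x, y) = f(xy)\<close>.\<close>

definition fun_alg :: "('g, 'm) monoid_scheme \<Rightarrow> ('k::field, 'g) bialg" where
  "fun_alg G = \<lparr>
     basis = carrier G,
     bmul = (\<lambda>f h x. f x * h x),
     bone = (\<lambda>x. if x \<in> carrier G then 1 else 0),
     bcomul = (\<lambda>f (x, y). if x \<in> carrier G \<and> y \<in> carrier G then f (x \<otimes>\<^bsub>G\<^esub> y) else 0),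
     bcounit = (\<lambda>f. f \<one>\<^bsub>G\<^esub>) \<rparr>"

text \<open>\<open>A(G, S, \<alpha>)\<close>; maps \<open>G \<rightarrow> k\<^sub>\<alpha>S\<close> are extended by zero outside \<open>G\<close>.\<close>

definition galois_object ::
  "('g, 'm) monoid_scheme \<Rightarrow> 'g set \<Rightarrow> ('g \<Rightarrow> 'g \<Rightarrow> 'k::field)
     \<Rightarrow> ('k, 'g \<Rightarrow> 'g \<Rightarrow> 'k, 'g) comod_alg"
where
  "galois_object G S \<alpha> = (let K = G\<lparr>carrier := S\<rparr> in \<lparr>
     ca_carrier = {f. (\<forall>g\<in>carrier G. f g \<in> coord_space S) \<and>
                      (\<forall>g. g \<notin> carrier G \<longrightarrow> f g = 0) \<and>
                      (\<forall>s\<in>S. \<forall>g\<in>carrier G. f (s \<otimes>\<^bsub>G\<^esub> g) = twisted_action K \<alpha> s (f g))},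
     ca_scale = (\<lambda>c f g. fscale c (f g)),
     ca_mul = (\<lambda>f f' g. twisted_mul K \<alpha> (f g) (f' g)),
     ca_one = (\<lambda>g. if g \<in> carrier G then twisted_one K \<alpha> else 0),
     ca_coact = (\<lambda>f g h. if h \<in> carrier G then f (h \<otimes>\<^bsub>G\<^esub> g) else 0) \<rparr>)"

text \<open>
  The element of \<open>kG \<otimes> kG = (k\<^sup>G \<otimes> k\<^sup>G)\<^sup>*\<close> corresponding to \<open>\<sigma>\<close>
\<close>

definition twist_of_cocycle ::
  "('g, 'm) monoid_scheme \<Rightarrow> (('g \<Rightarrow> 'k) \<Rightarrow> ('g \<Rightarrow> 'k) \<Rightarrow> 'k::field) \<Rightarrow> 'g \<times> 'g \<Rightarrow> 'k"
where
  "twist_of_cocycle G \<sigma> =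
     (\<Sum>g\<in>carrier G. \<Sum>h\<in>carrier G. fscale (\<sigma> (delta g) (delta h)) (tensor (delta g) (delta h)))"

text \<open>
  The cocycle \<open>\<sigma>\<close>, and hence the twist, is determined by \<open>(S, \<alpha>)\<close> only up to gauge equivalence,
  so this is a relation.
\<close>

definition associated_twist ::
  "('g, 'm) monoid_scheme \<Rightarrow> 'g set \<Rightarrow> ('g \<Rightarrow> 'g \<Rightarrow> 'k::field) \<Rightarrow> ('g \<times> 'g \<Rightarrow> 'k) \<Rightarrow> bool"
where
  "associated_twist G S \<alpha> J \<longleftrightarrow>
     (\<exists>\<sigma>. hopf_2cocycle (fun_alg G) \<sigma> \<and>
          convolution_invertible (fun_alg G) \<sigma> \<and>
          comod_alg_iso (fun_alg G) (galois_object G S \<alpha>) (cleft_object (fun_alg G) \<sigma>) \<and>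
          J = twist_of_cocycle G \<sigma>)"

end

theory Submission
  imports Defs "HOL-Library.Poly_Mapping" "HOL-Library.Product_Plus"
begin

text \<open>
  Let \<open>\<chi>\<close> be the sign character, \<open>u = (id \<otimes> \<chi>) J\<close> and \<open>v = (\<chi> \<otimes> id) J\<close>, and let
  \<open>\<theta>\<^sub>R = (id \<otimes> \<chi>) \<Delta>\<^sub>J\<close>, \<open>\<theta>\<^sub>L = (\<chi> \<otimes> id) \<Delta>\<^sub>J\<close>, which are commuting involutive algebra automorphisms:
  multiplication by \<open>\<chi>\<close> followed by conjugation with \<open>u\<close>, respectively \<open>v\<close>. The Hopf algebra
  \<open>(k\<S>\<^sub>n)\<^sup>J\<close> is simple iff \<open>u \<noteq> v\<close>.

  If \<open>u = v\<close>, then \<open>\<theta>\<^sub>L = \<theta>\<^sub>R\<close>, and its fixed points form a proper normal Hopf subalgebra.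

  Conversely, let \<open>A\<close> be a normal Hopf subalgebra of \<open>H = (k\<S>\<^sub>n)\<^sup>J\<close>. The ideal \<open>I = HA\<^sup>+ = A\<^sup>+H\<close> is a
  coideal for \<open>\<Delta>\<^sub>J\<close>, hence also for the untwisted \<open>\<Delta>\<close>, so \<open>N = {g. g - 1 \<in> I}\<close> is a normal subgroup
  of \<open>\<S>\<^sub>n\<close>: it is trivial, \<open>\<S>\<^sub>n\<close> or \<open>\<A>\<^sub>n\<close>. If \<open>N\<close> is trivial, then the functions on \<open>\<S>\<^sub>n\<close> vanishing
  on \<open>I\<close> form a subalgebra separating points, whence \<open>I = 0\<close> and \<open>A = k\<close>. If \<open>N = \<S>\<^sub>n\<close>, a nonzero
  left integral of \<open>A\<close> is a multiple of the sum of all group elements, whose coproduct is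
  nondegenerate, so \<open>A = H\<close>. If \<open>N = \<A>\<^sub>n\<close>, the functions vanishing on \<open>I\<close> are spanned by \<open>1\<close> and \<open>\<chi>\<close>; this
  forces \<open>\<theta>\<^sub>L\<close> and \<open>\<theta>\<^sub>R\<close> to have the same fixed points and hence to be equal. Then \<open>t = v u\<^bsup>-1\<^esup>\<close> is
  central, so \<open>J \<Delta>(t) = (t \<otimes> t) J\<close> makes it group-like for \<open>\<Delta>\<close>: a central element of \<open>\<S>\<^sub>n\<close>, so \<open>u = v\<close>.

  Finally \<open>u = v\<close> says that \<open>\<chi>\<close>, as an element of the cleft object \<open>(k\<^sup>G)\<^bsup>(\<sigma>)\<^esup>\<close>, is central. In
  \<open>A(G,S,\<alpha>)\<close> the element \<open>\<chi>\<close> corresponds to a function with \<open>f(g) = \<chi>(g) f(1)\<close>. If it is central, then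
  \<open>f(1)\<close> is central in \<open>k\<^sub>\<alpha>S\<close>, hence a scalar by non-degeneracy, and \<open>f(s) = s \<rhd> f(1) = f(1)\<close> shows that
  \<open>\<chi>\<close> is trivial on \<open>S\<close>, and conversely.
\<close>

section \<open>Group algebras as finitely supported functions\<close>

text \<open>The given definitions speak of coordinate functions and explicit sums. The argument runs
  instead in the group ring of an additively written group, where the structure maps are linear
  extensions of maps on group elements, so that identities can be checked on group elements; the
  results are carried back along an embedding. \<open>A\<close> is recovered from \<open>I\<close>
  as follows: \<open>A = k + A^+\<close> with \<open>A^+\<close> inside \<open>I\<close> settles
  \<open>I = 0\<close>; if all \<open>g - 1\<close> lie in \<open>I\<close>, an integral of
  \<open>A\<close> is invariant under the whole group, and the left tensor factors of the twisted
  coproduct of the sum of all group elements span \<open>H\<close>. When \<open>N\<close> is the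
  alternating group, the map \<open>thR(h\<^sub>1) S(h\<^sub>2)\<close> vanishes on
  \<open>I\<close>, hence depends on a group element only through \<open>chi\<close>; this gives
  \<open>thR h = p h + q thL h\<close> with \<open>p + q = 1\<close>, so the fixed points of
  \<open>thL\<close> are fixed by \<open>thR\<close>, and symmetrically. Two commuting involutions
  with the same fixed points agree, as is seen on \<open>h + thL h\<close> and
  \<open>h + thR h\<close>.\<close>

text \<open>
  The product on \<open>'g \<Rightarrow>\<^sub>0 'k\<close> is convolution with respect to addition, so that (possibly
  non-commutative) groups are written additively and \<open>'g \<times> 'g \<Rightarrow>\<^sub>0 'k\<close> is the tensor square of the
  group algebra.
\<close>

abbreviation "lookup \<equiv> Poly_Mapping.lookup"
abbreviation "keys \<equiv> Poly_Mapping.keys"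
abbreviation "sg \<equiv> Poly_Mapping.single"

text \<open>Scalars are placed in the algebra as multiples of the identity, so that scaling is ring
  multiplication and linearity can be handled by ring rewriting.\<close>

definition cst :: "'k::semiring_1 \<Rightarrow> 'g::monoid_add \<Rightarrow>\<^sub>0 'k" where
  "cst c = sg 0 c"

abbreviation pt :: "'g \<Rightarrow> 'g \<Rightarrow>\<^sub>0 'k::{zero,one}" where
  "pt g \<equiv> sg g 1"

definition lin :: "('a \<Rightarrow> 'b::monoid_add \<Rightarrow>\<^sub>0 'k::semiring_1) \<Rightarrow> ('a \<Rightarrow>\<^sub>0 'k) \<Rightarrow> 'b \<Rightarrow>\<^sub>0 'k" where
  "lin F x = (\<Sum>a\<in>keys x. cst (lookup x a) * F a)"

definition klin :: "(('a::monoid_add \<Rightarrow>\<^sub>0 'k::semiring_1) \<Rightarrow> ('b::monoid_add \<Rightarrow>\<^sub>0 'k)) \<Rightarrow> bool" where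
  "klin f \<longleftrightarrow> (\<forall>x y. f (x + y) = f x + f y) \<and> (\<forall>c x. f (cst c * x) = cst c * f x)"

text \<open>Weighted pushforward along \<open>f\<close>. For additive \<open>f\<close> and
  multiplicative \<open>w\<close> it is an algebra map; inclusions of tensor factors, diagonals,
  multiplication by a character and slices by a character are all of this form.\<close>

definition wmap :: "('a \<Rightarrow> 'b) \<Rightarrow> ('a \<Rightarrow> 'k) \<Rightarrow> ('a \<Rightarrow>\<^sub>0 'k::semiring_1) \<Rightarrow> 'b::monoid_add \<Rightarrow>\<^sub>0 'k" where
  "wmap f w = lin (\<lambda>a. sg (f a) (w a))"

abbreviation mp :: "('a \<Rightarrow> 'b) \<Rightarrow> ('a \<Rightarrow>\<^sub>0 'k::semiring_1) \<Rightarrow> 'b::monoid_add \<Rightarrow>\<^sub>0 'k" where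
  "mp f \<equiv> wmap f (\<lambda>_. 1)"

text \<open>The pairing of a function on the group with an element of its group algebra; the
  constant function 1 gives the counit.\<close>

definition aug :: "('a \<Rightarrow> 'k) \<Rightarrow> ('a \<Rightarrow>\<^sub>0 'k::semiring_1) \<Rightarrow> 'k" where
  "aug w x = (\<Sum>a\<in>keys x. lookup x a * w a)"

lemma cst_0 [simp]: "cst 0 = 0" and cst_1 [simp]: "cst 1 = 1"
  and cst_add: "cst (a + b) = cst a + cst b"
  and cst_mult: "cst (a * b) = cst a * cst b"
  by (simp_all add: cst_def single_add mult_single)

lemma cst_sum: "cst (sum h A) = (\<Sum>a\<in>A. cst (h a))"
  by (induction A rule: infinite_finite_induct) (simp_all add: cst_add)

lemma cst_uminus: "cst (- a) = - cst (a :: 'k :: ring_1)"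
  and cst_diff: "cst (a - b) = cst a - cst (b :: 'k :: ring_1)"
  by (simp_all add: cst_def single_uminus single_diff)

lemma cst_mult_single [simp]: "cst c * sg a d = sg a (c * d)"
  by (simp add: cst_def mult_single)

lemma single_mult_cst [simp]: "sg a d * cst c = sg a (d * c)"
  by (simp add: cst_def mult_single)

lemma cst_pt: "sg a c = cst c * pt a"
  by simp

lemma pt_mult: "pt a * pt b = (pt (a + b) :: 'g::monoid_add \<Rightarrow>\<^sub>0 'k::semiring_1)"
  by (simp add: mult_single)

lemma lookup_cst_mult [simp]: "lookup (cst c * x) a = c * lookup x a"
  unfolding cst_def
proof -
  have "{l. \<exists>q. lookup (sg 0 c) l * (lookup x q when a = l + q) \<noteq> 0} \<subseteq> {0}"
    by (auto simp: lookup_single when_def split: if_splits)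
  show "lookup (sg 0 c * x) a = c * lookup x a"
    by (simp add: lookup_mult lookup_single when_mult when_def if_distrib[of "\<lambda>x. x * _"] cong: if_cong)
qed

lemma poly_as_sum: "x = (\<Sum>a\<in>keys x. sg a (lookup x a))"
  by (rule poly_mapping_eqI)
     (auto simp: lookup_sum lookup_single when_def in_keys_iff sum.delta)

lemma poly_sum_superset:
  assumes "finite A" "keys x \<subseteq> A"
  shows "x = (\<Sum>a\<in>A. sg a (lookup x a))"
proof -
  have "(\<Sum>a\<in>A. sg a (lookup x a)) = (\<Sum>a\<in>keys x. sg a (lookup x a))"
    using assms by (intro sum.mono_neutral_right) (auto simp: in_keys_iff)
  then show ?thesis using poly_as_sum by metis
qed

lemma lin_superset:
  assumes "finite A" "keys x \<subseteq> A"
  shows "lin F x = (\<Sum>a\<in>A. cst (lookup x a) * F a)"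
  unfolding lin_def using assms by (intro sum.mono_neutral_left) (auto simp: in_keys_iff)

lemma lin_add: "lin F (x + y) = lin F x + lin F y"
proof -
  let ?A = "keys x \<union> keys y"
  have "lin F (x + y) = (\<Sum>a\<in>?A. cst (lookup (x + y) a) * F a)"
    by (rule lin_superset) (use keys_add[of x y] in auto)
  also have "\<dots> = lin F x + lin F y"
    by (simp add: lin_superset[of ?A] lookup_add cst_add distrib_right sum.distrib)
  finally show ?thesis .
qed

lemma keys_cst_mult: "keys (cst c * x) \<subseteq> keys x"
  by (auto simp: in_keys_iff)

lemma lin_cst_mult: "lin F (cst c * x) = cst c * lin F x"
proof -
  have "lin F (cst c * x) = (\<Sum>a\<in>keys x. cst (lookup (cst c * x) a) * F a)"
    by (rule lin_superset) (use keys_cst_mult in auto)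
  then show ?thesis by (simp add: lin_def cst_mult sum_distrib_left mult.assoc)
qed

lemma lin_single [simp]: "lin F (sg a c) = cst c * F a"
  by (cases "c = 0") (auto simp: lin_def)

lemma lin_0 [simp]: "lin F 0 = 0"
  by (simp add: lin_def)

lemma klin_lin [intro!]: "klin (lin F)"
  by (simp add: klin_def lin_add lin_cst_mult)

lemma klin_wmap [intro!]: "klin (wmap f w)"
  unfolding wmap_def by (rule klin_lin)

lemma klinI: "(\<And>x y. f (x + y) = f x + f y) \<Longrightarrow> (\<And>c x. f (cst c * x) = cst c * f x) \<Longrightarrow> klin f"
  by (simp add: klin_def)

lemma klin_add: "klin f \<Longrightarrow> f (x + y) = f x + f y"
  and klin_cst: "klin f \<Longrightarrow> f (cst c * x) = cst c * f x"
  by (simp_all add: klin_def)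

lemma klin_0: "klin f \<Longrightarrow> f 0 = 0"
  using klin_cst[of f 0 0] by simp

lemma klin_sum: "klin f \<Longrightarrow> f (sum h A) = (\<Sum>a\<in>A. f (h a))"
  by (induction A rule: infinite_finite_induct) (auto simp: klin_add klin_0)

lemma klin_uminus: "klin f \<Longrightarrow> f (- x) = - f (x :: 'a::monoid_add \<Rightarrow>\<^sub>0 'k::ring_1)"
  using klin_add[of f x "-x"] klin_0[of f] by (simp add: minus_unique)

lemma klin_diff: "klin f \<Longrightarrow> f (x - y) = f x - f (y :: 'a::monoid_add \<Rightarrow>\<^sub>0 'k::ring_1)"
  using klin_add[of f x "-y"] klin_uminus[of f y] by simp

lemma klin_single: "klin f \<Longrightarrow> f (sg a c) = cst c * f (pt a)"
  using klin_cst[of f c "pt a"] by simp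

lemma klin_expand: "klin f \<Longrightarrow> f x = lin (\<lambda>a. f (pt a)) x"
proof -
  assume f: "klin f"
  have "f x = (\<Sum>a\<in>keys x. f (sg a (lookup x a)))"
    by (subst poly_as_sum[of x]) (rule klin_sum[OF f])
  also have "\<dots> = lin (\<lambda>a. f (pt a)) x"
    unfolding lin_def by (intro sum.cong refl klin_single[OF f])
  finally show ?thesis .
qed

text \<open>Only points in the support of \<open>x\<close> are compared, which makes information
  about where \<open>x\<close> is supported available at each point.\<close>

lemma klin_eqI:
  assumes "klin f" "klin g" "\<And>a. a \<in> keys x \<Longrightarrow> f (pt a) = g (pt a)"
  shows "f x = g x"
  unfolding klin_expand[OF assms(1), of x] klin_expand[OF assms(2), of x] lin_def
  by (intro sum.cong refl) (simp add: assms(3))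

lemma cst_comm: "cst c * x = x * cst (c :: 'k :: comm_semiring_1)"
proof -
  have "klin (\<lambda>x. cst c * x)"
    by (rule klinI) (simp_all add: distrib_left mult.assoc[symmetric] flip: cst_mult, simp add: mult.commute)
  moreover have "klin (\<lambda>x. x * cst c)"
    by (rule klinI) (simp_all add: distrib_right mult.assoc)
  ultimately show ?thesis by (rule klin_eqI[where x = x]) simp
qed

lemma klin_id [intro!]: "klin (\<lambda>x. x)"
  by (simp add: klin_def)

lemma klin_comp: "klin f \<Longrightarrow> klin g \<Longrightarrow> klin (\<lambda>x. f (g x))"
  by (simp add: klin_def)

lemma klin_plus [intro!]: "klin f \<Longrightarrow> klin g \<Longrightarrow> klin (\<lambda>x. f x + g x)"
  by (simp add: klin_def algebra_simps)

lemma klin_mult_right [intro!]: "klin f \<Longrightarrow> klin (\<lambda>x. f x * y)"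
  by (simp add: klin_def algebra_simps)

lemma klin_mult_left [intro!]: "klin f \<Longrightarrow> klin (\<lambda>x. y * f x :: _ \<Rightarrow>\<^sub>0 'k::comm_semiring_1)"
  by (simp add: klin_def distrib_left) (metis cst_comm mult.assoc)

lemma klin_zero [intro!]: "klin (\<lambda>x. 0)"
  by (simp add: klin_def)

lemma klin_sum' [intro!]: "(\<And>i. i \<in> A \<Longrightarrow> klin (f i)) \<Longrightarrow> klin (\<lambda>x. \<Sum>i\<in>A. f i x)"
  by (induction A rule: infinite_finite_induct) auto

lemma klin_lin' [intro!]:
  fixes F :: "'x \<Rightarrow> ('a::monoid_add \<Rightarrow>\<^sub>0 'k::comm_semiring_1) \<Rightarrow> ('b::monoid_add \<Rightarrow>\<^sub>0 'k)"
  shows "(\<And>i. klin (F i)) \<Longrightarrow> klin (\<lambda>x. lin (\<lambda>i. F i x) y)"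
  unfolding lin_def by auto

lemma wmap_single [simp]: "wmap f w (sg a c) = sg (f a) (c * w a)"
  by (simp add: wmap_def)

lemma lin_wmap: "lin F (wmap f w x) = lin (\<lambda>a. cst (w a) * F (f a)) (x :: 'a::monoid_add \<Rightarrow>\<^sub>0 'k::semiring_1)"
  by (rule klin_eqI[where x = x]) (auto intro: klin_comp)

lemma wmap_wmap: "wmap g w' (wmap f w x) = wmap (\<lambda>a. g (f a)) (\<lambda>a. w a * w' (f a)) (x :: 'a::monoid_add \<Rightarrow>\<^sub>0 'k::semiring_1)"
  unfolding wmap_def[of g] by (simp add: lin_wmap) (simp add: wmap_def)

lemma wmap_id [simp]: "mp (\<lambda>a. a) x = x"
  by (rule klin_eqI[where x = x]) auto

lemma wmap_mult:
  assumes "\<And>a b. f (a + b) = f a + f b" "\<And>a b. w (a + b) = w a * w b"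
  shows "wmap f w (x * y) = wmap f w x * wmap f (w :: _ \<Rightarrow> 'k :: comm_semiring_1) y"
proof (rule klin_eqI[where x = x])
  show "klin (\<lambda>x. wmap f w (x * y))"
    by (rule klin_comp[of "wmap f w"]) auto
  show "wmap f w (pt a * y) = wmap f w (pt a) * wmap f w y" for a
  proof (rule klin_eqI[where x = y])
    show "klin (\<lambda>y. wmap f w (pt a * y))"
      by (rule klin_comp[of "wmap f w"]) auto
  qed (auto simp: mult_single assms)
qed auto

lemma wmap_antimult:
  assumes "\<And>a b. f (a + b) = f b + f a" "\<And>a b. w (a + b) = w a * w b"
  shows "wmap f w (x * y) = wmap f w y * wmap f (w :: _ \<Rightarrow> 'k :: comm_semiring_1) x"
proof (rule klin_eqI[where x = x])
  show "klin (\<lambda>x. wmap f w (x * y))"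
    by (rule klin_comp[of "wmap f w"]) auto
  show "wmap f w (pt a * y) = wmap f w y * wmap f w (pt a)" for a
  proof (rule klin_eqI[where x = y])
    show "klin (\<lambda>y. wmap f w (pt a * y))"
      by (rule klin_comp[of "wmap f w"]) auto
  qed (auto simp: mult_single assms mult.commute)
qed auto

lemma aug_superset:
  assumes "finite A" "keys x \<subseteq> A"
  shows "aug w x = (\<Sum>a\<in>A. lookup x a * w a)"
  unfolding aug_def using assms by (intro sum.mono_neutral_left) (auto simp: in_keys_iff)

lemma cst_aug: "cst (aug w x) = wmap (\<lambda>_. 0) w x"
proof -
  have "cst (aug w x) = (\<Sum>a\<in>keys x. cst (lookup x a * w a))"
    by (simp add: aug_def cst_sum)
  then show ?thesis by (simp add: wmap_def lin_def) (simp add: cst_def)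
qed

lemma cst_inj [simp]: "cst a = cst b \<longleftrightarrow> a = b"
  by (metis cst_def lookup_single_eq)

section \<open>Coproduct, antipode and the two-sided action on the group algebra\<close>

definition comul :: "('g::monoid_add \<Rightarrow>\<^sub>0 'k::semiring_1) \<Rightarrow> 'g \<times> 'g \<Rightarrow>\<^sub>0 'k" where
  "comul = mp (\<lambda>g. (g, g))"

definition gS :: "('g::group_add \<Rightarrow>\<^sub>0 'k::semiring_1) \<Rightarrow> 'g \<Rightarrow>\<^sub>0 'k" where
  "gS = mp uminus"

abbreviation eps :: "('g \<Rightarrow>\<^sub>0 'k::semiring_1) \<Rightarrow> 'k" where
  "eps \<equiv> aug (\<lambda>_. 1)"

definition tens :: "('g::monoid_add \<Rightarrow>\<^sub>0 'k::semiring_1) \<Rightarrow> ('h::monoid_add \<Rightarrow>\<^sub>0 'k) \<Rightarrow> 'g \<times> 'h \<Rightarrow>\<^sub>0 'k" where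
  "tens x y = mp (\<lambda>a. (a, 0)) x * mp (\<lambda>b. (0, b)) y"

text \<open>Here \<open>a \<otimes> b\<close> acts on \<open>z\<close> by \<open>a z b^-1\<close>,
  and in \<open>ract\<close> from the right by \<open>a^-1 z b\<close>. Both are actions of the
  algebra \<open>kG \<otimes> kG\<close>; applying \<open>J\<close> or its inverse to 1 gives the
  elements by which the antipode of the twist has to be corrected.\<close>

definition act :: "('g::group_add \<times> 'g \<Rightarrow>\<^sub>0 'k::comm_semiring_1) \<Rightarrow> ('g \<Rightarrow>\<^sub>0 'k) \<Rightarrow> 'g \<Rightarrow>\<^sub>0 'k" where
  "act X z = lin (\<lambda>(a, b). pt a * z * pt (- b)) X"

definition ract :: "('g::group_add \<Rightarrow>\<^sub>0 'k::comm_semiring_1) \<Rightarrow> ('g \<times> 'g \<Rightarrow>\<^sub>0 'k) \<Rightarrow> 'g \<Rightarrow>\<^sub>0 'k" where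
  "ract z X = lin (\<lambda>(a, b). pt (- a) * z * pt b) X"

text \<open>Thus \<open>in12 J\<close> is \<open>J \<otimes> 1\<close> and \<open>in23 J\<close> is
  \<open>1 \<otimes> J\<close>, while \<open>dup12\<close> and \<open>dup23\<close> are
  \<open>\<Delta> \<otimes> id\<close> and \<open>id \<otimes> \<Delta>\<close>.\<close>

abbreviation "in12 \<equiv> mp (\<lambda>(a, b). (a, b, 0))"
abbreviation "in23 \<equiv> mp (Pair 0)"
abbreviation "dup12 \<equiv> mp (\<lambda>(a, b). (a, a, b))"
abbreviation "dup23 \<equiv> mp (\<lambda>(a, b). (a, b, b))"

lemma klin_comul [intro!]: "klin comul"
  and klin_gS [intro!]: "klin gS"
  unfolding comul_def gS_def by auto

lemma klin_act [intro!]: "klin (act X)" "klin (\<lambda>X. act X z)"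
  and klin_ract [intro!]: "klin (ract z)" "klin (\<lambda>z. ract z X)"
  unfolding act_def[abs_def] ract_def[abs_def] by (auto split: prod.splits)

lemma comul_sg [simp]: "comul (sg a c) = sg (a, a) c"
  by (simp add: comul_def)

lemma gS_sg [simp]: "gS (sg a c) = sg (- a) c"
  by (simp add: gS_def)

lemma act_sg [simp]: "act (sg (a, b) c) z = cst c * (pt a * z * pt (- b))"
  and ract_sg [simp]: "ract z (sg (a, b) c) = cst c * (pt (- a) * z * pt b)"
  by (simp_all add: act_def ract_def)

lemma tens_pt [simp]: "tens (pt a) (pt b) = pt (a, b)"
  by (simp add: tens_def mult_single)

lemma klin_tens [intro!]: "klin (\<lambda>x. tens x y)" "klin (\<lambda>y. tens x (y :: _ \<Rightarrow>\<^sub>0 'k::comm_semiring_1))"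
  unfolding tens_def by auto

lemma klin2_eqI:
  assumes "\<And>y. klin (\<lambda>x. f x y)" "\<And>x. klin (f x)" "\<And>y. klin (\<lambda>x. g x y)" "\<And>x. klin (g x)"
    "\<And>a b. f (pt a) (pt b) = g (pt a) (pt b)"
  shows "f x y = g x y"
  by (rule klin_eqI[of "\<lambda>x. f x y"]; (rule assms)?) (rule klin_eqI[of "f _"]; (rule assms)?)

lemma comul_mult: "comul (x * y) = comul x * (comul y :: _ \<Rightarrow>\<^sub>0 'k::comm_semiring_1)"
  unfolding comul_def by (rule wmap_mult) auto

lemma wmap_1: "f 0 = 0 \<Longrightarrow> w 0 = 1 \<Longrightarrow> wmap f w 1 = 1"
  by (subst single_one[symmetric], subst wmap_single) simp

lemma comul_1 [simp]: "comul 1 = 1"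
  unfolding comul_def by (rule wmap_1) (simp_all add: zero_prod_def)

lemma gS_mult: "gS (x * y) = gS y * gS (x :: _ \<Rightarrow>\<^sub>0 'k::comm_semiring_1)"
  unfolding gS_def by (rule wmap_antimult) (auto simp: minus_add)

lemma gS_1 [simp]: "gS 1 = 1"
  unfolding gS_def by (rule wmap_1) auto

lemma gS_gS [simp]: "gS (gS x) = x"
  unfolding gS_def by (simp add: wmap_wmap)

lemma pt_diff: "pt (a - b) = pt a * (pt (- b) :: 'g::group_add \<Rightarrow>\<^sub>0 'k::semiring_1)"
  by (simp add: mult_single)

lemma act_mult: "act (X * Y) z = act X (act Y z)"
proof (rule klin2_eqI[of "\<lambda>X Y. act (X * Y) z" "\<lambda>X Y. act X (act Y z)"])
  fix a b :: "'a \<times> 'a"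
  show "act (pt a * pt b) z = act (pt a) (act (pt b) z)"
    by (cases a; cases b) (simp add: mult_single minus_add del: add_uminus_conv_diff, simp add: mult.assoc pt_diff flip: pt_mult)
qed (auto intro: klin_comp)

lemma ract_mult: "ract z (X * Y) = ract (ract z X) Y"
proof (rule klin2_eqI[of "\<lambda>X Y. ract z (X * Y)" "\<lambda>X Y. ract (ract z X) Y"])
  fix a b :: "'a \<times> 'a"
  show "ract z (pt a * pt b) = ract (ract z (pt a)) (pt b)"
    by (cases a; cases b) (simp add: mult_single minus_add del: add_uminus_conv_diff, simp add: mult.assoc pt_diff flip: pt_mult)
next
  show "klin (\<lambda>X. ract (ract z X) Y)" for Y
    by (rule klin_comp[of "\<lambda>z. ract z Y"]) auto
qed (auto intro: klin_comp)

lemma act_tens: "act (tens x y) z = x * z * gS y"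
  by (rule klin2_eqI[of "\<lambda>x y. act (tens x y) z"]) (auto intro: klin_comp)

lemma act_comul_1: "act (comul x) 1 = cst (eps x)"
  unfolding cst_aug by (rule klin_eqI[where x = x]) (auto intro: klin_comp simp: pt_mult)

lemma ract_comul_1: "ract 1 (comul x) = cst (eps x)"
  unfolding cst_aug by (rule klin_eqI[where x = x]) (auto intro: klin_comp simp: pt_mult)

lemma aug_0 [simp]: "aug w 0 = 0"
  by (simp add: aug_def)

lemma aug_sg [simp]: "aug w (sg a c) = c * w a"
  by (cases "c = 0") (simp_all add: aug_def)

lemma aug_add: "aug w (x + y) = aug w x + aug w (y :: _::monoid_add \<Rightarrow>\<^sub>0 'k::comm_semiring_1)"
  using klin_add[OF klin_wmap[of "\<lambda>_. 0 :: nat" w], of x y] by (simp flip: cst_aug cst_add)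

lemma aug_diff: "aug w (x - y) = aug w x - aug w (y :: _::monoid_add \<Rightarrow>\<^sub>0 'k::comm_ring_1)"
  using klin_diff[OF klin_wmap[of "\<lambda>_. 0 :: nat" w], of x y] by (simp flip: cst_aug cst_diff)

lemma aug_cst_mult: "aug w (cst c * x) = c * aug w (x :: _::monoid_add \<Rightarrow>\<^sub>0 'k::comm_semiring_1)"
  using klin_cst[OF klin_wmap[of "\<lambda>_. 0 :: nat" w], of c x] by (simp flip: cst_aug cst_mult)

lemma aug_mult:
  assumes "\<And>a b. w (a + b) = w a * w b"
  shows "aug w (x * y) = aug w x * aug w (y :: _::monoid_add \<Rightarrow>\<^sub>0 'k::comm_semiring_1)"
  using wmap_mult[of "\<lambda>_. 0 :: nat" w x y] assms by (simp flip: cst_aug cst_mult)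

lemma aug_wmap: "aug w (wmap f w' x) = aug (\<lambda>a. w' a * w (f a)) (x :: _::monoid_add \<Rightarrow>\<^sub>0 'k::comm_semiring_1)"
  using wmap_wmap[of "\<lambda>_. 0 :: nat" w f w' x] by (simp flip: cst_aug)

lemma aug_1: "w 0 = 1 \<Longrightarrow> aug w 1 = 1"
  by (metis aug_sg mult_1 single_one)

text \<open>The two composites of these maps below carry the proof that
  \<open>act J 1\<close> and \<open>ract 1 J\<inverse>\<close> are inverse to each other.\<close>

lemma alt_sum_in:
  "mp (\<lambda>(x, y, z). x - y + z) (in23 Y * in12 X) = act X 1 * ract 1 (Y :: _ \<Rightarrow>\<^sub>0 'k::comm_semiring_1)"
  (is "?f X Y = ?g X Y")
proof (rule klin2_eqI[of ?f ?g])
  show "?f (pt a) (pt b) = ?g (pt a) (pt b)" for a b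
    by (cases a; cases b) (simp add: mult_single, ((simp only: diff_conv_add_uminus minus_add)?, simp only: add.assoc minus_add_cancel add_minus_cancel minus_minus)?)
qed (auto intro!: klin_mult_right klin_mult_left klin_comp[of "mp (\<lambda>(x, y, z). x - y + z)"])

text \<open>For basis elements \<open>(a, b)\<close> and \<open>(c, d)\<close> the product is
  \<open>(a + c, b + c, b + d)\<close>, whose alternating sum telescopes to \<open>a + d\<close>.
  The alternating sum is not additive in a non-commutative group, so the order of the factors
  matters.\<close>

lemma alt_sum_dup:
  "mp (\<lambda>(x, y, z). x - y + z) (dup23 X * dup12 Y) = mp fst X * mp snd (Y :: 'g::group_add \<times> 'g \<Rightarrow>\<^sub>0 'k::comm_semiring_1)"
  (is "?f X Y = ?g X Y")
proof (rule klin2_eqI[of ?f ?g])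
  show "?f (pt a) (pt b) = ?g (pt a) (pt b)" for a b
    by (cases a; cases b) (simp add: mult_single, ((simp only: diff_conv_add_uminus minus_add)?, simp only: add.assoc minus_add_cancel add_minus_cancel minus_minus)?)
qed (auto intro!: klin_mult_right klin_mult_left klin_comp[of "mp (\<lambda>(x, y, z). x - y + z)"])

lemma alt_sum_in':
  "mp (\<lambda>(x, y, z). - x + y - z) (in12 Y * in23 X) = ract 1 Y * act X (1 :: _ \<Rightarrow>\<^sub>0 'k::comm_semiring_1)"
  (is "?f X Y = ?g X Y")
proof (rule klin2_eqI[of ?f ?g])
  show "?f (pt a) (pt b) = ?g (pt a) (pt b)" for a b
    by (cases a; cases b) (simp add: mult_single, ((simp only: diff_conv_add_uminus minus_add)?, simp only: add.assoc minus_add_cancel add_minus_cancel minus_minus)?)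
qed (auto intro!: klin_mult_right klin_mult_left klin_comp[of "mp (\<lambda>(x, y, z). - x + y - z)"])

lemma alt_sum_dup':
  "mp (\<lambda>(x, y, z). - x + y - z) (dup12 X * dup23 Y) = gS (mp fst Y) * gS (mp snd (X :: _ \<Rightarrow>\<^sub>0 'k::comm_semiring_1))"
  (is "?f X Y = ?g X Y")
proof (rule klin2_eqI[of ?f ?g])
  show "?f (pt a) (pt b) = ?g (pt a) (pt b)" for a b
    by (cases a; cases b) (simp add: mult_single, ((simp only: diff_conv_add_uminus minus_add)?, simp only: add.assoc minus_add_cancel add_minus_cancel minus_minus)?)
qed (auto intro!: klin_mult_right klin_mult_left klin_comp[of "mp (\<lambda>(x, y, z). - x + y - z)"] klin_comp[of gS])

lemma mult_eq_1_cancel: "a * b = 1 \<Longrightarrow> a * (b * c) = (c :: 'a :: monoid_mult)"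
  by (simp flip: mult.assoc)

lemma mult_left_comm_if: "a * b = b * a \<Longrightarrow> a * (b * c) = b * (a * (c :: 'a :: monoid_mult))"
  by (simp flip: mult.assoc)

text \<open>The ambient group is a whole type and may be infinite; the group algebra of a finite
  subgroup is the subspace of elements supported in it.\<close>

definition supp :: "'g set \<Rightarrow> ('g \<Rightarrow>\<^sub>0 'k::zero) set" where
  "supp A = {x. keys x \<subseteq> A}"

section \<open>Twisted comultiplications\<close>

locale twist =
  fixes G :: "'g::group_add set"
    and chi :: "'g \<Rightarrow> 'k::field_char_0"
    and J J' :: "'g \<times> 'g \<Rightarrow>\<^sub>0 'k"
  assumes finite_G: "finite G"
    and zero_G: "0 \<in> G"
    and add_G: "a \<in> G \<Longrightarrow> b \<in> G \<Longrightarrow> a + b \<in> G"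
    and uminus_G: "a \<in> G \<Longrightarrow> - a \<in> G"
    and J_supp: "J \<in> supp (G \<times> G)"
    and J'_supp: "J' \<in> supp (G \<times> G)"
    and J_J' [simp]: "J * J' = 1"
    and J'_J [simp]: "J' * J = 1"
    and cocycle: "in12 J * dup12 J = in23 J * dup23 J"
    and counit_J: "mp fst J = 1" "mp snd J = 1"
    and chi_add: "chi (a + b) = chi a * chi b"
    and chi_sq [simp]: "chi a * chi a = 1"
begin

lemma chi_0 [simp]: "chi 0 = 1"
  by (metis add.right_neutral chi_add chi_sq)

lemma chi_uminus [simp]: "chi (- a) = chi a"
proof -
  have "chi (- a) * chi a * chi a = chi a"
    by (simp flip: chi_add)
  then show ?thesis by (simp add: mult.assoc)
qed

text \<open>\<open>Q\<close> is \<open>J\<close> with its second factor inverted and multiplied onto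
  the first, the usual element by which a twist changes the antipode. \<open>Sj\<close> is the
  antipode for \<open>D\<close>; \<open>Si\<close> is its inverse, obtained from the fact that
  \<open>gS\<close> is an involution.\<close>

definition D where "D x = J * comul x * J'"
definition Q where "Q = act J 1"
definition Qi where "Qi = ract 1 J'"
definition Sj where "Sj x = Q * gS x * Qi"
definition Si where "Si x = gS (Qi * x * Q)"

lemma hom_simps:
  "in12 (x * y) = in12 x * in12 (y :: _ \<Rightarrow>\<^sub>0 'k)" "in23 (x * y) = in23 x * in23 (y :: _ \<Rightarrow>\<^sub>0 'k)"
  "dup12 (x * y) = dup12 x * dup12 (y :: _ \<Rightarrow>\<^sub>0 'k)" "dup23 (x * y) = dup23 x * dup23 (y :: _ \<Rightarrow>\<^sub>0 'k)"
  "mp fst (x * y) = mp fst x * mp fst (y :: _ \<Rightarrow>\<^sub>0 'k)" "mp snd (x * y) = mp snd x * mp snd (y :: _ \<Rightarrow>\<^sub>0 'k)"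
  for x y :: "'g \<times> 'g \<Rightarrow>\<^sub>0 'k"
  by (rule wmap_mult; auto)+

lemma hom_1 [simp]:
  "in12 (1 :: 'g \<times> 'g \<Rightarrow>\<^sub>0 'k) = 1" "in23 (1 :: 'g \<times> 'g \<Rightarrow>\<^sub>0 'k) = 1"
  "dup12 (1 :: 'g \<times> 'g \<Rightarrow>\<^sub>0 'k) = 1" "dup23 (1 :: 'g \<times> 'g \<Rightarrow>\<^sub>0 'k) = 1"
  "mp fst (1 :: 'g \<times> 'g \<Rightarrow>\<^sub>0 'k) = 1" "mp snd (1 :: 'g \<times> 'g \<Rightarrow>\<^sub>0 'k) = 1"
  by (rule wmap_1; simp add: zero_prod_def)+

lemma counit_J': "mp fst J' = 1" "mp snd J' = 1"
  using hom_simps(5,6)[of J J'] counit_J by simp_all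

lemma in_J_inv [simp]: "in12 J' * in12 J = 1" "in12 J * in12 J' = 1" "in23 J' * in23 J = 1" "in23 J * in23 J' = 1"
  "dup12 J' * dup12 J = 1" "dup12 J * dup12 J' = 1" "dup23 J' * dup23 J = 1" "dup23 J * dup23 J' = 1"
  by (simp_all flip: hom_simps)

lemma cocycle': "in23 J' * in12 J = dup23 J * dup12 J'" "in12 J' * in23 J = dup12 J * dup23 J'"
  and cocycle_inv: "dup12 J' * in12 J' = dup23 J' * in23 J'"
proof -
  note cancel = in_J_inv[THEN mult_eq_1_cancel]
  have "in23 J' * in12 J = in23 J' * (in12 J * dup12 J) * dup12 J'"
    by (simp add: mult.assoc)
  also have "\<dots> = dup23 J * dup12 J'"
    by (simp add: cocycle cancel mult.assoc)
  finally show "in23 J' * in12 J = dup23 J * dup12 J'" .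
  have "in12 J' * in23 J = in12 J' * (in23 J * dup23 J) * dup23 J'"
    by (simp add: mult.assoc)
  also have "\<dots> = dup12 J * dup23 J'"
    by (simp add: cocycle[symmetric] cancel mult.assoc)
  finally show "in12 J' * in23 J = dup12 J * dup23 J'" .
  have "dup12 J' * in12 J' = dup12 J' * in12 J' * (in23 J * dup23 J) * (dup23 J' * in23 J')"
    by (simp add: mult.assoc cancel)
  also have "\<dots> = dup23 J' * in23 J'"
    by (simp add: cocycle[symmetric] cancel mult.assoc)
  finally show "dup12 J' * in12 J' = dup23 J' * in23 J'" .
qed

text \<open>The cocycle equation turns \<open>in23 J' * in12 J\<close> into
  \<open>dup23 J * dup12 J'\<close>. The alternating sum sends the first to \<open>Q * Qi\<close>
  and the second to a product of counit slices, which is 1. The other order uses the mirrored pair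
  of identities.\<close>

lemma Q_Qi [simp]: "Q * Qi = 1" and Qi_Q [simp]: "Qi * Q = 1"
  using alt_sum_in[of J' J] alt_sum_dup[of J J'] alt_sum_in'[of J' J] alt_sum_dup'[of J J']
  by (simp_all add: Q_def Qi_def cocycle' counit_J counit_J')

lemma Q_Qi_cancel [simp]: "Q * (Qi * x) = x" "Qi * (Q * x) = x"
  by (simp_all flip: mult.assoc)

lemma J_J'_cancel [simp]: "J * (J' * x) = x" "J' * (J * x) = x"
  by (simp_all flip: mult.assoc)

lemma klin_D [intro!]: "klin D" and klin_Sj [intro!]: "klin Sj" and klin_Si [intro!]: "klin Si"
  unfolding D_def[abs_def] Sj_def[abs_def] Si_def[abs_def]
  by (auto intro: klin_comp[of gS])

lemma D_mult: "D (x * y) = D x * D y"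
  by (simp add: D_def comul_mult mult.assoc)

lemma D_1 [simp]: "D 1 = 1"
  by (simp add: D_def)

lemma Sj_mult: "Sj (x * y) = Sj y * Sj x"
  by (simp add: Sj_def gS_mult mult.assoc)

lemma Sj_1 [simp]: "Sj 1 = 1"
  by (simp add: Sj_def)

lemma Si_Sj [simp]: "Si (Sj x) = x" and Sj_Si [simp]: "Sj (Si x) = x"
  by (simp_all add: Si_def Sj_def mult.assoc)

lemma Si_mult: "Si (x * y) = Si y * Si x"
  by (metis Si_Sj Sj_Si Sj_mult)

lemma counit_D: "mp fst (D x) = x" "mp snd (D x) = x"
  by (simp_all add: D_def hom_simps counit_J counit_J' comul_def wmap_wmap)

lemma eps_D: "eps (D x) = eps x"
proof -
  have "eps (mp fst (D x)) = eps (D x)" by (simp add: aug_wmap)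
  then show ?thesis by (simp add: counit_D)
qed

text \<open>Since \<open>Q\<close> is \<open>J\<close> applied to 1, the trailing \<open>J'\<close>
  of \<open>D h\<close> cancels, and the untwisted coproduct acts on 1 through the counit because
  \<open>g * 1 * g^-1 = 1\<close>.\<close>

lemma act_D: "act (D h) Q = cst (eps h) * Q"
proof -
  have "act (D h) Q = act (J * comul h * (J' * J)) 1"
    by (simp only: D_def Q_def act_mult)
  also have "\<dots> = act J (cst (eps h) * 1)"
    by (simp add: act_mult act_comul_1)
  also have "\<dots> = cst (eps h) * Q"
    unfolding Q_def by (rule klin_cst) auto
  finally show ?thesis .
qed

lemma ract_D: "ract Qi (D h) = cst (eps h) * Qi"
proof -
  have "ract Qi (D h) = ract 1 (J' * J * comul h * J')"
    by (simp only: D_def Qi_def ract_mult mult.assoc)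
  also have "\<dots> = ract (cst (eps h) * 1) J'"
    by (simp add: ract_mult ract_comul_1)
  also have "\<dots> = cst (eps h) * Qi"
    unfolding Qi_def by (rule klin_cst[of "\<lambda>z. ract z J'"]) auto
  finally show ?thesis .
qed

text \<open>These are \<open>D \<otimes> id\<close> and \<open>id \<otimes> D\<close>.\<close>

definition D12 where "D12 X = in12 J * dup12 X * in12 J'"
definition D23 where "D23 X = in23 J * dup23 X * in23 J'"

lemma klin_D12 [intro!]: "klin D12" and klin_D23 [intro!]: "klin D23"
  unfolding D12_def[abs_def] D23_def[abs_def] by auto

text \<open>The outer factors \<open>in12 J * dup12 J\<close> and \<open>dup12 J' * in12 J'\<close>
  are what the cocycle equation and its inverse rewrite; the untwisted coproduct in the middle is
  coassociative.\<close>

lemma coassoc: "D12 (D x) = D23 (D x)"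
proof -
  have eq: "dup12 (comul x) = dup23 (comul x)" by (simp add: comul_def wmap_wmap)
  have "D12 (D x) = (in12 J * dup12 J) * dup12 (comul x) * (dup12 J' * in12 J')"
    by (simp add: D12_def D_def hom_simps mult.assoc)
  also have "\<dots> = (in23 J * dup23 J) * dup23 (comul x) * (dup23 J' * in23 J')"
    by (simp only: cocycle cocycle_inv eq)
  also have "\<dots> = D23 (D x)"
    by (simp add: D23_def D_def hom_simps mult.assoc)
  finally show ?thesis .
qed

lemma D12_tens: "D12 (tens x y) = in12 (D x) * mp (\<lambda>b. (0, 0, b)) y"
  and D23_tens: "D23 (tens x y) = mp (\<lambda>a. (a, 0, 0)) x * in23 (D y)"
proof -
  have comm: "mp (\<lambda>b. (0, 0, b)) y * in12 X = in12 X * mp (\<lambda>b. (0, 0, b)) y"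
    for X :: "'g \<times> 'g \<Rightarrow>\<^sub>0 'k"
    by (rule klin2_eqI[of "\<lambda>y X. mp (\<lambda>b. (0, 0, b)) y * in12 X"]) (auto simp: mult_single)
  have "dup12 (tens x y) = in12 (comul x) * mp (\<lambda>b. (0, 0, b)) y"
    by (simp add: tens_def hom_simps comul_def wmap_wmap)
  then show "D12 (tens x y) = in12 (D x) * mp (\<lambda>b. (0, 0, b)) y"
    by (simp add: D12_def D_def hom_simps mult.assoc comm)
  have comm: "mp (\<lambda>a. (a, 0, 0)) x * in23 X = in23 X * mp (\<lambda>a. (a, 0, 0)) x"
    for X :: "'g \<times> 'g \<Rightarrow>\<^sub>0 'k"
    by (rule klin2_eqI[of "\<lambda>x X. mp (\<lambda>a. (a, 0, 0)) x * in23 X"]) (auto simp: mult_single)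
  have "dup23 (tens x y) = mp (\<lambda>a. (a, 0, 0)) x * in23 (comul y)"
    by (simp add: tens_def hom_simps comul_def wmap_wmap)
  then show "D23 (tens x y) = mp (\<lambda>a. (a, 0, 0)) x * in23 (D y)"
    by (simp add: D23_def D_def hom_simps mult.assoc comm mult_left_comm_if[OF comm])
qed

lemma lin_D12: "lin F (D12 X) = lin (\<lambda>(a, b). lin (\<lambda>(c, d). F (c, d, b)) (D (pt a))) X"
  for F :: "'g \<times> 'g \<times> 'g \<Rightarrow> 'b::monoid_add \<Rightarrow>\<^sub>0 'k"
proof (rule klin_eqI[where x = X])
  fix ab :: "'g \<times> 'g"
  obtain a b where ab: "ab = (a, b)" by force
  have "lin F (in12 Y * mp (\<lambda>b. (0, 0, b)) (pt b)) = lin (\<lambda>(c, d). F (c, d, b)) Y" for Y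
    by (rule klin_eqI[where x = Y]) (auto intro: klin_comp[of "lin F"] simp: mult_single)
  then show "lin F (D12 (pt ab)) = lin (\<lambda>(a, b). lin (\<lambda>(c, d). F (c, d, b)) (D (pt a))) (pt ab)"
    using D12_tens[of "pt a" "pt b"] by (simp add: ab)
qed (auto intro: klin_comp)

lemma lin_D23: "lin F (D23 X) = lin (\<lambda>(a, b). lin (\<lambda>(c, d). F (a, c, d)) (D (pt b))) X"
  for F :: "'g \<times> 'g \<times> 'g \<Rightarrow> 'b::monoid_add \<Rightarrow>\<^sub>0 'k"
proof (rule klin_eqI[where x = X])
  fix ab :: "'g \<times> 'g"
  obtain a b where ab: "ab = (a, b)" by force
  have "lin F (mp (\<lambda>a. (a, 0, 0)) (pt a) * in23 Y) = lin (\<lambda>(c, d). F (a, c, d)) Y" for Y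
    by (rule klin_eqI[where x = Y]) (auto intro: klin_comp[of "lin F"] simp: mult_single)
  then show "lin F (D23 (pt ab)) = lin (\<lambda>(a, b). lin (\<lambda>(c, d). F (a, c, d)) (D (pt b))) (pt ab)"
    using D23_tens[of "pt a" "pt b"] by (simp add: ab)
qed (auto intro: klin_comp)

text \<open>Coassociativity in Sweedler form: \<open>F\<close> evaluated on the threefold coproduct
  of \<open>x\<close>, bracketed in the two ways. Antipode cancellations are carried out with it
  below.\<close>

lemma coassoc_lin:
  "lin (\<lambda>(a, b). lin (\<lambda>(c, d). F (c, d, b)) (D (pt a))) (D x) =
   lin (\<lambda>(a, b). lin (\<lambda>(c, d). F (a, c, d)) (D (pt b))) (D x)"
  for F :: "'g \<times> 'g \<times> 'g \<Rightarrow> 'b::monoid_add \<Rightarrow>\<^sub>0 'k"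
  using coassoc lin_D12 lin_D23 by metis

text \<open>Summing \<open>Sj a * b\<close> over \<open>D h\<close> gives
  \<open>Q * ract Qi (D h)\<close>, and \<open>Qi\<close> is an eigenvector of \<open>D h\<close> by
  \<open>ract_D\<close>.\<close>

lemma antipode_left: "lin (\<lambda>(a, b). Sj (pt a) * pt b) (D h) = cst (eps h)"
proof -
  have "lin (\<lambda>(a, b). Sj (pt a) * pt b) X = Q * ract Qi X" for X
    by (rule klin_eqI[where x = X]) (auto simp: Sj_def mult.assoc)
  then show ?thesis by (simp add: ract_D mult.assoc[symmetric] flip: cst_comm)
       (simp add: mult.assoc)
qed

lemma antipode_right: "lin (\<lambda>(a, b). pt a * Sj (pt b)) (D h) = cst (eps h)"
proof -
  have "lin (\<lambda>(a, b). pt a * Sj (pt b)) X = act X Q * Qi" for X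
    by (rule klin_eqI[where x = X]) (auto simp: Sj_def mult.assoc)
  then show ?thesis by (simp add: act_D mult.assoc)
qed

end

section \<open>Supports and sums of pure tensors\<close>

lemma supp_0 [simp]: "0 \<in> supp A"
  and supp_add: "x \<in> supp A \<Longrightarrow> y \<in> supp A \<Longrightarrow> x + y \<in> supp (A :: 'a set)"
  and supp_sg: "a \<in> A \<Longrightarrow> sg a c \<in> supp A"
  for x y :: "'a \<Rightarrow>\<^sub>0 'k::monoid_add"
  using keys_add[of x y] by (auto simp: supp_def)

lemma supp_sum: "(\<And>i. i \<in> I \<Longrightarrow> f i \<in> supp A) \<Longrightarrow> sum f I \<in> supp A"
  for f :: "'i \<Rightarrow> 'a \<Rightarrow>\<^sub>0 'k::comm_monoid_add"
  by (induction I rule: infinite_finite_induct) (auto intro: supp_add)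

lemma supp_cst: "x \<in> supp A \<Longrightarrow> cst c * x \<in> supp A"
  using keys_cst_mult[of c x] by (auto simp: supp_def)

lemma supp_mult:
  assumes "\<And>a b. a \<in> A \<Longrightarrow> b \<in> A \<Longrightarrow> a + b \<in> A" "x \<in> supp A" "y \<in> supp A"
  shows "x * y \<in> supp A"
proof -
  have "keys (x * y) \<subseteq> {a + b |a b. a \<in> keys x \<and> b \<in> keys y}"
    by (rule keys_mult)
  also have "\<dots> \<subseteq> A" using assms by (auto simp: supp_def)
  finally show ?thesis by (simp add: supp_def)
qed

lemma supp_lin: "(\<And>a. a \<in> keys x \<Longrightarrow> F a \<in> supp B) \<Longrightarrow> lin F x \<in> supp B"
  unfolding lin_def by (intro supp_sum supp_cst)

lemma supp_wmap: "x \<in> supp A \<Longrightarrow> (\<And>a. a \<in> A \<Longrightarrow> f a \<in> B) \<Longrightarrow> wmap f w x \<in> supp B"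
  unfolding wmap_def by (rule supp_lin) (auto simp: supp_def intro!: supp_sg)

lemma scal_left: "x * (cst c * y) = cst c * (x * (y :: _ \<Rightarrow>\<^sub>0 'k::comm_semiring_1))"
  by (metis cst_comm mult.assoc)

lemma scal2: "a * (cst c * x) * y * (cst d * z) * w =
    cst (c * d) * (a * x * y * z * (w :: _ \<Rightarrow>\<^sub>0 'k::comm_semiring_1))"
proof -
  have "a * (cst c * x) * y * (cst d * z) * w = cst d * (cst c * (a * x) * y * z) * w"
    by (simp only: scal_left[of _ d] scal_left[of a])
  then show ?thesis by (simp add: mult.assoc mult.commute[of c] cst_mult)
qed

text \<open>The image of \<open>A \<otimes> B\<close> in the tensor product. Only sums are built in:
  when \<open>A\<close> is closed under scaling, scalars are absorbed into the left factor, see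
  \<open>tspan_cst\<close>.\<close>

inductive_set tspan :: "('a::monoid_add \<Rightarrow>\<^sub>0 'k::comm_semiring_1) set \<Rightarrow> ('b::monoid_add \<Rightarrow>\<^sub>0 'k) set \<Rightarrow> ('a \<times> 'b \<Rightarrow>\<^sub>0 'k) set"
  for A B where
  tspan_0: "0 \<in> tspan A B"
| tspan_step: "X \<in> tspan A B \<Longrightarrow> a \<in> A \<Longrightarrow> b \<in> B \<Longrightarrow> X + tens a b \<in> tspan A B"

lemma tspan_tens: "a \<in> A \<Longrightarrow> b \<in> B \<Longrightarrow> tens a b \<in> tspan A B"
  using tspan_step[OF tspan_0] by fastforce

lemma tspan_add: "X \<in> tspan A B \<Longrightarrow> Y \<in> tspan A B \<Longrightarrow> X + Y \<in> tspan A B"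
proof -
  assume X: "X \<in> tspan A B"
  assume "Y \<in> tspan A B"
  then show ?thesis
    by induction (auto intro: tspan.intros X simp: add.assoc[symmetric])
qed

lemma tspan_sum: "(\<And>i. i \<in> I \<Longrightarrow> f i \<in> tspan A B) \<Longrightarrow> sum f I \<in> tspan A B"
  by (induction I rule: infinite_finite_induct) (auto intro: tspan_0 tspan_add)

lemma tens_cst: "tens (cst c * x) y = cst c * tens x y" "tens x (cst c * y) = cst c * tens x (y :: _ \<Rightarrow>\<^sub>0 'k::comm_semiring_1)"
  using klin_cst[OF klin_tens(1)] klin_cst[OF klin_tens(2)] by auto

lemma tens_add: "tens (x + x') y = tens x y + tens x' (y :: _ \<Rightarrow>\<^sub>0 'k::comm_semiring_1)"
  "tens x (y + y') = tens x y + tens x (y' :: _ \<Rightarrow>\<^sub>0 'k::comm_semiring_1)"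
  using klin_add[OF klin_tens(1)] klin_add[OF klin_tens(2)] by auto

lemma tens_mult:
  fixes x x' :: "'a::monoid_add \<Rightarrow>\<^sub>0 'k::comm_semiring_1" and y y' :: "'b::monoid_add \<Rightarrow>\<^sub>0 'k"
  shows "tens x y * tens x' y' = tens (x * x') (y * y')"
proof -
  have c: "mp (\<lambda>b. (0 :: 'a, b)) y * mp (\<lambda>a. (a, 0 :: 'b)) x' = mp (\<lambda>a. (a, 0 :: 'b)) x' * mp (\<lambda>b. (0 :: 'a, b)) y"
    by (rule klin2_eqI[of "\<lambda>y x'. mp (\<lambda>b. (0 :: 'a, b)) y * mp (\<lambda>a. (a, 0 :: 'b)) x'"]) (auto simp: mult_single)
  have "mp (\<lambda>a. (a, 0 :: 'b)) (x * x') = mp (\<lambda>a. (a, 0 :: 'b)) x * mp (\<lambda>a. (a, 0 :: 'b)) x'"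
    "mp (\<lambda>b. (0 :: 'a, b)) (y * y') = mp (\<lambda>b. (0 :: 'a, b)) y * mp (\<lambda>b. (0 :: 'a, b)) y'"
    by (rule wmap_mult; auto)+
  then show ?thesis unfolding tens_def
    by (simp add: mult.assoc mult_left_comm_if[OF c])
qed

lemma tens_1 [simp]: "tens 1 1 = 1"
  unfolding tens_def by (subst wmap_1; (simp add: zero_prod_def)?)+

lemma tens_lin: "X = lin (\<lambda>(a, b). tens (pt a) (pt b)) X"
  by (rule klin_eqI[where x = X]) auto

lemma tspan_cst:
  assumes "\<And>c a. a \<in> A \<Longrightarrow> cst c * a \<in> A" "X \<in> tspan A B"
  shows "cst c * X \<in> tspan A B"
  using assms(2)
  by induction (auto simp: distrib_left tens_cst[symmetric] intro!: tspan.intros assms(1))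

lemma tspan_lin:
  assumes "\<And>c a. a \<in> A \<Longrightarrow> cst c * a \<in> A" "\<And>a. a \<in> keys x \<Longrightarrow> F a \<in> tspan A B"
  shows "lin F x \<in> tspan A B"
  unfolding lin_def by (intro tspan_sum tspan_cst assms)

lemma supp_tspan:
  assumes "X \<in> supp (G \<times> H)" shows "X \<in> tspan (supp G) (supp H)"
proof (subst tens_lin, intro tspan_lin supp_cst)
  fix p assume "p \<in> keys X"
  then have "fst p \<in> G" "snd p \<in> H" using assms by (auto simp: supp_def)
  then show "(\<lambda>(a, b). tens (pt a) (pt b)) p \<in> tspan (supp G) (supp H)"
    by (auto simp: case_prod_unfold simp del: tens_pt intro!: tspan_tens supp_sg)
qed

section \<open>The involutions given by a quadratic character\<close>

context twist
begin

text \<open>\<open>cR\<close> and \<open>cL\<close> are the slices \<open>id \<otimes> chi\<close>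
  and \<open>chi \<otimes> id\<close>; \<open>ch\<close> multiplies every group element by its
  character value, and \<open>ch1\<close>, \<open>ch2\<close> are \<open>ch \<otimes> id\<close> and
  \<open>id \<otimes> ch\<close>. All are algebra maps since \<open>chi\<close> is
  multiplicative.\<close>

definition "cR = wmap fst (\<lambda>(a, b). chi b)"
definition "cL = wmap snd (\<lambda>(a, b). chi a)"
definition "ch = wmap (\<lambda>a. a) chi"
definition "ch1 = wmap (\<lambda>a. a) (\<lambda>(a, b). chi a)"
definition "ch2 = wmap (\<lambda>a. a) (\<lambda>(a, b). chi b)"
definition "u = cR J"
definition "u' = cR J'"
definition "v = cL J"
definition "v' = cL J'"
definition "thR x = u * ch x * u'"
definition "thL x = v * ch x * v'"

abbreviation "i1 x \<equiv> tens x 1"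
abbreviation "i2 x \<equiv> tens 1 x"

lemma i1_eq: "i1 x = mp (\<lambda>a. (a, 0)) x" and i2_eq: "i2 x = mp (\<lambda>b. (0, b)) x"
  by (simp_all add: tens_def) (subst wmap_1; simp add: zero_prod_def)+

lemma c_mult: "cR (X * Y) = cR X * cR Y" "cL (X * Y) = cL X * cL Y" "ch (x * y) = ch x * ch y"
  "ch1 (X * Y) = ch1 X * ch1 Y" "ch2 (X * Y) = ch2 X * ch2 Y"
  unfolding cR_def cL_def ch_def ch1_def ch2_def
  by (rule wmap_mult; auto simp: chi_add split: prod.splits)+

lemma c_1 [simp]: "cR 1 = 1" "cL 1 = 1" "ch 1 = 1" "ch1 1 = 1" "ch2 1 = 1"
  unfolding cR_def cL_def ch_def ch1_def ch2_def
  by (rule wmap_1; auto simp: zero_prod_def)+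

lemma klin_c [intro!]: "klin cR" "klin cL" "klin ch" "klin ch1" "klin ch2"
  unfolding cR_def cL_def ch_def ch1_def ch2_def by auto

lemma klin_th [intro!]: "klin thR" "klin thL"
  unfolding thR_def[abs_def] thL_def[abs_def] by auto

lemma ch_ch [simp]: "ch (ch x) = x" "ch1 (ch1 X) = X" "ch2 (ch2 X) = X"
  by (simp_all add: ch_def ch1_def ch2_def wmap_wmap case_prod_unfold)

lemma uu' [simp]: "u * u' = 1" "u' * u = 1" "v * v' = 1" "v' * v = 1"
  by (simp_all add: u_def u'_def v_def v'_def flip: c_mult)

lemmas uu'_cancel [simp] = uu'[THEN mult_eq_1_cancel]

lemma i_uu' [simp]: "i1 u * i1 u' = 1" "i1 u' * i1 u = 1" "i2 u * i2 u' = 1" "i2 u' * i2 u = 1"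
   "i1 v * i1 v' = 1" "i1 v' * i1 v = 1" "i2 v * i2 v' = 1" "i2 v' * i2 v = 1"
  by (simp_all add: tens_mult)

lemma th_mult: "thR (x * y) = thR x * thR y" "thL (x * y) = thL x * thL y"
  by (simp_all add: thR_def thL_def c_mult mult.assoc)

lemma th_1 [simp]: "thR 1 = 1" "thL 1 = 1"
  by (simp_all add: thR_def thL_def)

lemma cR_D: "cR (D x) = thR x" and cL_D: "cL (D x) = thL x"
  by (simp_all add: D_def c_mult thR_def thL_def u_def u'_def v_def v'_def)
     (simp_all add: cR_def cL_def ch_def comul_def wmap_wmap)

text \<open>Evaluating \<open>chi\<close> in one tensor factor of the cocycle equation gives a
  relation between \<open>u\<close>, \<open>v\<close> and \<open>J\<close>; this is the third
  factor, the next lemma uses the first.\<close>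

lemma J_comul_u: "J * comul u = i2 u * ch2 J"
proof -
  let ?f = "wmap (\<lambda>(a, b, c). (a, b)) (\<lambda>(a, b, c). chi c) :: ('g \<times> 'g \<times> 'g \<Rightarrow>\<^sub>0 'k) \<Rightarrow> 'g \<times> 'g \<Rightarrow>\<^sub>0 'k"
  have m: "?f (X * Y) = ?f X * ?f Y" for X Y
    by (rule wmap_mult) (auto simp: chi_add)
  have "?f (in12 J) = J" "?f (dup12 J) = comul u" "?f (in23 J) = i2 u" "?f (dup23 J) = ch2 J"
    by (simp_all add: i2_eq u_def cR_def ch2_def comul_def wmap_wmap case_prod_unfold)
  then show ?thesis using arg_cong[OF cocycle, of ?f] by (simp only: m)
qed

lemma J_comul_v: "J * comul v = i1 v * ch1 J"
proof -
  let ?f = "wmap (\<lambda>(a, b, c). (b, c)) (\<lambda>(a, b, c). chi a) :: ('g \<times> 'g \<times> 'g \<Rightarrow>\<^sub>0 'k) \<Rightarrow> 'g \<times> 'g \<Rightarrow>\<^sub>0 'k"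
  have m: "?f (X * Y) = ?f X * ?f Y" for X Y
    by (rule wmap_mult) (auto simp: chi_add)
  have "?f (in12 J) = i1 v" "?f (dup12 J) = ch1 J" "?f (in23 J) = J" "?f (dup23 J) = comul v"
    by (simp_all add: i1_eq v_def cL_def ch1_def comul_def wmap_wmap case_prod_unfold)
  then show ?thesis using arg_cong[OF cocycle, of ?f] by (simp only: m)
qed

text \<open>The middle factor of the cocycle equation; this is the relation that links
  \<open>u\<close> with \<open>v\<close>.\<close>

lemma u_ch1_J: "i1 u * ch1 J = i2 v * ch2 J"
proof -
  let ?f = "wmap (\<lambda>(a, b, c). (a, c)) (\<lambda>(a, b, c). chi b) :: ('g \<times> 'g \<times> 'g \<Rightarrow>\<^sub>0 'k) \<Rightarrow> 'g \<times> 'g \<Rightarrow>\<^sub>0 'k"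
  have m: "?f (X * Y) = ?f X * ?f Y" for X Y
    by (rule wmap_mult) (auto simp: chi_add)
  have "?f (in12 J) = i1 u" "?f (dup12 J) = ch1 J" "?f (in23 J) = i2 v" "?f (dup23 J) = ch2 J"
    by (simp_all add: i1_eq i2_eq u_def v_def cL_def cR_def ch1_def ch2_def wmap_wmap case_prod_unfold)
  then show ?thesis using arg_cong[OF cocycle, of ?f] by (simp only: m)
qed

lemma comul_uu' [simp]: "comul u * comul u' = 1" "comul u' * comul u = 1"
    "comul v * comul v' = 1" "comul v' * comul v = 1"
  by (simp_all flip: comul_mult)

lemma ch_J_inv [simp]: "ch1 J * ch1 J' = 1" "ch1 J' * ch1 J = 1" "ch2 J * ch2 J' = 1" "ch2 J' * ch2 J = 1"
  by (simp_all flip: c_mult)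

lemma inverse_unique2:
  fixes a :: "'r :: monoid_mult"
  shows "a * b = 1 \<Longrightarrow> b' * a = 1 \<Longrightarrow> b = b'"
  by (metis mult.assoc mult.right_neutral mult_1)

lemma comul_u'_J': "comul u' * J' = ch2 J' * i2 u'"
proof (rule inverse_unique2)
  show "(J * comul u) * (comul u' * J') = 1"
    by (simp add: mult.assoc comul_uu'[THEN mult_eq_1_cancel])
  show "ch2 J' * i2 u' * (J * comul u) = 1"
    by (simp add: J_comul_u mult.assoc i_uu'[THEN mult_eq_1_cancel])
qed

lemma comul_v'_J': "comul v' * J' = ch1 J' * i1 v'"
proof (rule inverse_unique2)
  show "(J * comul v) * (comul v' * J') = 1"
    by (simp add: mult.assoc comul_uu'[THEN mult_eq_1_cancel])
  show "ch1 J' * i1 v' * (J * comul v) = 1"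
    by (simp add: J_comul_v mult.assoc i_uu'[THEN mult_eq_1_cancel])
qed

definition "th2 X = i2 u * ch2 X * i2 u'"
definition "th1 X = i1 v * ch1 X * i1 v'"

lemma klin_th12 [intro!]: "klin th1" "klin th2"
  unfolding th1_def[abs_def] th2_def[abs_def] by auto

text \<open>Being a slice of \<open>D\<close> on the right, \<open>thR\<close> passes through
  \<open>D\<close> into the second tensor factor. In terms of \<open>J\<close> this is
  \<open>J_comul_u\<close> on the left and its inverse on the right.\<close>

lemma D_thR: "D (thR x) = th2 (D x)"
proof -
  have "comul (ch x) = ch2 (comul x)"
    by (simp add: comul_def ch_def ch2_def wmap_wmap)
  then have "D (thR x) = (J * comul u) * ch2 (comul x) * (comul u' * J')"
    by (simp add: D_def thR_def comul_mult mult.assoc)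
  then show ?thesis
    by (simp add: J_comul_u comul_u'_J' th2_def D_def c_mult mult.assoc)
qed

lemma D_thL: "D (thL x) = th1 (D x)"
proof -
  have "comul (ch x) = ch1 (comul x)"
    by (simp add: comul_def ch_def ch1_def wmap_wmap)
  then have "D (thL x) = (J * comul v) * ch1 (comul x) * (comul v' * J')"
    by (simp add: D_def thL_def comul_mult mult.assoc)
  then show ?thesis
    by (simp add: J_comul_v comul_v'_J' th1_def D_def c_mult mult.assoc)
qed

lemma th_tens: "th2 (tens x y) = tens x (thR y)" "th1 (tens x y) = tens (thL x) y"
proof -
  have "ch2 (tens x y) = tens x (ch y)" "ch1 (tens x y) = tens (ch x) y"
    by (rule klin2_eqI[of "\<lambda>x y. ch2 (tens x y)" "\<lambda>x y. tens x (ch y)"];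
        (intro klin_comp[OF klin_c(5)] klin_comp[OF klin_tens(2) klin_c(3)] klin_tens)?;
        simp add: ch_def ch2_def tens_def mult_single)
       (rule klin2_eqI[of "\<lambda>x y. ch1 (tens x y)" "\<lambda>x y. tens (ch x) y"];
        (intro klin_comp[OF klin_c(4)] klin_comp[OF klin_tens(1) klin_c(3)] klin_tens)?;
        simp add: ch_def ch1_def tens_def mult_single)
  then show "th2 (tens x y) = tens x (thR y)" "th1 (tens x y) = tens (thL x) y"
    by (simp_all add: th1_def th2_def thR_def thL_def tens_mult)
qed

text \<open>Both composites evaluate \<open>chi\<close> in the two outer factors of the threefold
  coproduct of \<open>x\<close>.\<close>

lemma th_comm: "thL (thR x) = thR (thL x)"
proof -
  have *: "cL (ch2 X) = ch (cL X)" for X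
    by (simp add: cL_def ch2_def ch_def wmap_wmap case_prod_unfold mult.commute)
  have **: "cL (i2 y) = y" for y
    by (simp add: i2_eq cL_def wmap_wmap)
  have "thL (thR x) = cL (th2 (D x))"
    by (simp flip: D_thR cL_D)
  also have "\<dots> = thR (thL x)"
    by (simp add: th2_def c_mult * ** thR_def cL_D)
  finally show ?thesis .
qed

text \<open>Slice \<open>J_comul_u\<close> by \<open>chi\<close> once more: since \<open>chi\<close>
  squares to 1, the weights on \<open>J\<close> cancel and the counit axiom leaves only the scalar
  \<open>aug chi u\<close>. This is what makes \<open>thR\<close> an involution.\<close>

lemma u_ch_u: "u * ch u = cst (aug chi u)" and v_ch_v: "v * ch v = cst (aug chi v)"
proof -
  have "cR (J * comul u) = u * ch u" "cL (J * comul v) = v * ch v"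
    by (simp_all add: c_mult u_def v_def) (simp_all add: cR_def cL_def ch_def comul_def wmap_wmap)
  moreover have "cR (i2 u * ch2 J) = cst (aug chi u)" "cL (i1 v * ch1 J) = cst (aug chi v)"
  proof -
    have "cR (i2 u) = cst (aug chi u)" "cL (i1 v) = cst (aug chi v)"
      by (simp_all add: i1_eq i2_eq cR_def cL_def cst_aug wmap_wmap)
    moreover have "cR (ch2 J) = mp fst J" "cL (ch1 J) = mp snd J"
      by (simp_all add: cR_def cL_def ch1_def ch2_def wmap_wmap case_prod_unfold)
    ultimately show "cR (i2 u * ch2 J) = cst (aug chi u)" "cL (i1 v * ch1 J) = cst (aug chi v)"
      by (simp_all add: c_mult counit_J)
  qed
  ultimately show "u * ch u = cst (aug chi u)" "v * ch v = cst (aug chi v)"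
    by (simp_all add: J_comul_u J_comul_v)
qed

lemma aug_chi_mult: "aug chi (x * y) = aug chi x * aug chi y" and eps_mult: "eps (x * y) = eps x * eps (y :: 'g \<Rightarrow>\<^sub>0 'k)"
  by (rule aug_mult; simp add: chi_add)+

lemma aug_chi_nz: "aug chi u \<noteq> 0" "aug chi v \<noteq> 0"
  using aug_chi_mult[of u u'] aug_chi_mult[of v v'] by (auto simp: aug_1)

lemma th_th: "thR (thR x) = x" "thL (thL x) = x"
proof -
  have gen: "w * ch (w * ch x * w') * w' = x"
    if "w * ch w = cst c" "c \<noteq> 0" "w * w' = 1" "w' * w = 1" for w w' and c :: 'k
  proof -
    have "ch w' * w' = cst (inverse c)"
    proof (rule inverse_unique2)
      have "ch w * ch w' = 1" using that by (simp flip: c_mult)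
      then show "(w * ch w) * (ch w' * w') = 1"
        using that(3) by (metis mult.assoc mult.right_neutral)
      show "cst (inverse c) * (w * ch w) = 1" using that by (simp flip: cst_mult)
    qed
    then have "w * ch (w * ch x * w') * w' = cst c * x * cst (inverse c)"
      by (simp add: c_mult mult.assoc) (simp add: that mult.assoc[symmetric])
    then show ?thesis using that
      by (simp add: mult.assoc flip: cst_comm cst_mult) (simp flip: mult.assoc cst_mult)
  qed
  show "thR (thR x) = x" unfolding thR_def by (rule gen[OF u_ch_u]) (auto simp: aug_chi_nz)
  show "thL (thL x) = x" unfolding thL_def by (rule gen[OF v_ch_v]) (auto simp: aug_chi_nz)
qed

text \<open>Eliminating \<open>ch1 J\<close> and \<open>ch2 J\<close> from the three relations
  leaves an identity in \<open>J\<close> alone, which says that \<open>v * u'\<close> is group-like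
  for \<open>D\<close> up to the position of \<open>J\<close>.\<close>

lemma J_comul_vu': "J * comul (v * u') = tens (v * u') (v * u') * J"
proof -
  have c1: "ch1 J = i1 u' * i2 v * ch2 J"
    using arg_cong[OF u_ch1_J, of "\<lambda>x. i1 u' * x"] by (simp add: i_uu'[THEN mult_eq_1_cancel] mult.assoc)
  have c2: "ch2 J = i2 u' * J * comul u"
    using arg_cong[OF J_comul_u, of "\<lambda>x. i2 u' * x"] by (simp add: i_uu'[THEN mult_eq_1_cancel] mult.assoc)
  have "J * comul v = i1 v * (i1 u' * i2 v * (i2 u' * J * comul u))"
    by (simp only: J_comul_v c1 flip: c2)
  also have "\<dots> = tens (v * u') (v * u') * J * comul u"
    by (simp add: tens_mult flip: mult.assoc)
  finally have "J * comul v * comul u' = tens (v * u') (v * u') * J * (comul u * comul u')"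
    by (simp add: mult.assoc)
  then show ?thesis by (simp add: comul_mult mult.assoc)
qed

lemma ch_act: "ch (act X z) = act (ch1 (ch2 X)) (ch z)"
proof (rule klin2_eqI[of "\<lambda>X z. ch (act X z)" "\<lambda>X z. act (ch1 (ch2 X)) (ch z)"])
  show "ch (act (pt a) (pt b)) = act (ch1 (ch2 (pt a))) (ch (pt b))" for a b
    by (cases a) (simp add: ch_def ch1_def ch2_def mult_single chi_add mult_ac diff_conv_add_uminus del: add_uminus_conv_diff)
qed (auto intro: klin_comp[of ch] klin_comp[of "\<lambda>X. act X _"] klin_comp[of ch1] klin_comp[of "act _"])

lemma eps_uv: "eps u = 1" "eps v = 1"
proof -
  have "eps u = aug chi (mp snd J)" "eps v = aug chi (mp fst J)"
    by (simp_all add: u_def v_def cR_def cL_def aug_wmap case_prod_unfold)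
  then show "eps u = 1" "eps v = 1" by (simp_all add: counit_J aug_1)
qed

lemma act_J_comul_1: "eps x = 1 \<Longrightarrow> act (J * comul x) 1 = Q"
  by (simp add: act_mult act_comul_1 Q_def)

text \<open>Let the relations \<open>J_comul_u\<close> and \<open>J_comul_v\<close> act on 1.
  Elements of counit 1 have coproducts that fix 1, so \<open>Q\<close> is expressed once through
  \<open>ch2 J\<close> and once through \<open>ch1 J\<close>, and \<open>ch\<close> exchanges the
  two.\<close>

lemma ch_Q: "v * ch Q = Q * ch (gS u)"
proof -
  have 1: "act (ch2 J) 1 * gS u = Q"
    using act_J_comul_1[OF eps_uv(1)] by (simp add: J_comul_u act_mult act_tens)
  have 2: "v * act (ch1 J) 1 = Q"
    using act_J_comul_1[OF eps_uv(2)] by (simp add: J_comul_v act_mult act_tens)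
  have "ch (act (ch2 J) 1) = act (ch1 J) 1" by (simp add: ch_act)
  then have "v * ch Q = v * (act (ch1 J) 1 * ch (gS u))"
    by (simp add: c_mult flip: 1)
  then show ?thesis by (simp add: 2 flip: mult.assoc)
qed

lemma ch_gS: "ch (gS x) = gS (ch x)"
  by (simp add: ch_def gS_def wmap_wmap)

lemma gS_cst [simp]: "gS (cst c) = cst c"
  by (simp add: cst_def)

text \<open>The scalar \<open>c\<close> enters \<open>ch Q\<close> and \<open>ch Qi\<close>
  inversely, so it disappears from the antipode and from the adjoint action, where \<open>Q\<close>
  and \<open>Qi\<close> occur once each.\<close>

lemma ch_Q_eq:
  assumes "u = v"
  defines "c \<equiv> aug chi u"
  shows "ch Q = cst c * (u' * Q * gS u')" "ch Qi = cst (inverse c) * (gS u * Qi * u)"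
proof -
  have c: "c \<noteq> 0" unfolding c_def by (rule aug_chi_nz)
  have "ch u = u' * (u * ch u)" by simp
  then have chu: "ch u = cst c * u'" unfolding c_def by (simp add: u_ch_u cst_comm)
  have "ch Q = v' * (v * ch Q)" by simp
  also have "\<dots> = u' * (Q * gS (ch u))"
    using uu' \<open>u = v\<close> inverse_unique2[of v v' u'] by (simp add: ch_Q ch_gS)
  also have "\<dots> = cst c * (u' * Q * gS u')"
    by (simp add: chu gS_mult mult.assoc) (simp add: cst_comm mult.assoc)
  finally show *: "ch Q = cst c * (u' * Q * gS u')" .
  show "ch Qi = cst (inverse c) * (gS u * Qi * u)"
  proof (rule inverse_unique2)
    show "ch Q * ch Qi = 1" by (simp flip: c_mult)
    have g: "gS u' * gS u = 1" "gS u * gS u' = 1" by (simp_all flip: gS_mult)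
    have "cst (inverse c) * (gS u * Qi * u) * (cst c * (u' * Q * gS u')) =
      cst (inverse c) * cst c * (gS u * Qi * u * (u' * Q * gS u'))"
      using scal2[of 1 "inverse c" _ 1 c _ 1] by (simp add: cst_mult)
    also have "\<dots> = 1" using c by (simp add: mult.assoc g flip: cst_mult)
    finally show "cst (inverse c) * (gS u * Qi * u) * ch Q = 1" unfolding * .
  qed
qed

text \<open>The adjoint actions \<open>h\<^sub>1 a Sj(h\<^sub>2)\<close> and
  \<open>Sj(h\<^sub>1) a h\<^sub>2\<close> of the twisted Hopf algebra, written through the
  two-sided action because \<open>Sj\<close> is inversion conjugated by \<open>Q\<close>.\<close>

definition ladj where "ladj h a = act (D h) (a * Q) * Qi"
definition radj where "radj h a = Q * ract (Qi * a) (D h)"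

lemma thR_Sj:
  assumes "u = v" shows "thR (Sj x) = Sj (thR x)"
proof -
  let ?c = "aug chi u"
  have "thR (Sj x) = u * ch Q * ch (gS x) * ch Qi * u'"
    by (simp add: thR_def Sj_def c_mult mult.assoc)
  also have "\<dots> = cst ?c * cst (inverse ?c) * (Q * gS u' * gS (ch x) * gS u * Qi)"
    unfolding ch_Q_eq[OF assms] ch_gS scal2 by (simp add: mult.assoc cst_mult)
  also have "\<dots> = Sj (thR x)"
    using aug_chi_nz by (simp add: Sj_def thR_def gS_mult mult.assoc flip: cst_mult)
  finally show ?thesis .
qed

lemma thR_ladj:
  assumes "u = v" "thR a = a" shows "thR (ladj h a) = ladj h a"
proof -
  let ?c = "aug chi u"
  have v': "v' = u'" using assms(1) uu' inverse_unique2[of v v' u'] by simp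
  have a: "ch a = u' * a * u"
    using arg_cong[OF assms(2), of "\<lambda>x. u' * x * u"] by (simp add: thR_def mult.assoc)
  have th: "thL = thR" by (rule ext) (simp add: thL_def thR_def assms(1) v')
  \<comment> \<open>\<open>th1\<close> and \<open>th2\<close> move to \<open>thL\<close> and
    \<open>thR\<close> on \<open>h\<close>, which coincide here and cancel. Read backwards,
    \<open>ch1 (ch2 (D h))\<close> is \<open>D h\<close> conjugated by
    \<open>u \<otimes> u\<close>.\<close>
  have "D h = th1 (th2 (D h))"
    by (simp add: D_thR[symmetric] D_thL[symmetric] th th_th)
  also have "\<dots> = i1 u * ch1 (i2 u * ch2 (D h) * i2 u') * i1 u'"
    by (simp add: th1_def th2_def v' assms(1))
  also have "\<dots> = tens u u * ch1 (ch2 (D h)) * tens u' u'"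
  proof -
    have i2: "ch1 (i2 y) = i2 y" for y
      by (simp add: ch1_def i2_eq wmap_wmap)
    have "i1 u * ch1 (i2 u * ch2 (D h) * i2 u') * i1 u' = (i1 u * i2 u) * ch1 (ch2 (D h)) * (i2 u' * i1 u')"
      by (simp add: c_mult mult.assoc i2)
    then show ?thesis by (simp add: tens_mult)
  qed
  finally have "tens u' u' * D h * tens u u = tens u' u' * (tens u u * ch1 (ch2 (D h)) * tens u' u') * tens u u"
    by (rule arg_cong[of _ _ "\<lambda>X. tens u' u' * X * tens u u"])
  then have "tens u' u' * D h * tens u u = (tens u' u' * tens u u) * ch1 (ch2 (D h)) * (tens u' u' * tens u u)"
    by (simp only: mult.assoc)
  then have Dh: "ch1 (ch2 (D h)) = tens u' u' * D h * tens u u"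
    by (simp add: tens_mult)
  have g: "gS u' * gS u = 1" "gS u * gS u' = 1" by (simp_all flip: gS_mult)
  have "ch (ladj h a) = act (ch1 (ch2 (D h))) (ch a * ch Q) * ch Qi"
    by (simp add: ladj_def c_mult ch_act)
  also have "ch a * ch Q = cst ?c * act (tens u' u') (a * Q)"
    unfolding a ch_Q_eq[OF assms(1)] act_tens scal_left by (simp add: mult.assoc)
  also have "act (ch1 (ch2 (D h))) (cst ?c * act (tens u' u') (a * Q)) = cst ?c * act (ch1 (ch2 (D h))) (act (tens u' u') (a * Q))"
    by (rule klin_cst) auto
  also have "act (ch1 (ch2 (D h))) (act (tens u' u') (a * Q)) = act (tens u' u' * D h * (tens u u * tens u' u')) (a * Q)"
    by (simp add: Dh act_mult)
  also have "\<dots> = u' * act (D h) (a * Q) * gS u'"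
    by (simp add: tens_mult act_mult act_tens)
  also have "cst ?c * (u' * act (D h) (a * Q) * gS u') * ch Qi =
     cst ?c * cst (inverse ?c) * (u' * act (D h) (a * Q) * (gS u' * gS u) * Qi * u)"
    using scal2[of 1 ?c "u' * act (D h) (a * Q) * gS u'" 1 "inverse ?c" "gS u * Qi * u" 1]
    by (simp add: ch_Q_eq[OF assms(1)] mult.assoc cst_mult)
  also have "\<dots> = u' * ladj h a * u"
    using aug_chi_nz by (simp add: g ladj_def mult.assoc flip: cst_mult)
  finally show ?thesis by (simp add: thR_def mult.assoc)
qed

end

section \<open>Subspaces and duality\<close>

definition ksub :: "('g::monoid_add \<Rightarrow>\<^sub>0 'k::semiring_1) set \<Rightarrow> bool" where
  "ksub V \<longleftrightarrow> 0 \<in> V \<and> (\<forall>x\<in>V. \<forall>y\<in>V. x + y \<in> V) \<and> (\<forall>c. \<forall>x\<in>V. cst c * x \<in> V)"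

lemma ksubD: "ksub V \<Longrightarrow> 0 \<in> V" "ksub V \<Longrightarrow> x \<in> V \<Longrightarrow> y \<in> V \<Longrightarrow> x + y \<in> V"
  "ksub V \<Longrightarrow> x \<in> V \<Longrightarrow> cst c * x \<in> V"
  by (auto simp: ksub_def)

lemma ksub_diff: "ksub V \<Longrightarrow> x \<in> V \<Longrightarrow> y \<in> V \<Longrightarrow> x - (y :: _ \<Rightarrow>\<^sub>0 'k::ring_1) \<in> V"
  using ksubD(2)[OF _ _ ksubD(3)[of V y "-1"], of x] by (simp add: cst_uminus)

lemma ksub_sum: "ksub V \<Longrightarrow> (\<And>i. i \<in> I \<Longrightarrow> f i \<in> V) \<Longrightarrow> sum f I \<in> V"
  by (induction I rule: infinite_finite_induct) (auto simp: ksubD)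

lemma ksub_lin: "ksub V \<Longrightarrow> (\<And>i. i \<in> keys x \<Longrightarrow> f i \<in> V) \<Longrightarrow> lin f x \<in> V"
  unfolding lin_def by (intro ksub_sum ksubD(3)) auto

lemma ksub_supp: "ksub (supp G)"
  by (simp add: ksub_def supp_add supp_cst)

context
  fixes types :: "('g::monoid_add \<times> 'k::field) itself"
begin

interpretation pm: vector_space "\<lambda>c (x :: 'g \<Rightarrow>\<^sub>0 'k). cst c * x"
  by unfold_locales (simp_all add: distrib_left cst_add distrib_right mult.assoc cst_mult)

interpretation kk: vector_space "(*) :: 'k \<Rightarrow> 'k \<Rightarrow> 'k"
  by unfold_locales (simp_all add: algebra_simps)

interpretation pk: vector_space_pair "\<lambda>c (x :: 'g \<Rightarrow>\<^sub>0 'k). cst c * x" "(*) :: 'k \<Rightarrow> 'k \<Rightarrow> 'k" ..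

interpretation pp: vector_space_pair "\<lambda>c (x :: 'g \<Rightarrow>\<^sub>0 'k). cst c * x" "\<lambda>c (x :: 'g \<Rightarrow>\<^sub>0 'k). cst c * x" ..

lemma lin_iff_k: "Vector_Spaces.linear (\<lambda>c (x :: 'g \<Rightarrow>\<^sub>0 'k). cst c * x) (*) L \<longleftrightarrow>
    (\<forall>x y. L (x + y) = L x + L y) \<and> (\<forall>c x. L (cst c * x) = c * L x)"
  unfolding Vector_Spaces.linear_iff using pm.vector_space_axioms kk.vector_space_axioms by auto

lemma lin_iff_p: "Vector_Spaces.linear (\<lambda>c (x :: 'g \<Rightarrow>\<^sub>0 'k). cst c * x) (\<lambda>c (x :: 'g \<Rightarrow>\<^sub>0 'k). cst c * x) f \<longleftrightarrow>
    klin f"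
  unfolding Vector_Spaces.linear_iff klin_def using pm.vector_space_axioms by auto

lemma functional_aug:
  assumes "Vector_Spaces.linear (\<lambda>c (x :: 'g \<Rightarrow>\<^sub>0 'k). cst c * x) (*) L"
  shows "L x = aug (\<lambda>g. L (pt g)) x"
proof -
  have add: "L (x + y) = L x + L y" and sc: "L (cst c * x) = c * L x" for x y c
    using assms by (auto simp: lin_iff_k)
  have "klin (\<lambda>x. cst (L x) :: nat \<Rightarrow>\<^sub>0 'k)"
    by (rule klinI) (simp_all add: add sc cst_add cst_mult)
  then have "cst (L x) = (lin (\<lambda>a. cst (L (pt a))) x :: nat \<Rightarrow>\<^sub>0 'k)" by (rule klin_expand)
  also have "\<dots> = (cst (aug (\<lambda>g. L (pt g)) x) :: nat \<Rightarrow>\<^sub>0 'k)"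
    unfolding cst_aug wmap_def by (simp only: cst_def)
  finally show ?thesis by simp
qed

lemma pm_subspace: "pm.subspace V \<longleftrightarrow> ksub V"
  by (auto simp: pm.subspace_def ksub_def)

text \<open>Extend a basis of \<open>V\<close> by \<open>z\<close> and take the coordinate of
  \<open>z\<close>; a linear functional on finitely supported elements is the pairing with its
  values on the points.\<close>

lemma separating_functional:
  assumes "ksub V" "z \<notin> V"
  shows "\<exists>f :: 'g \<Rightarrow> 'k. (\<forall>x\<in>V. aug f x = 0) \<and> aug f z = 1"
proof -
  obtain B where B: "B \<subseteq> V" "pm.independent B" "V \<subseteq> pm.span B"
    using pm.maximal_independent_subset by blast
  have sp: "pm.span B = V" using B assms(1) pm.span_subspace pm_subspace by blast
  have "pm.independent (insert z B)"
    using B assms(2) sp by (simp add: pm.independent_insertI)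
  then obtain L where L: "Vector_Spaces.linear (\<lambda>c (x :: 'g \<Rightarrow>\<^sub>0 'k). cst c * x) (*) L"
    and Lz: "\<forall>x\<in>insert z B. L x = (if x = z then 1 else 0)"
    using pk.linear_independent_extend[of "insert z B" "\<lambda>x. if x = z then 1 else 0"] by blast
  have "L x = 0" if "x \<in> V" for x
  proof -
    have "x \<in> pm.span B" using that sp by simp
    then show ?thesis
    proof (induction rule: pm.span_induct_alt)
      case base
      then show ?case using L by (metis (no_types, lifting) pk.linear_0)
    next
      case (step c x y)
      moreover have "L x = 0" using step.hyps(1) Lz B(1) assms(2) by auto
      ultimately show ?case using L by (simp add: lin_iff_k)
    qed
  qed
  then show ?thesis
    using Lz functional_aug[OF L] by (metis insertI1)
qed

lemma finite_independent_supp: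
  assumes "finite G" "B \<subseteq> supp G" "pm.independent B"
  shows "finite B"
proof -
  have "supp G \<subseteq> pm.span (pt ` G)"
  proof
    fix x :: "'g \<Rightarrow>\<^sub>0 'k" assume "x \<in> supp G"
    then have "x = (\<Sum>a\<in>G. cst (lookup x a) * pt a)"
      using poly_sum_superset[OF assms(1), of x] by (simp add: supp_def)
    also have "\<dots> \<in> pm.span (pt ` G)"
      by (intro pm.span_sum pm.span_scale pm.span_base imageI)
    finally show "x \<in> pm.span (pt ` G)" .
  qed
  then show ?thesis
    using assms pm.independent_span_bound[of "pt ` G" B] by auto
qed

text \<open>The coordinate functionals of a basis of \<open>A\<close> are extended to the whole
  algebra and given by functions on the group, so that they can be applied factorwise to
  tensors.\<close>

lemma dual_basis:
  assumes "finite G" "ksub A" "A \<subseteq> supp (G :: 'g set)"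
  obtains B and e :: "('g \<Rightarrow>\<^sub>0 'k) \<Rightarrow> 'g \<Rightarrow> 'k" where "finite B" "B \<subseteq> A"
    "\<And>a. a \<in> A \<Longrightarrow> a = (\<Sum>b\<in>B. cst (aug (e b) a) * b)"
proof -
  obtain B where B: "B \<subseteq> A" "pm.independent B" "A \<subseteq> pm.span B"
    using pm.maximal_independent_subset by blast
  have fin: "finite B" using finite_independent_supp B assms by (meson subset_trans)
  have "\<exists>L. Vector_Spaces.linear (\<lambda>c (x :: 'g \<Rightarrow>\<^sub>0 'k). cst c * x) (*) L \<and>
      (\<forall>x\<in>B. L x = (if x = b then 1 else 0))" for b
    using pk.linear_independent_extend[OF B(2), of "\<lambda>x. if x = b then 1 else 0"] by blast
  then obtain L where L: "\<And>b. Vector_Spaces.linear (\<lambda>c (x :: 'g \<Rightarrow>\<^sub>0 'k). cst c * x) (*) (L b)"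
    and Lb: "\<And>b x. x \<in> B \<Longrightarrow> L b x = (if x = b then 1 else 0)" by metis
  have eq: "a = (\<Sum>b\<in>B. cst (L b a) * b)" if "a \<in> A" for a
  proof -
    have "a \<in> pm.span B" using that B by auto
    then show ?thesis
    proof (induction rule: pm.span_induct_alt)
      case base
      have "L b 0 = 0" for b using L by (metis (no_types, lifting) pk.linear_0)
      then show ?case by simp
    next
      case (step c x y)
      have "(\<Sum>b\<in>B. cst (L b (cst c * x + y)) * b)
        = (\<Sum>b\<in>B. cst c * (cst (L b x) * b) + cst (L b y) * b)"
      proof (intro sum.cong refl)
        fix b
        have "L b (cst c * x + y) = c * L b x + L b y" using L[of b] by (simp only: lin_iff_k)
        then show "cst (L b (cst c * x + y)) * b = cst c * (cst (L b x) * b) + cst (L b y) * b"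
          by (simp only: cst_add cst_mult distrib_right mult.assoc)
      qed
      also have "\<dots> = cst c * (\<Sum>b\<in>B. cst (L b x) * b) + y"
        using step.IH by (simp only: sum.distrib sum_distrib_left)
      also have "(\<Sum>b\<in>B. cst (L b x) * b) = (\<Sum>b\<in>B. if b = x then b else 0)"
        using step.hyps by (intro sum.cong) (auto simp: Lb)
      also have "\<dots> = x" using step.hyps fin by simp
      finally show ?case by simp
    qed
  qed
  show ?thesis
  proof (rule that[OF fin B(1)])
    show "a = (\<Sum>b\<in>B. cst (aug (\<lambda>g. L b (pt g)) a) * b)" if "a \<in> A" for a
      using eq[OF that] by (simp flip: functional_aug[OF L])
  qed
qed

text \<open>Dimension count: the image of a basis together with a vector outside the image would be
  an independent set larger than the basis. It is used to invert the antipode on a Hopf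
  subalgebra.\<close>

lemma injective_endo_surj:
  assumes "finite G" "ksub A" "A \<subseteq> supp (G :: 'g set)" "klin f" "inj f" "f ` A \<subseteq> (A :: ('g \<Rightarrow>\<^sub>0 'k) set)"
  shows "f ` A = A"
proof (rule equalityI[OF assms(6)], rule subsetI, rule ccontr)
  fix x assume x: "x \<in> A" "x \<notin> f ` A"
  obtain B where B: "B \<subseteq> A" "pm.independent B" "A \<subseteq> pm.span B"
    using pm.maximal_independent_subset by blast
  have fin: "finite B" using finite_independent_supp B assms by (meson subset_trans)
  have sp: "pm.span B = A" using B assms(2) pm.span_subspace pm_subspace by blast
  have lf: "Vector_Spaces.linear (\<lambda>c (x :: 'g \<Rightarrow>\<^sub>0 'k). cst c * x) (\<lambda>c x. cst c * x) f"
    using assms(4) by (simp add: lin_iff_p)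
  have ind: "pm.independent (f ` B)"
    using pp.linear_independent_injective_image[OF lf B(2)] assms(5) by (meson inj_on_subset subset_UNIV)
  have "pm.span (f ` B) = f ` A"
    using pp.linear_span_image[OF lf] sp by simp
  then have "pm.independent (insert x (f ` B))"
    using ind x by (simp add: pm.independent_insertI)
  moreover have "insert x (f ` B) \<subseteq> pm.span B"
    using sp x assms(6) B(1) by auto
  ultimately have "card (insert x (f ` B)) \<le> card B"
    using pm.independent_span_bound[OF fin] by blast
  moreover have "card (f ` B) = card B"
    using assms(5) by (meson card_image inj_on_subset subset_UNIV)
  moreover have "x \<notin> f ` B" using x B(1) by auto
  ultimately show False using fin by simp
qed

end

section \<open>Structure maps on the finite group algebra, and the fixed points of
  \<open>thR\<close>\<close>

context twist
begin

lemma supp_mult_G: "x \<in> supp G \<Longrightarrow> y \<in> supp G \<Longrightarrow> x * y \<in> supp (G :: 'g set)" for x y :: "'g \<Rightarrow>\<^sub>0 'k"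
  by (rule supp_mult) (auto intro: add_G)

lemma supp_mult_GG: "X \<in> supp (G \<times> G) \<Longrightarrow> Y \<in> supp (G \<times> G) \<Longrightarrow> X * Y \<in> supp (G \<times> G)"
  for X Y :: "'g \<times> 'g \<Rightarrow>\<^sub>0 'k"
  by (rule supp_mult) (auto intro: add_G)

lemma keys_supp: "X \<in> supp (G \<times> G) \<Longrightarrow> (a, b) \<in> keys X \<Longrightarrow> a \<in> G"
  "X \<in> supp (G \<times> G) \<Longrightarrow> (a, b) \<in> keys X \<Longrightarrow> b \<in> G" for X :: "'g \<times> 'g \<Rightarrow>\<^sub>0 'k"
  by (auto simp: supp_def)

lemma supp_1: "(1 :: 'g \<Rightarrow>\<^sub>0 'k) \<in> supp G"
  using supp_sg[OF zero_G, of "1 :: 'k"] by simp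

lemma supp_uv: "u \<in> supp G" "u' \<in> supp G" "v \<in> supp G" "v' \<in> supp G"
  unfolding u_def u'_def v_def v'_def cR_def cL_def
  using J_supp J'_supp by (auto intro: supp_wmap)

lemma supp_ch: "x \<in> supp G \<Longrightarrow> ch x \<in> supp G"
  unfolding ch_def by (rule supp_wmap)

lemma supp_th: "x \<in> supp G \<Longrightarrow> thR x \<in> supp G" "x \<in> supp G \<Longrightarrow> thL x \<in> supp G"
  unfolding thR_def thL_def by (intro supp_mult_G supp_uv supp_ch; assumption)+

lemma supp_D: "x \<in> supp G \<Longrightarrow> D x \<in> supp (G \<times> G)"
  unfolding D_def comul_def by (intro supp_mult_GG J_supp J'_supp supp_wmap[where A = G]) auto

lemma supp_act: "X \<in> supp (G \<times> G) \<Longrightarrow> z \<in> supp G \<Longrightarrow> act X z \<in> supp G"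
  for z :: "'g \<Rightarrow>\<^sub>0 'k"
  unfolding act_def by (intro supp_lin) (auto intro!: supp_mult_G supp_sg uminus_G intro: keys_supp)

lemma supp_ract: "X \<in> supp (G \<times> G) \<Longrightarrow> z \<in> supp G \<Longrightarrow> ract z X \<in> supp G"
  for z :: "'g \<Rightarrow>\<^sub>0 'k"
  unfolding ract_def by (intro supp_lin) (auto intro!: supp_mult_G supp_sg uminus_G intro: keys_supp)

lemma supp_Q: "Q \<in> supp G" "Qi \<in> supp G"
  unfolding Q_def Qi_def by (intro supp_act supp_ract J_supp J'_supp supp_1)+

lemma supp_gS: "x \<in> supp G \<Longrightarrow> gS x \<in> supp G"
  unfolding gS_def by (rule supp_wmap) (auto intro: uminus_G)

lemma supp_Sj: "x \<in> supp G \<Longrightarrow> Sj x \<in> supp G"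
  unfolding Sj_def by (intro supp_mult_G supp_Q supp_gS)

lemma supp_ladj: "h \<in> supp G \<Longrightarrow> a \<in> supp G \<Longrightarrow> ladj h a \<in> supp G"
  unfolding ladj_def by (intro supp_mult_G supp_act supp_D supp_Q)

definition "Fix = {x \<in> supp G. thR x = x}"

lemma Fix_ksub: "ksub Fix"
  by (auto simp: Fix_def ksub_def supp_add supp_cst klin_add[OF klin_th(1)] klin_cst[OF klin_th(1)] klin_0[OF klin_th(1)])

lemma Fix_1: "1 \<in> Fix" and Fix_mult: "x \<in> Fix \<Longrightarrow> y \<in> Fix \<Longrightarrow> x * y \<in> Fix"
  by (auto simp: Fix_def supp_1 supp_mult_G th_mult)

lemma Fix_avg: "x \<in> supp G \<Longrightarrow> x + thR x \<in> Fix"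
  by (auto simp: Fix_def klin_add[OF klin_th(1)] th_th supp_add supp_th add.commute)

lemma thL_eq_thR: "u = v \<Longrightarrow> thL = thR"
  using inverse_unique2[of v v' u'] uu' by (auto simp: thL_def thR_def fun_eq_iff)

lemma Fix_D:
  assumes "u = v" "x \<in> Fix"
  shows "D x \<in> tspan Fix Fix"
proof -
  have x: "x \<in> supp G" "thR x = x" "thL x = x"
    using assms by (auto simp: Fix_def thL_eq_thR)
  have 1: "th1 (D x) = D x" "th2 (D x) = D x"
    using D_thR[of x] D_thL[of x] x by simp_all
  \<comment> \<open>\<open>D x\<close> is fixed by the commuting involutions \<open>th1\<close> and
    \<open>th2\<close>, so four times \<open>D x\<close> is the sum of its images under the four
    products of them. On a pure tensor that sum symmetrizes each factor into
    \<open>Fix\<close>.\<close>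
  let ?F = "\<lambda>(a, b). tens (pt a + thL (pt a)) (pt b + thR (pt b))"
  have "X + th1 X + th2 X + th1 (th2 X) = lin ?F X" for X
  proof (rule klin_eqI[where x = X])
    fix ab :: "'g \<times> 'g"
    obtain a b where "ab = (a, b)" by force
    then show "pt ab + th1 (pt ab) + th2 (pt ab) + th1 (th2 (pt ab)) = lin ?F (pt ab)"
      by (simp only: lin_single prod.case cst_1 mult_1) (simp only: tens_add tens_pt[symmetric] th_tens add_ac)
  qed (auto intro!: klin_plus klin_comp[of th1])
  from this[of "D x"] have 4: "D x + D x + D x + D x = lin ?F (D x)"
    by (simp add: 1)
  have "D x = cst (1 / 4) * (D x + D x + D x + D x)"
  proof -
    have "(4 :: 'k) = 1 + 1 + 1 + 1" by simp
    then have "D x + D x + D x + D x = cst 4 * D x"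
      by (simp only: cst_add cst_1 distrib_right mult_1)
    then show ?thesis by (simp flip: mult.assoc cst_mult)
  qed
  also have "\<dots> \<in> tspan Fix Fix"
    unfolding 4
  proof (intro tspan_cst tspan_lin ksubD(3)[OF Fix_ksub])
    fix ab assume "ab \<in> keys (D x)"
    then obtain a b where ab: "ab = (a, b)" "a \<in> G" "b \<in> G"
      using supp_D[OF x(1)] by (auto simp: supp_def)
    then have "pt a + thL (pt a) \<in> Fix" "pt b + thR (pt b) \<in> Fix"
      by (simp_all only: thL_eq_thR[OF assms(1)]) (intro Fix_avg supp_sg; assumption)+
    then show "?F ab \<in> tspan Fix Fix" using ab by (auto intro: tspan_tens)
  qed
  finally show ?thesis .
qed

lemma Fix_Sj: "u = v \<Longrightarrow> x \<in> Fix \<Longrightarrow> Sj x \<in> Fix"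
  by (simp add: Fix_def supp_Sj thR_Sj)

lemma Fix_ladj: "u = v \<Longrightarrow> h \<in> supp G \<Longrightarrow> x \<in> Fix \<Longrightarrow> ladj h x \<in> Fix"
  by (simp add: Fix_def supp_ladj thR_ladj)

text \<open>If \<open>thR\<close> fixed \<open>g\<close>, then \<open>u * ch g = g * u\<close>; the
  counit, which is 1 on \<open>u\<close>, would give \<open>chi g = 1\<close>.\<close>

lemma Fix_neq_supp:
  assumes "g \<in> G" "chi g \<noteq> 1"
  shows "Fix \<noteq> supp G"
proof
  assume "Fix = supp G"
  moreover have "pt g \<in> supp G" using assms(1) by (rule supp_sg)
  ultimately have "thR (pt g) = pt g" by (auto simp: Fix_def)
  then have "u * ch (pt g) * u' * u = pt g * u" by (simp add: thR_def)
  then have "eps (u * ch (pt g)) = eps (pt g * u)" by (simp add: mult.assoc)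
  then have "eps (ch (pt g)) = eps (pt g :: 'g \<Rightarrow>\<^sub>0 'k)" by (simp add: eps_mult eps_uv)
  then show False using assms by (simp add: ch_def)
qed

text \<open>If only scalars were fixed, then \<open>thR x = c(x) - x\<close> with scalar
  \<open>c(x)\<close>. Multiplicativity of \<open>thR\<close> makes \<open>2 (x y - y x)\<close> a
  scalar, and the counit shows that this scalar is 0.\<close>

lemma Fix_neq_cst:
  assumes "a \<in> G" "b \<in> G" "a + b \<noteq> b + a"
  shows "Fix \<noteq> range cst"
proof
  assume F: "Fix = range cst"
  have "\<exists>c. thR x = cst c - x" if "x \<in> supp G" for x
    using Fix_avg[OF that] F by (metis add_diff_cancel_left' imageE)
  then obtain c where c: "\<And>x. x \<in> supp G \<Longrightarrow> thR x = cst (c x) - x" by metis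
  have xy: "x * y + x * y = cst (c (x * y)) - cst (c x) * cst (c y) + cst (c x) * y + cst (c y) * x"
    if "x \<in> supp G" "y \<in> supp G" for x y
  proof -
    have "cst (c (x * y)) - x * y = (cst (c x) - x) * (cst (c y) - y)"
      using c that th_mult(1)[of x y] supp_mult_G by metis
    then show ?thesis by (simp add: algebra_simps cst_comm[of "c y" x])
  qed
  let ?x = "pt a :: 'g \<Rightarrow>\<^sub>0 'k" and ?y = "pt b :: 'g \<Rightarrow>\<^sub>0 'k"
  have s: "?x \<in> supp G" "?y \<in> supp G" by (intro supp_sg assms)+
  have "?x * ?y + ?x * ?y - (?y * ?x + ?y * ?x) = cst (c (?x * ?y)) - cst (c (?y * ?x))"
    unfolding xy[OF s] xy[OF s(2,1)] by (simp add: algebra_simps cst_comm[of "c ?x" "cst (c ?y)"])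
  then have eq: "sg (a + b) 2 - sg (b + a) 2 = (cst (c (?x * ?y) - c (?y * ?x)) :: 'g \<Rightarrow>\<^sub>0 'k)"
    by (simp add: mult_single cst_diff flip: single_add)
  have "c (?x * ?y) - c (?y * ?x) = 0"
    using arg_cong[OF eq, of eps] by (simp add: aug_diff cst_def)
  then have "sg (a + b) 2 = (sg (b + a) 2 :: 'g \<Rightarrow>\<^sub>0 'k)" using eq by simp
  then have "lookup (sg (a + b) (2::'k)) (a + b) = lookup (sg (b + a) 2) (a + b)" by simp
  then show False using assms(3) by (simp add: lookup_single when_def split: if_splits)
qed

end

section \<open>Normal Hopf subalgebras of a twisted group algebra\<close>

inductive_set pspan :: "'r::ring_1 set \<Rightarrow> 'r set \<Rightarrow> 'r set" for X Y where
  pspan_0: "0 \<in> pspan X Y"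
| pspan_step: "z \<in> pspan X Y \<Longrightarrow> x \<in> X \<Longrightarrow> y \<in> Y \<Longrightarrow> z + x * y \<in> pspan X Y"

lemma pspan_prod: "x \<in> X \<Longrightarrow> y \<in> Y \<Longrightarrow> x * y \<in> pspan X Y"
  using pspan_step[OF pspan_0] by fastforce

lemma pspan_add: "z \<in> pspan X Y \<Longrightarrow> w \<in> pspan X Y \<Longrightarrow> z + w \<in> pspan X Y"
proof -
  assume z: "z \<in> pspan X Y"
  assume "w \<in> pspan X Y"
  then show ?thesis by induction (auto intro: pspan.intros z simp: add.assoc[symmetric])
qed

lemma pspan_least:
  assumes "z \<in> pspan X Y" "0 \<in> V" "\<And>a b. a \<in> V \<Longrightarrow> b \<in> V \<Longrightarrow> a + b \<in> V"
    "\<And>x y. x \<in> X \<Longrightarrow> y \<in> Y \<Longrightarrow> x * y \<in> V"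
  shows "z \<in> V"
  using assms(1) by induction (auto intro: assms)

lemma tspan_mult:
  assumes "X \<in> tspan A B" "Y \<in> tspan A' B'"
    "\<And>a a'. a \<in> A \<Longrightarrow> a' \<in> A' \<Longrightarrow> a * a' \<in> C" "\<And>b b'. b \<in> B \<Longrightarrow> b' \<in> B' \<Longrightarrow> b * b' \<in> E"
  shows "X * Y \<in> tspan C E"
  using assms(1)
proof induction
  case (tspan_step X a b)
  have "tens a b * Y \<in> tspan C E"
    using assms(2)
    by induction (auto simp: distrib_left tens_mult intro!: tspan.intros assms(3,4) tspan_step.hyps)
  then show ?case using tspan_step.IH by (simp add: distrib_right tspan_add)
qed (auto intro: tspan_0)

lemma aug_tens: "aug (\<lambda>(a, b). f a * f' b) (tens x y) = aug f x * (aug f' y :: 'k::comm_semiring_1)"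
proof -
  let ?F = "\<lambda>x y. wmap (\<lambda>_. 0 :: nat) (\<lambda>(a, b). f a * f' b) (tens x y)"
    and ?H = "\<lambda>x y. wmap (\<lambda>_. 0 :: nat) f x * wmap (\<lambda>_. 0 :: nat) f' y"
  have "?F x y = ?H x y"
  proof (rule klin2_eqI[of ?F ?H])
    show "klin (\<lambda>x. ?F x y)" "klin (?F x)" for x y
      by (rule klin_comp[OF klin_wmap klin_tens(1)] klin_comp[OF klin_wmap klin_tens(2)])+
  qed (auto simp: mult_single)
  then show ?thesis by (simp flip: cst_aug cst_mult)
qed

definition klinf :: "(('g::monoid_add \<Rightarrow>\<^sub>0 'k::comm_semiring_1) \<Rightarrow> 'k) \<Rightarrow> bool" where
  "klinf p \<longleftrightarrow> (\<forall>x y. p (x + y) = p x + p y) \<and> (\<forall>c x. p (cst c * x) = c * p x)"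

lemma klinf_aug [intro!]: "klinf (aug w)"
  by (simp add: klinf_def aug_add aug_cst_mult)

lemma klinf_comp: "klinf p \<Longrightarrow> klin f \<Longrightarrow> klinf (\<lambda>x. p (f x))"
  by (simp add: klinf_def klin_def)

lemma klinf_klin: "klinf p \<Longrightarrow> klin (\<lambda>x. cst (p x))"
  by (simp add: klinf_def klin_def cst_add cst_mult)

lemma klinf_0: "klinf p \<Longrightarrow> p 0 = 0"
  unfolding klinf_def by (metis mult_zero_left mult_zero_right)

lemma klinf_sum: "klinf p \<Longrightarrow> p (sum f I) = (\<Sum>i\<in>I. p (f i))"
  by (induction I rule: infinite_finite_induct) (auto simp: klinf_0, simp add: klinf_def)

text \<open>The slice \<open>id \<otimes> p\<close>, determined by the values of \<open>p\<close> on
  group elements; for linear \<open>p\<close> it has the expected value on tensors, see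
  \<open>sl_tens\<close>.\<close>

definition sl :: "(('g::monoid_add \<Rightarrow>\<^sub>0 'k::comm_semiring_1) \<Rightarrow> 'k) \<Rightarrow> ('g \<times> 'g \<Rightarrow>\<^sub>0 'k) \<Rightarrow> 'g \<Rightarrow>\<^sub>0 'k" where
  "sl p = wmap fst (\<lambda>(a, b). p (pt b))"

lemma klin_sl [intro!]: "klin (sl p)"
  unfolding sl_def by auto

lemma sl_tens: 
  assumes "klinf p" shows "sl p (tens x y) = cst (p y) * x"
proof (rule klin2_eqI[of "\<lambda>x y. sl p (tens x y)" "\<lambda>x y. cst (p y) * x"])
  show "klin (\<lambda>x. sl p (tens x y))" "klin (\<lambda>y. sl p (tens x y))" for x y
    by (rule klin_comp[OF klin_sl klin_tens(1)] klin_comp[OF klin_sl klin_tens(2)])+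
qed (auto intro: klinf_klin assms simp: sl_def)

lemma sl_scale: "sl (\<lambda>y. c * p y) X = cst c * sl p X"
  by (rule klin_eqI[where x = X]) (auto simp: sl_def mult_ac)

locale normal_sub = twist +
  fixes A :: "('a \<Rightarrow>\<^sub>0 'b) set"
  assumes A_sub: "A \<subseteq> supp G"
    and A_ksub: "ksub A"
    and A_1: "1 \<in> A"
    and A_mult: "x \<in> A \<Longrightarrow> y \<in> A \<Longrightarrow> x * y \<in> A"
    and A_D: "x \<in> A \<Longrightarrow> D x \<in> tspan A A"
    and A_Sj: "x \<in> A \<Longrightarrow> Sj x \<in> A"
    and stable: "(\<forall>h\<in>supp G. \<forall>a\<in>A. ladj h a \<in> A) \<or> (\<forall>h\<in>supp G. \<forall>a\<in>A. radj h a \<in> A)"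
begin

lemma A_cst: "cst c \<in> A"
  using ksubD(3)[OF A_ksub A_1, of c] by simp

text \<open>\<open>Sj\<close> is injective and maps the finite-dimensional space \<open>A\<close>
  into itself, hence onto itself.\<close>

lemma A_Si: assumes "x \<in> A" shows "Si x \<in> A"
proof -
  have "inj Sj" by (rule inj_on_inverseI[of _ Si]) simp
  then have "Sj ` A = A"
    using injective_endo_surj[OF finite_G A_ksub A_sub] A_Sj by blast
  then show ?thesis using assms Si_Sj by (metis imageE)
qed

definition "Ap = {a \<in> A. eps a = 0}"
definition "IL = pspan (supp G) Ap"
definition "IR = pspan Ap (supp G)"

lemma eps_act: "eps (act X z) = eps X * eps z" and eps_ract: "eps (ract z X) = eps X * eps z"
  for z :: "'a \<Rightarrow>\<^sub>0 'b"
proof -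
  have "klin (\<lambda>X. cst (eps (act X z)) :: 'a \<Rightarrow>\<^sub>0 'b)" "klin (\<lambda>X. cst (eps (ract z X)) :: 'a \<Rightarrow>\<^sub>0 'b)"
    "klin (\<lambda>X :: 'a \<times> 'a \<Rightarrow>\<^sub>0 'b. cst (eps X * eps z) :: 'a \<Rightarrow>\<^sub>0 'b)"
    by (rule klinI; simp add: klin_add[OF klin_act(2)] klin_cst[OF klin_act(2)]
      klin_add[OF klin_ract(1)] klin_cst[OF klin_ract(1)] aug_add aug_cst_mult cst_add cst_mult distrib_right mult.assoc)+
  note kl = this
  have "cst (eps (act X z)) = (cst (eps X * eps z) :: 'a \<Rightarrow>\<^sub>0 'b)"
    by (rule klin_eqI[OF kl(1,3)]) (auto simp: eps_mult)
  moreover have "cst (eps (ract z X)) = (cst (eps X * eps z) :: 'a \<Rightarrow>\<^sub>0 'b)"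
    by (rule klin_eqI[OF kl(2,3)]) (auto simp: eps_mult)
  ultimately show "eps (act X z) = eps X * eps z" "eps (ract z X) = eps X * eps z" by simp_all
qed

lemma eps_J: "eps J = 1"
proof -
  have "eps (mp fst J) = eps J" by (simp add: aug_wmap)
  then show ?thesis by (simp add: counit_J aug_1)
qed

lemma eps_Q: "eps Q = 1" "eps Qi = 1"
proof -
  show "eps Q = 1" by (simp add: Q_def eps_act eps_J aug_1)
  then show "eps Qi = 1" using eps_mult[of Q Qi] by (simp add: aug_1)
qed

lemma eps_adj: "eps (ladj h a) = eps h * eps a" "eps (radj h a) = eps h * eps a"
  by (simp_all add: ladj_def radj_def eps_mult eps_act eps_ract eps_Q eps_D)

lemma eps_Sj: "eps (Sj a) = eps a"
  by (simp add: Sj_def eps_mult eps_Q gS_def aug_wmap)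

lemma Ap_ksub: "ksub Ap"
  using A_ksub by (auto simp: Ap_def ksub_def aug_add aug_cst_mult)

lemma Ap_sub: "Ap \<subseteq> supp G"
  using A_sub by (auto simp: Ap_def)

lemma pspan_cst:
  assumes "ksub X" "z \<in> pspan X Y" shows "cst c * z \<in> pspan X Y"
  using assms(2) by induction (auto simp: distrib_left mult.assoc[symmetric] intro!: pspan.intros ksubD(3)[OF assms(1)])

lemma pspan_ksub: "ksub X \<Longrightarrow> ksub (pspan X Y)"
  unfolding ksub_def[of "pspan X Y"] using pspan_cst by (auto intro: pspan_0 pspan_add)

text \<open>This is \<open>x\<^sub>1 a Sj(x\<^sub>2) x\<^sub>3 = x a\<close>: coassociativity brings
  the antipode next to \<open>x\<^sub>3\<close>. If \<open>A\<close> is stable under the left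
  adjoint action, it rewrites \<open>x a\<close> with the element of \<open>A\<close> in
  front.\<close>

lemma ladj_sum: "lin (\<lambda>(g, h). ladj (pt g) a * pt h) (D x) = x * a"
proof -
  have inner: "ladj (pt g) a * pt h = lin (\<lambda>(c, d). pt c * (a * Q) * pt (- d) * Qi * pt h) (D (pt g))" for g h
    unfolding ladj_def by (rule klin_eqI[where x = "D (pt g)"]) auto
  have "lin (\<lambda>(g, h). ladj (pt g) a * pt h) (D x) =
      lin (\<lambda>(g, h). lin (\<lambda>(c, d). pt c * (a * Q) * pt (- d) * Qi * pt h) (D (pt g))) (D x)"
    by (simp only: inner)
  also have "\<dots> = lin (\<lambda>(c, y). lin (\<lambda>(d, h). pt c * (a * Q) * pt (- d) * Qi * pt h) (D (pt y))) (D x)"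
    using coassoc_lin[of "\<lambda>(c, d, h). pt c * (a * Q) * pt (- d) * Qi * pt h" x] by simp
  also have "\<dots> = lin (\<lambda>(c, y). pt c * a) (D x)"
  proof -
    have "lin (\<lambda>(d, h). pt c * (a * Q) * pt (- d) * Qi * pt h) X = pt c * (a * Q) * ract Qi X" for c X
      by (rule klin_eqI[where x = X]) (auto simp: mult.assoc)
    then show ?thesis by (simp add: ract_D mult.assoc)
  qed
  also have "\<dots> = mp fst (D x) * a"
    by (rule klin_eqI[where x = "D x"]) auto
  finally show ?thesis by (simp add: counit_D)
qed

lemma radj_sum: "lin (\<lambda>(g, h). pt g * radj (pt h) a) (D x) = a * x"
proof -
  have inner: "pt g * radj (pt h) a = lin (\<lambda>(c, d). pt g * Q * pt (- c) * (Qi * a) * pt d) (D (pt h))" for g h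
    unfolding radj_def by (rule klin_eqI[where x = "D (pt h)"]) (auto simp: mult.assoc)
  have "lin (\<lambda>(g, h). pt g * radj (pt h) a) (D x) =
      lin (\<lambda>(g, h). lin (\<lambda>(c, d). pt g * Q * pt (- c) * (Qi * a) * pt d) (D (pt h))) (D x)"
    by (simp only: inner)
  also have "\<dots> = lin (\<lambda>(y, d). lin (\<lambda>(g, c). pt g * Q * pt (- c) * (Qi * a) * pt d) (D (pt y))) (D x)"
    using coassoc_lin[of "\<lambda>(g, c, d). pt g * Q * pt (- c) * (Qi * a) * pt d" x] by simp
  also have "\<dots> = lin (\<lambda>(y, d). a * pt d) (D x)"
  proof -
    have "lin (\<lambda>(g, c). pt g * Q * pt (- c) * (Qi * a) * pt d) X = act X Q * (Qi * a) * pt d" for d X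
      by (rule klin_eqI[where x = X]) auto
    then show ?thesis by (simp add: act_D mult.assoc)
  qed
  also have "\<dots> = a * mp snd (D x)"
    by (rule klin_eqI[where x = "D x"]) auto
  finally show ?thesis by (simp add: counit_D)
qed

lemma IL_IR_Sj: "x \<in> IL \<Longrightarrow> Sj x \<in> IR" "x \<in> IR \<Longrightarrow> Sj x \<in> IL"
  "x \<in> IL \<Longrightarrow> Si x \<in> IR" "x \<in> IR \<Longrightarrow> Si x \<in> IL"
proof -
  have Si_supp: "Si y \<in> supp G" if "y \<in> supp G" for y
    unfolding Si_def by (intro supp_gS supp_mult_G supp_Q that)
  have eSi: "eps (Si y) = eps y" for y using eps_Sj[of "Si y"] by simp
  have Ap: "Sj y \<in> Ap" "Si y \<in> Ap" if "y \<in> Ap" for y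
    using that A_Sj A_Si by (auto simp: Ap_def eps_Sj eSi)
  show "x \<in> IL \<Longrightarrow> Sj x \<in> IR" unfolding IL_def IR_def
    by (induction rule: pspan.induct) (auto simp: klin_0[OF klin_Sj] klin_add[OF klin_Sj] Sj_mult intro!: pspan.intros Ap supp_Sj)
  show "x \<in> IR \<Longrightarrow> Sj x \<in> IL" unfolding IL_def IR_def
    by (induction rule: pspan.induct) (auto simp: klin_0[OF klin_Sj] klin_add[OF klin_Sj] Sj_mult intro!: pspan.intros Ap supp_Sj)
  show "x \<in> IL \<Longrightarrow> Si x \<in> IR" unfolding IL_def IR_def
    by (induction rule: pspan.induct) (auto simp: klin_0[OF klin_Si] klin_add[OF klin_Si] Si_mult intro!: pspan.intros Ap Si_supp)
  show "x \<in> IR \<Longrightarrow> Si x \<in> IL" unfolding IL_def IR_def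
    by (induction rule: pspan.induct) (auto simp: klin_0[OF klin_Si] klin_add[OF klin_Si] Si_mult intro!: pspan.intros Ap Si_supp)
qed

text \<open>Stability on one side gives one inclusion. The antipode and its inverse exchange the two
  ideals, so applying one and then the other yields the opposite inclusion.\<close>

lemma IL_eq_IR: "IL = IR"
proof -
  have "IL \<subseteq> IR \<or> IR \<subseteq> IL"
    using stable
  proof
    assume st: "\<forall>h\<in>supp G. \<forall>a\<in>A. ladj h a \<in> A"
    have "h * a \<in> IR" if h: "h \<in> supp G" and a: "a \<in> Ap" for h a
    proof (subst ladj_sum[symmetric], rule ksub_lin)
      show "ksub IR" by (simp add: IR_def pspan_ksub Ap_ksub)
      fix gh assume "gh \<in> keys (D h)"
      then obtain g g' where gh: "gh = (g, g')" "g \<in> G" "g' \<in> G"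
        using keys_supp[OF supp_D[OF h]] by (cases gh) auto
      then have "ladj (pt g) a \<in> Ap" using st a by (auto simp: Ap_def eps_adj intro: supp_sg)
      then show "(\<lambda>(g, h). ladj (pt g) a * pt h) gh \<in> IR"
        using gh by (auto simp: IR_def intro!: pspan_prod supp_sg)
    qed
    then have "IL \<subseteq> IR" unfolding IL_def
      by (auto elim!: pspan_least simp: IR_def intro: pspan_0 pspan_add)
    then show ?thesis ..
  next
    assume st: "\<forall>h\<in>supp G. \<forall>a\<in>A. radj h a \<in> A"
    have "a * h \<in> IL" if h: "h \<in> supp G" and a: "a \<in> Ap" for h a
    proof (subst radj_sum[symmetric], rule ksub_lin)
      show "ksub IL" by (simp add: IL_def pspan_ksub ksub_supp)
      fix gh assume "gh \<in> keys (D h)"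
      then obtain g g' where gh: "gh = (g, g')" "g \<in> G" "g' \<in> G"
        using keys_supp[OF supp_D[OF h]] by (cases gh) auto
      then have "radj (pt g') a \<in> Ap" using st a by (auto simp: Ap_def eps_adj intro: supp_sg)
      then show "(\<lambda>(g, h). pt g * radj (pt h) a) gh \<in> IL"
        using gh by (auto simp: IL_def intro!: pspan_prod supp_sg)
    qed
    then have "IR \<subseteq> IL" unfolding IR_def
      by (auto elim!: pspan_least simp: IL_def intro: pspan_0 pspan_add)
    then show ?thesis ..
  qed
  then show ?thesis
  proof
    assume "IL \<subseteq> IR"
    moreover have "IR \<subseteq> IL" using IL_IR_Sj(2,4) \<open>IL \<subseteq> IR\<close> Sj_Si by (metis subsetD subsetI)
    ultimately show ?thesis ..
  next
    assume "IR \<subseteq> IL"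
    moreover have "IL \<subseteq> IR" using IL_IR_Sj(1,3) \<open>IR \<subseteq> IL\<close> Sj_Si by (metis subsetD subsetI)
    ultimately show ?thesis by blast
  qed
qed

lemma IL_ksub: "ksub IL"
  unfolding IL_def by (intro pspan_ksub ksub_supp)

lemma IL_left: "h \<in> supp G \<Longrightarrow> x \<in> IL \<Longrightarrow> h * x \<in> IL"
proof -
  assume h: "h \<in> supp G"
  assume "x \<in> IL"
  then show ?thesis unfolding IL_def
    by induction (auto simp: distrib_left mult.assoc[symmetric] intro!: pspan.intros supp_mult_G h)
qed

lemma IL_right: "h \<in> supp G \<Longrightarrow> x \<in> IL \<Longrightarrow> x * h \<in> IL"
proof -
  assume h: "h \<in> supp G"
  assume "x \<in> IL"
  then show ?thesis unfolding IL_eq_IR unfolding IR_def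
    by induction (auto simp: distrib_right mult.assoc intro!: pspan.intros supp_mult_G h)
qed

lemma IL_eps: "x \<in> IL \<Longrightarrow> eps x = 0"
  unfolding IL_def by (induction rule: pspan.induct) (auto simp: aug_add eps_mult Ap_def)

lemma IL_supp: "IL \<subseteq> supp G"
  unfolding IL_def using Ap_sub by (auto elim!: pspan_least intro!: supp_add supp_mult_G)

lemma Ap_IL: "Ap \<subseteq> IL"
  unfolding IL_def using pspan_prod[OF supp_1] by fastforce

text \<open>The sum \<open>I \<otimes> H + H \<otimes> I\<close>. It is a two-sided ideal of
  \<open>H \<otimes> H\<close>, and a coproduct lying in it is the coideal condition.\<close>

definition "Tid = {Y + Z |Y Z. Y \<in> tspan IL (supp G) \<and> Z \<in> tspan (supp G) IL}"

lemma Tid_add: "X \<in> Tid \<Longrightarrow> Y \<in> Tid \<Longrightarrow> X + Y \<in> Tid"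
proof -
  assume "X \<in> Tid" "Y \<in> Tid"
  then obtain a b c d where "X = a + b" "Y = c + d" "a \<in> tspan IL (supp G)" "c \<in> tspan IL (supp G)"
    "b \<in> tspan (supp G) IL" "d \<in> tspan (supp G) IL"
    by (auto simp: Tid_def)
  then show ?thesis
    unfolding Tid_def by (intro CollectI exI[of _ "a + c"] exI[of _ "b + d"]) (auto intro: tspan_add simp: add_ac)
qed

lemma Tid_mult: assumes "X \<in> supp (G \<times> G)" "Y \<in> Tid" shows "X * Y \<in> Tid" "Y * X \<in> Tid"
proof -
  note X = supp_tspan[OF assms(1)]
  from assms(2) obtain a b where Y: "Y = a + b" "a \<in> tspan IL (supp G)" "b \<in> tspan (supp G) IL"
    by (auto simp: Tid_def)
  have "X * a \<in> tspan IL (supp G)" "X * b \<in> tspan (supp G) IL"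
    "a * X \<in> tspan IL (supp G)" "b * X \<in> tspan (supp G) IL"
    by (rule tspan_mult[OF X Y(2)] tspan_mult[OF X Y(3)] tspan_mult[OF Y(2) X] tspan_mult[OF Y(3) X];
        auto intro: IL_left IL_right supp_mult_G)+
  then show "X * Y \<in> Tid" "Y * X \<in> Tid"
    unfolding Tid_def Y(1) distrib_left distrib_right by blast+
qed

lemma mp_snd_tens: "mp snd (tens p q) = cst (eps p) * q" and mp_fst_tens: "mp fst (tens p q) = cst (eps q) * p"
  for p q :: "'a \<Rightarrow>\<^sub>0 'b"
proof -
  have "mp fst (tens p q) = sl eps (tens p q)" by (simp add: sl_def case_prod_unfold)
  then show "mp fst (tens p q) = cst (eps q) * p" by (simp add: sl_tens klinf_aug)
  show "mp snd (tens p q) = cst (eps p) * q"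
    by (rule klin2_eqI[of "\<lambda>p q. mp snd (tens p q)" "\<lambda>p q. cst (eps p) * q"])
       (auto intro: klin_comp[OF klin_wmap klin_tens(1)] klin_comp[OF klin_wmap klin_tens(2)] klinf_klin)
qed

lemma D_Ap: assumes "a \<in> Ap" shows "D a \<in> Tid"
proof -
  \<comment> \<open>Replacing \<open>p \<otimes> q\<close> by \<open>1 \<otimes> eps(p) q\<close>
    costs \<open>(p - eps(p)) \<otimes> q\<close>, whose left factor lies in the augmentation ideal
    of \<open>A\<close>. For \<open>X = D a\<close> the counit axiom makes the replacement equal to
    \<open>1 \<otimes> a\<close>.\<close>
  have "X - tens 1 (mp snd X) \<in> tspan IL (supp G)" if "X \<in> tspan A A" for X
    using that
  proof induction
    case tspan_0
    then show ?case by (simp add: klin_0[OF klin_wmap] klin_0[OF klin_tens(2)] tspan.tspan_0)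
  next
    case (tspan_step X p q)
    have "p - cst (eps p) \<in> Ap"
      using tspan_step A_cst ksub_diff[OF A_ksub] by (auto simp: Ap_def aug_diff cst_def)
    then have "tens (p - cst (eps p)) q \<in> tspan IL (supp G)"
      using Ap_IL A_sub tspan_step.hyps by (auto intro: tspan_tens)
    moreover have "X + tens p q - tens 1 (mp snd (X + tens p q)) = (X - tens 1 (mp snd X)) + tens (p - cst (eps p)) q"
      by (simp add: tens_cst(1)[of "eps p" 1 q, simplified] klin_add[OF klin_wmap] mp_snd_tens tens_add tens_cst klin_diff[OF klin_tens(1)])
    ultimately show ?case using tspan_step.IH by (simp only: tspan_add)
  qed
  from this[OF A_D] have "D a - tens 1 a \<in> tspan IL (supp G)"
    using assms by (simp add: Ap_def counit_D)
  moreover have "tens 1 a \<in> tspan (supp G) IL"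
    using assms Ap_IL supp_1 by (auto intro: tspan_tens)
  ultimately show ?thesis unfolding Tid_def by (metis (mono_tags, lifting) diff_add_cancel mem_Collect_eq)
qed

lemma comul_IL: assumes "x \<in> IL" shows "comul x \<in> Tid"
proof -
  have 0: "0 \<in> Tid" unfolding Tid_def using tspan_0 by force
  have "D x \<in> Tid" using assms unfolding IL_def
    by induction (auto simp: klin_0[OF klin_D] klin_add[OF klin_D] D_mult 0 intro!: Tid_add Tid_mult(1)[OF supp_D D_Ap])
  \<comment> \<open>Because \<open>Tid\<close> is a two-sided ideal, conjugation by \<open>J\<close>
    can be undone inside it, and the statement passes from \<open>D\<close> to the untwisted
    coproduct.\<close>
  then have "J' * D x * J \<in> Tid" by (intro Tid_mult J_supp J'_supp)
  then show ?thesis by (simp add: D_def mult.assoc)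
qed

section \<open>Functions on the group vanishing on the ideal\<close>

definition "perp f \<longleftrightarrow> (\<forall>x\<in>IL. aug f x = 0)"

lemma perp_1: "perp (\<lambda>_. 1)"
  by (simp add: perp_def IL_eps)

text \<open>Pairing with a pointwise product is pairing \<open>f \<otimes> f'\<close> with the
  coproduct, and each half of \<open>Tid\<close> is killed by one of the two factors.\<close>

lemma perp_mult:
  assumes "perp f" "perp f'" shows "perp (\<lambda>g. f g * f' g)"
  unfolding perp_def
proof
  fix x assume "x \<in> IL"
  then obtain Y Z where YZ: "comul x = Y + Z" "Y \<in> tspan IL (supp G)" "Z \<in> tspan (supp G) IL"
    using comul_IL[of x] unfolding Tid_def by blast
  let ?F = "\<lambda>(a, b). f a * f' b"
  have "aug ?F Y = 0" using YZ(2)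
    by induction (use assms(1) in \<open>auto simp: aug_add aug_tens perp_def\<close>)
  moreover have "aug ?F Z = 0" using YZ(3)
    by induction (use assms(2) in \<open>auto simp: aug_add aug_tens perp_def\<close>)
  moreover have "aug (\<lambda>g. f g * f' g) x = aug ?F (comul x)"
    by (simp add: comul_def aug_wmap)
  ultimately show "aug (\<lambda>g. f g * f' g) x = 0" by (simp add: YZ aug_add)
qed

lemma perp_prod: "finite H \<Longrightarrow> (\<And>h. h \<in> H \<Longrightarrow> perp (f h)) \<Longrightarrow> perp (\<lambda>x. \<Prod>h\<in>H. f h x)"
  by (induction H rule: finite_induct) (auto intro: perp_1 perp_mult)

lemma aug_shift: "aug (\<lambda>x. f x - c) x = aug f x - c * eps x" for c :: 'b
  by (simp add: aug_def sum_subtractf sum_distrib_left algebra_simps)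

lemma perp_separate:
  assumes "z \<notin> IL" shows "\<exists>f. perp f \<and> aug f z = 1"
  using separating_functional[OF IL_ksub assms] by (simp add: perp_def)

lemma A_decomp: "a \<in> A \<Longrightarrow> a - cst (eps a) \<in> Ap"
  using A_cst ksub_diff[OF A_ksub] by (auto simp: Ap_def aug_diff cst_def)

lemma A_eq_scalars:
  assumes triv: "\<And>g. g \<in> G \<Longrightarrow> pt g - 1 \<in> IL \<Longrightarrow> g = 0"
  shows "A = range cst"
proof -
  have sep: "\<exists>f. perp f \<and> f g = 1 \<and> f h = 0" if gh: "g \<in> G" "h \<in> G" "g \<noteq> h" for g h
  proof -
    have "pt g - pt h \<notin> IL"
    proof
      assume "pt g - pt h \<in> IL"
      then have "pt (- h) * (pt g - pt h) \<in> IL" by (intro IL_left supp_sg uminus_G gh)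
      then have "pt (- h + g) - 1 \<in> IL" by (simp add: right_diff_distrib mult_single)
      then have "- h + g = 0" using triv gh add_G uminus_G by blast
      then show False using gh(3) by (metis add.right_neutral add_minus_cancel)
    qed
    then obtain f where f: "perp f" "aug f (pt g - pt h) = 1" using perp_separate by blast
    \<comment> \<open>Constants pair with \<open>IL\<close> through the counit, hence to 0, so
      \<open>f\<close> may be shifted to vanish at \<open>h\<close>.\<close>
    have "perp (\<lambda>x. f x - f h)" using f(1) by (simp add: perp_def aug_shift IL_eps)
    then show ?thesis using f(2) by (intro exI[of _ "\<lambda>x. f x - f h"]) (simp add: aug_diff)
  qed
  have "x = 0" if x: "x \<in> IL" for x
  proof (rule poly_mapping_eqI)
    fix g
    show "lookup x g = lookup 0 g"
    proof (cases "g \<in> G")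
      case True
      then obtain f where f: "\<And>h. h \<in> G - {g} \<Longrightarrow> perp (f h) \<and> f h g = 1 \<and> f h h = 0"
        using sep by (metis DiffE singletonI)
      \<comment> \<open>On \<open>G\<close> this product is the indicator function of
        \<open>g\<close>, so its pairing with \<open>x\<close> is the coefficient at
        \<open>g\<close>.\<close>
      let ?F = "\<lambda>x. \<Prod>h\<in>G - {g}. f h x"
      have "perp ?F" using f finite_G by (intro perp_prod) auto
      then have "0 = aug ?F x" using x by (simp add: perp_def)
      also have "\<dots> = (\<Sum>a\<in>G. lookup x a * ?F a)"
        using x IL_supp finite_G by (intro aug_superset) (auto simp: supp_def)
      also have "\<dots> = (\<Sum>a\<in>G. if a = g then lookup x a else 0)"
      proof (intro sum.cong refl)
        fix a assume a: "a \<in> G"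
        show "lookup x a * ?F a = (if a = g then lookup x a else 0)"
          using f a finite_G by (auto intro!: prod.neutral prod_zero)
      qed
      finally show ?thesis using True finite_G by simp
    next
      case False
      then show ?thesis using x IL_supp by (auto simp: supp_def in_keys_iff subset_iff)
    qed
  qed
  then have "a = cst (eps a)" if "a \<in> A" for a
    using A_decomp[OF that] Ap_IL by force
  then show ?thesis using A_cst by auto
qed

lemma D12_sl: "D (sl p X) = wmap (\<lambda>(a, b, c). (a, b)) (\<lambda>(a, b, c). p (pt c)) (D12 X)"
proof (rule klin_eqI[where x = X])
  show "klin (\<lambda>X. D (sl p X))" by (rule klin_comp[OF klin_D klin_sl])
  show "klin (\<lambda>X. wmap (\<lambda>(a, b, c). (a, b)) (\<lambda>(a, b, c). p (pt c)) (D12 X) :: 'a \<times> 'a \<Rightarrow>\<^sub>0 'b)"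
    by (rule klin_comp[OF klin_wmap klin_D12])
  fix ab :: "'a \<times> 'a"
  obtain a b where ab: "ab = (a, b)" by force
  have "wmap (\<lambda>(a, b, c). (a, b)) (\<lambda>(a, b, c). p (pt c)) (in12 Y * sg (0, 0, b) 1) = cst (p (pt b)) * Y"
    for Y :: "'a \<times> 'a \<Rightarrow>\<^sub>0 'b"
    by (rule klin_eqI[where x = Y]) (auto intro: klin_comp[OF klin_wmap] simp: mult_single)
  moreover have "sl p (pt ab) = cst (p (pt b)) * pt a" by (simp add: sl_def ab)
  ultimately show "D (sl p (pt ab)) = wmap (\<lambda>(a, b, c). (a, b)) (\<lambda>(a, b, c). p (pt c)) (D12 (pt ab))"
    using D12_tens[of "pt a" "pt b"] by (simp add: ab klin_cst[OF klin_D] del: cst_mult_single)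
qed

definition conv where "conv p q y = aug (\<lambda>(b, c). p (pt b) * q (pt c)) (D y)"

text \<open>By coassociativity both sides are
  \<open>w\<^sub>1 p(w\<^sub>2) q(w\<^sub>3)\<close>.\<close>

lemma sl_D_sl: "sl p (D (sl q (D w))) = sl (conv p q) (D w)"
proof -
  have "sl p (D (sl q (D w))) = lin (\<lambda>(a, b, c). sg a (q (pt c) * p (pt b))) (D12 (D w))"
    by (simp only: D12_sl) (simp add: sl_def wmap_wmap case_prod_unfold, simp add: wmap_def case_prod_unfold)
  also have "\<dots> = lin (\<lambda>(a, y). lin (\<lambda>(b, c). sg a (q (pt c) * p (pt b))) (D (pt y))) (D w)"
    by (simp add: coassoc lin_D23)
  also have "\<dots> = sl (conv p q) (D w)"
  proof -
    have "lin (\<lambda>(b, c). sg a (q (pt c) * p (pt b))) X = sg a (aug (\<lambda>(b, c). p (pt b) * q (pt c)) X)"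
      for a :: 'a and X :: "'a \<times> 'a \<Rightarrow>\<^sub>0 'b"
    proof -
      have "klin (\<lambda>X. sg a (aug (\<lambda>(b, c). p (pt b) * q (pt c)) X))"
        by (rule klinI) (simp_all add: aug_add aug_cst_mult single_add)
      from klin_eqI[OF klin_lin this, of X] show ?thesis by (auto simp: mult_ac)
    qed
    then show ?thesis by (simp add: sl_def wmap_def conv_def case_prod_unfold)
  qed
  finally show ?thesis .
qed

text \<open>The inverse antipode applied to \<open>antipode_left\<close> reverses the product,
  giving the identity for \<open>Si(y\<^sub>2) y\<^sub>1\<close>.\<close>

lemma Si_lin: "lin (\<lambda>(b, d). Si (pt d) * pt b) (D y) = cst (eps y)"
proof -
  have "Si (lin (\<lambda>(a, b). Sj (pt a) * pt b) X) = lin (\<lambda>(b, d). Si (pt d) * pt b) X" for X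
    by (rule klin_eqI[where x = X]) (auto intro: klin_comp[OF klin_Si] simp: Si_mult)
  from this[of "D y"] show ?thesis
    by (simp add: antipode_left) (simp add: Si_def mult.assoc flip: cst_comm)
qed

text \<open>The left side is \<open>(1 \<otimes> Si(h\<^sub>3)) (h\<^sub>1 \<otimes> h\<^sub>2) D
  y\<close>, where \<open>Si(h\<^sub>3) h\<^sub>2\<close> collapses to the counit. It lets left
  multiplication by \<open>h\<close> outside a slice be moved inside the coproduct.\<close>

lemma i1_via_D: "lin (\<lambda>(c, d). i2 (Si (pt d)) * D (pt c * y)) (D h) = i1 h * D y"
proof -
  have 1: "i2 (Si (pt d)) * D (pt c * y) = lin (\<lambda>(a, b). i2 (Si (pt d)) * pt (a, b) * D y) (D (pt c))" for c d
  proof -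
    have "i2 (Si (pt d)) * D (pt c * y) = i2 (Si (pt d)) * D (pt c) * D y"
      by (simp add: D_mult mult.assoc)
    also have "\<dots> = lin (\<lambda>ab. i2 (Si (pt d)) * pt ab * D y) (D (pt c))"
      by (rule klin_expand) auto
    finally show ?thesis by (simp add: case_prod_unfold)
  qed
  have 2: "lin (\<lambda>(b, d). i2 (Si (pt d)) * pt (a, b) * D y) X = tens (pt a) (lin (\<lambda>(b, d). Si (pt d) * pt b) X) * D y" for a X
    by (rule klin_eqI[where x = X])
       (auto intro!: klin_mult_right klin_comp[OF klin_tens(2) klin_lin] simp: tens_mult simp flip: tens_pt)
  have "lin (\<lambda>(c, d). i2 (Si (pt d)) * D (pt c * y)) (D h) =
     lin (\<lambda>(c, d). lin (\<lambda>(a, b). i2 (Si (pt d)) * pt (a, b) * D y) (D (pt c))) (D h)"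
    by (simp only: 1)
  also have "\<dots> = lin (\<lambda>(a, y'). lin (\<lambda>(b, d). i2 (Si (pt d)) * pt (a, b) * D y) (D (pt y'))) (D h)"
    using coassoc_lin[of "\<lambda>(a, b, d). i2 (Si (pt d)) * pt (a, b) * D y" h] by simp
  also have "\<dots> = lin (\<lambda>(a, y'). tens (pt a) 1 * D y) (D h)"
    by (simp only: 2 Si_lin aug_sg mult_1 cst_1)
  also have "\<dots> = i1 (mp fst (D h)) * D y"
    by (rule klin_eqI[where x = "D h"]) (auto intro!: klin_mult_right klin_comp[OF klin_tens(1) klin_wmap])
  finally show ?thesis by (simp add: counit_D)
qed

end

section \<open>Left integrals of \<open>A\<close>, and the case where every group element is trivial
  modulo the ideal\<close>

context normal_sub
begin

abbreviation "mS \<equiv> lin (\<lambda>(c, d). pt c * Sj (pt d))"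

lemma klin_SS: "klin (\<lambda>x. Sj (Sj x))"
  by (rule klin_comp[OF klin_Sj klin_Sj])

lemma mS_tens: "mS (tens p q) = p * Sj q"
  by (rule klin2_eqI[of "\<lambda>p q. mS (tens p q)" "\<lambda>p q. p * Sj q"])
     (auto intro: klin_comp[OF klin_lin klin_tens(1)] klin_comp[OF klin_lin klin_tens(2)])

lemma sl_tspan_in_A:
  assumes "klinf p" "X \<in> tspan A A" shows "sl p X \<in> A"
  using assms(2)
  by induction (auto simp: klin_0[OF klin_sl] klin_add[OF klin_sl] sl_tens[OF assms(1)] intro!: ksubD[OF A_ksub])

text \<open>
  With dual bases \<open>b\<^sub>i\<close>, \<open>f\<^sub>i\<close> of \<open>A\<close>, the values of \<open>P x = \<Sum>\<^sub>i (id \<otimes> f\<^sub>i S\<^sup>2) (\<Delta>\<^sub>J (b\<^sub>i x))\<close> are left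
  integrals, and \<open>\<Sum>\<^sub>i (id \<otimes> f\<^sub>i S) (\<Delta>\<^sub>J (P b\<^sub>i)) = 1\<close> prevents all of them from vanishing.
\<close>

lemma left_integral_exists:
  obtains L where "L \<in> A" "L \<noteq> 0" "\<And>h. h \<in> A \<Longrightarrow> h * L = cst (eps h) * L"
proof -
  obtain B and e where B: "finite B" "B \<subseteq> A"
    and dual: "\<And>a. a \<in> A \<Longrightarrow> a = (\<Sum>b\<in>B. cst (aug (e b) a) * b)"
    by (rule dual_basis[OF finite_G A_ksub A_sub]) (rule that)
  define f where "f b = aug (e b)" for b
  have kf [intro!]: "klinf (f b)" for b by (simp add: f_def klinf_aug)
  have dual: "a = (\<Sum>b\<in>B. cst (f b a) * b)" if "a \<in> A" for a
    unfolding f_def by (rule dual[OF that])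
  have f_sc: "f b (cst c * x) = c * f b x" for b c x using kf by (simp add: klinf_def)
  have f_mult: "f l (x * y) = (\<Sum>b\<in>B. f b y * f l (x * b))" if "y \<in> A" for l x y
  proof -
    have "f l (x * y) = f l (\<Sum>b\<in>B. cst (f b y) * (x * b))"
      by (subst dual[OF that]) (simp add: sum_distrib_left scal_left)
    then show ?thesis by (simp add: klinf_sum[OF kf] f_sc)
  qed
  define p where "p b y = f b (Sj (Sj y))" for b y
  have kp [intro!]: "klinf (p b)" for b
    unfolding p_def by (rule klinf_comp[OF kf klin_SS])
  define P where "P x = (\<Sum>i\<in>B. sl (p i) (D (i * x)))" for x
  have P_A: "P x \<in> A" if "x \<in> A" for x
    unfolding P_def using B(2) that
    by (intro ksub_sum[OF A_ksub] sl_tspan_in_A kp A_D A_mult) auto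
  have P_int: "h * P x = cst (eps h) * P x" if h: "h \<in> A" and x: "x \<in> A" for h x
  proof -
    \<comment> \<open>At \<open>X = D h\<close> this is \<open>(h \<otimes> 1) D (i * x)\<close> by
      \<open>i1_via_D\<close>, which is how \<open>h * P x\<close> arises. Working with arbitrary
      \<open>X\<close> allows an induction over sums of tensors in
      \<open>A \<otimes> A\<close>.\<close>
    let ?Psi = "\<lambda>i X. lin (\<lambda>(c, d). i2 (Si (pt d)) * D (pt c * (i * x))) X"
    have Psi_tens: "?Psi i (tens r q) = i2 (Si q) * D (r * (i * x))" for i r q
    proof (rule klin2_eqI[of "\<lambda>r q. ?Psi i (tens r q)" "\<lambda>r q. i2 (Si q) * D (r * (i * x))"])
      show "klin (\<lambda>r. ?Psi i (tens r q))" "klin (\<lambda>q. ?Psi i (tens r q))" for r q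
        by (rule klin_comp[OF klin_lin klin_tens(1)] klin_comp[OF klin_lin klin_tens(2)])+
      show "klin (\<lambda>r. i2 (Si q) * D (r * (i * x)))" for q
        by (intro klin_mult_left klin_comp[OF klin_D klin_mult_right] klin_id)
      show "klin (\<lambda>q. i2 (Si q) * D (r * (i * x)))" for r
        by (intro klin_mult_right klin_comp[OF klin_tens(2) klin_Si])
    qed simp
    \<comment> \<open>The square of the antipode in \<open>p\<close> sends \<open>Si q * t\<close>
      to \<open>Sj q * Sj (Sj t)\<close>, again in \<open>A\<close>. Summing over \<open>i\<close>
      then recombines the dual basis and puts this element in place of \<open>i\<close>.\<close>
    have inner: "(\<Sum>i\<in>B. cst (f j (r * i)) * sl (p i) (i2 (Si q) * Y)) = sl (\<lambda>y. f j (r * Sj q * Sj (Sj y))) Y"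
      if "q \<in> A" "Y \<in> tspan A A" for j r q Y
      using that(2)
    proof induction
      case tspan_0
      then show ?case by (simp add: klin_0[OF klin_sl])
    next
      case (tspan_step Y s t)
      have kl: "klinf (\<lambda>y. f j (r * Sj q * Sj (Sj y)))"
        by (rule klinf_comp[OF kf klin_mult_left[OF klin_SS]])
      have w: "Sj q * Sj (Sj t) \<in> A" using that(1) tspan_step.hyps by (intro A_mult A_Sj)
      have "(\<Sum>i\<in>B. cst (f j (r * i)) * sl (p i) (i2 (Si q) * tens s t))
        = (\<Sum>i\<in>B. cst (f j (r * i)) * (cst (f i (Sj q * Sj (Sj t))) * s))"
        by (simp add: tens_mult sl_tens[OF kp] p_def Sj_mult)
      also have "\<dots> = cst (\<Sum>i\<in>B. f i (Sj q * Sj (Sj t)) * f j (r * i)) * s"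
        by (simp add: cst_sum sum_distrib_right mult.assoc[symmetric] mult.commute[of "f j _"] flip: cst_mult)
      also have "\<dots> = sl (\<lambda>y. f j (r * Sj q * Sj (Sj y))) (tens s t)"
        unfolding sl_tens[OF kl] f_mult[OF w, symmetric] by (simp only: mult.assoc)
      finally show ?case using tspan_step.IH
        by (simp add: distrib_left klin_add[OF klin_sl] sum.distrib)
    qed
    have claim: "(\<Sum>i\<in>B. sl (p i) (?Psi i X)) = (\<Sum>j\<in>B. sl (\<lambda>y. f j (mS X * Sj (Sj y))) (D (j * x)))"
      if "X \<in> tspan A A" for X
      using that
    proof induction
      case tspan_0
      have "sl (\<lambda>y. 0) X = 0" for X :: "'a \<times> 'a \<Rightarrow>\<^sub>0 'b" using sl_scale[of 0 "\<lambda>_. 0" X] by simp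
      moreover have "f j 0 = 0" for j by (rule klinf_0[OF kf])
      ultimately show ?case by (simp add: klin_0[OF klin_sl])
    next
      case (tspan_step X r q)
      have Dexp: "D (r * (i * x)) = (\<Sum>j\<in>B. cst (f j (r * i)) * D (j * x))" if "i \<in> B" for i
      proof -
        have "r * i \<in> A" using that B(2) tspan_step.hyps A_mult by auto
        then have "D (r * (i * x)) = D ((\<Sum>j\<in>B. cst (f j (r * i)) * j) * x)"
          by (simp add: mult.assoc flip: dual)
        also have "\<dots> = (\<Sum>j\<in>B. D (cst (f j (r * i)) * (j * x)))"
          by (simp only: sum_distrib_right klin_sum[OF klin_D] mult.assoc)
        finally show ?thesis by (simp only: klin_cst[OF klin_D])
      qed
      have "(\<Sum>i\<in>B. sl (p i) (?Psi i (tens r q))) =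
         (\<Sum>i\<in>B. \<Sum>j\<in>B. cst (f j (r * i)) * sl (p i) (i2 (Si q) * D (j * x)))"
        unfolding Psi_tens
        by (intro sum.cong refl) (simp add: Dexp sum_distrib_left klin_sum[OF klin_sl] scal_left klin_cst[OF klin_sl])
      also have "\<dots> = (\<Sum>j\<in>B. \<Sum>i\<in>B. cst (f j (r * i)) * sl (p i) (i2 (Si q) * D (j * x)))"
        by (rule sum.swap)
      also have "\<dots> = (\<Sum>j\<in>B. sl (\<lambda>y. f j (mS (tens r q) * Sj (Sj y))) (D (j * x)))"
      proof (intro sum.cong refl)
        fix j assume "j \<in> B"
        then have "D (j * x) \<in> tspan A A" using B(2) x by (intro A_D A_mult) auto
        then show "(\<Sum>i\<in>B. cst (f j (r * i)) * sl (p i) (i2 (Si q) * D (j * x))) =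
          sl (\<lambda>y. f j (mS (tens r q) * Sj (Sj y))) (D (j * x))"
          unfolding mS_tens using tspan_step.hyps by (intro inner)
      qed
      finally have "(\<Sum>i\<in>B. sl (p i) (?Psi i (X + tens r q))) =
        (\<Sum>j\<in>B. sl (\<lambda>y. f j (mS X * Sj (Sj y))) (D (j * x)) + sl (\<lambda>y. f j (mS (tens r q) * Sj (Sj y))) (D (j * x)))"
        using tspan_step.IH by (simp add: lin_add klin_add[OF klin_sl] sum.distrib)
      also have "\<dots> = (\<Sum>j\<in>B. sl (\<lambda>y. f j (mS (X + tens r q) * Sj (Sj y))) (D (j * x)))"
      proof (intro sum.cong refl)
        fix j
        have "f j (x + y) = f j x + f j y" for x y using kf[of j] by (simp add: klinf_def)
        moreover have "sl (\<lambda>y. g y + h y) Z = sl g Z + sl h Z" for g h :: "('a \<Rightarrow>\<^sub>0 'b) \<Rightarrow> 'b" and Z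
          by (rule klin_eqI[where x = Z]) (auto simp: sl_def distrib_left single_add)
        ultimately show "sl (\<lambda>y. f j (mS X * Sj (Sj y))) (D (j * x)) + sl (\<lambda>y. f j (mS (tens r q) * Sj (Sj y))) (D (j * x))
          = sl (\<lambda>y. f j (mS (X + tens r q) * Sj (Sj y))) (D (j * x))"
          by (simp add: lin_add distrib_right)
      qed
      finally show ?case .
    qed
    have i1: "h * sl g X = sl g (i1 h * X)" for g X
    proof (rule klin2_eqI[of "\<lambda>h X. h * sl g X" "\<lambda>h X. sl g (i1 h * X)"])
      show "klin (\<lambda>h. sl g (i1 h * X))" for X
        by (rule klin_comp[OF klin_sl klin_mult_right[OF klin_tens(1)]])
      show "klin (\<lambda>X. sl g (i1 h * X))" for h
        by (rule klin_comp[OF klin_sl klin_mult_left[OF klin_id]])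
      show "pt a * sl g (pt b) = sl g (i1 (pt a) * pt b)" for a b
        by (cases b) (simp add: sl_def i1_eq mult_single)
    qed (intro klin_mult_right klin_mult_left klin_id klin_sl)+
    have "h * P x = (\<Sum>i\<in>B. sl (p i) (?Psi i (D h)))"
      by (simp add: P_def sum_distrib_left i1 i1_via_D)
    also have "\<dots> = (\<Sum>j\<in>B. sl (\<lambda>y. f j (mS (D h) * Sj (Sj y))) (D (j * x)))"
      by (rule claim[OF A_D[OF h]])
    also have "\<dots> = cst (eps h) * P x"
      by (simp add: antipode_right f_sc sl_scale P_def sum_distrib_left p_def[abs_def])
    finally show ?thesis .
  qed
  define q where "q b z = f b (Sj z)" for b z
  have kq [intro!]: "klinf (q b)" for b
    unfolding q_def by (rule klinf_comp[OF kf klin_Sj])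
  have "(\<Sum>k\<in>B. sl (q k) (D (P k))) = 1"
  proof -
    \<comment> \<open>By the dual basis property the sum is \<open>f l\<close> of
      \<open>Sj (Sj s\<^sub>2) * Sj s\<^sub>1\<close>, which is
      \<open>Sj (s\<^sub>1 * Sj s\<^sub>2)\<close>, so the antipode axiom evaluates it.\<close>
    have conv_sum: "(\<Sum>k\<in>B. \<Sum>i\<in>B. f l (i * k) * conv (q k) (p i) s) = f l 1 * eps s"
      if s: "s \<in> A" for l s
    proof -
      have "(\<Sum>k\<in>B. \<Sum>i\<in>B. f l (i * k) * aug (\<lambda>(b, c). q k (pt b) * p i (pt c)) Z) = f l (Sj (mS Z))"
        if "Z \<in> tspan A A" for Z
        using that
      proof induction
        case tspan_0
        then show ?case by (simp add: klin_0[OF klin_Sj] klinf_0[OF kf])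
      next
        case (tspan_step Z b c)
        have pt_aug: "aug (\<lambda>b. g (pt b)) y = g y" if "klinf g" for g :: "('a \<Rightarrow>\<^sub>0 'b) \<Rightarrow> 'b" and y
        proof -
          have "cst (aug (\<lambda>b. g (pt b)) y) = (cst (g y) :: 'a \<Rightarrow>\<^sub>0 'b)"
            by (rule klin_eqI[where x = y]) (auto intro!: klinf_klin that)
          then show ?thesis by simp
        qed
        have bc: "Sj b \<in> A" "Sj (Sj c) \<in> A" using tspan_step.hyps by (auto intro: A_Sj)
        have "(\<Sum>k\<in>B. \<Sum>i\<in>B. f l (i * k) * aug (\<lambda>(b, c). q k (pt b) * p i (pt c)) (tens b c))
          = (\<Sum>k\<in>B. f k (Sj b) * (\<Sum>i\<in>B. f i (Sj (Sj c)) * f l (i * k)))"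
          by (simp only: aug_tens pt_aug[OF kp] pt_aug[OF kq]) (simp add: p_def q_def sum_distrib_left mult_ac)
        also have "\<dots> = (\<Sum>k\<in>B. f k (Sj b) * f l (Sj (Sj c) * k))"
        proof (intro sum.cong refl)
          fix k
          have "f l (Sj (Sj c) * k) = f l (\<Sum>i\<in>B. cst (f i (Sj (Sj c))) * (i * k))"
            by (subst dual[OF bc(2)]) (simp add: sum_distrib_right mult.assoc)
          then show "f k (Sj b) * (\<Sum>i\<in>B. f i (Sj (Sj c)) * f l (i * k)) = f k (Sj b) * f l (Sj (Sj c) * k)"
            by (simp add: klinf_sum[OF kf] f_sc)
        qed
        also have "\<dots> = f l (Sj (mS (tens b c)))"
          by (simp add: mS_tens Sj_mult flip: f_mult[OF bc(1)])
        finally show ?case using tspan_step.IH kf[of l]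
          by (simp add: aug_add distrib_left sum.distrib lin_add klin_add[OF klin_Sj] klinf_def)
      qed
      from this[OF A_D[OF s]] have "(\<Sum>k\<in>B. \<Sum>i\<in>B. f l (i * k) * conv (q k) (p i) s) = f l (Sj (mS (D s)))"
        by (simp only: conv_def)
      also have "mS (D s) = cst (eps s) * 1" by (simp only: antipode_right mult_1_right)
      also have "f l (Sj (cst (eps s) * 1)) = f l 1 * eps s"
        by (simp only: klin_cst[OF klin_Sj] f_sc Sj_1 mult.commute)
      finally show ?thesis .
    qed
    have kconv: "klinf (conv (q k) (p i))" for k i
      unfolding conv_def by (rule klinf_comp[OF klinf_aug klin_D])
    have key: "(\<Sum>k\<in>B. \<Sum>i\<in>B. cst (f l (i * k)) * sl (conv (q k) (p i)) Y) = cst (f l 1) * mp fst Y"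
      if "Y \<in> tspan A A" for l Y
      using that
    proof induction
      case tspan_0
      then show ?case by (simp add: klin_0[OF klin_sl] klin_0[OF klin_wmap])
    next
      case (tspan_step Y r s)
      have "(\<Sum>k\<in>B. \<Sum>i\<in>B. cst (f l (i * k)) * sl (conv (q k) (p i)) (tens r s)) =
        cst (\<Sum>k\<in>B. \<Sum>i\<in>B. f l (i * k) * conv (q k) (p i) s) * r"
        by (simp add: sl_tens[OF kconv] cst_sum cst_mult sum_distrib_right mult.assoc)
      also have "\<dots> = cst (f l 1) * mp fst (tens r s)"
        using tspan_step.hyps by (simp only: conv_sum mp_fst_tens cst_mult mult.assoc)
      finally show ?case using tspan_step.IH
        by (simp add: klin_add[OF klin_sl] klin_add[OF klin_wmap] distrib_left sum.distrib)
    qed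
    have "(\<Sum>k\<in>B. sl (q k) (D (P k))) = (\<Sum>k\<in>B. \<Sum>i\<in>B. sl (conv (q k) (p i)) (D (i * k)))"
      by (simp only: P_def klin_sum[OF klin_D] klin_sum[OF klin_sl] sl_D_sl)
    also have "\<dots> = (\<Sum>k\<in>B. \<Sum>i\<in>B. \<Sum>l\<in>B. cst (f l (i * k)) * sl (conv (q k) (p i)) (D l))"
    proof (intro sum.cong refl)
      fix k i assume "k \<in> B" "i \<in> B"
      then have "i * k \<in> A" using B(2) A_mult by auto
      then have "sl (conv (q k) (p i)) (D (i * k)) = sl (conv (q k) (p i)) (D (\<Sum>l\<in>B. cst (f l (i * k)) * l))"
        by (simp flip: dual)
      then show "sl (conv (q k) (p i)) (D (i * k)) = (\<Sum>l\<in>B. cst (f l (i * k)) * sl (conv (q k) (p i)) (D l))"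
        by (simp only: klin_sum[OF klin_D] klin_sum[OF klin_sl] klin_cst[OF klin_D] klin_cst[OF klin_sl])
    qed
    also have "\<dots> = (\<Sum>k\<in>B. \<Sum>l\<in>B. \<Sum>i\<in>B. cst (f l (i * k)) * sl (conv (q k) (p i)) (D l))"
      by (intro sum.cong refl sum.swap)
    also have "\<dots> = (\<Sum>l\<in>B. \<Sum>k\<in>B. \<Sum>i\<in>B. cst (f l (i * k)) * sl (conv (q k) (p i)) (D l))"
      by (rule sum.swap)
    also have "\<dots> = (\<Sum>l\<in>B. cst (f l 1) * l)"
    proof (intro sum.cong refl)
      fix l assume "l \<in> B"
      then have "D l \<in> tspan A A" using B(2) A_D by auto
      then show "(\<Sum>k\<in>B. \<Sum>i\<in>B. cst (f l (i * k)) * sl (conv (q k) (p i)) (D l)) = cst (f l 1) * l"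
        by (simp only: key counit_D)
    qed
    also have "\<dots> = 1" by (simp flip: dual[OF A_1])
    finally show ?thesis .
  qed
  moreover have "(\<Sum>k\<in>B. sl (q k) (D (P k))) = 0" if "\<And>k. k \<in> B \<Longrightarrow> P k = 0"
    using that by (simp add: klin_0[OF klin_D] klin_0[OF klin_sl])
  ultimately obtain k where "k \<in> B" "P k \<noteq> 0" by fastforce
  then show ?thesis using that[of "P k"] P_A P_int B(2) by blast
qed

lemma A_eq_supp:
  assumes full: "\<And>g. g \<in> G \<Longrightarrow> pt g - 1 \<in> IL"
  shows "A = supp G"
proof -
  obtain L where L: "L \<in> A" "L \<noteq> 0" "\<And>h. h \<in> A \<Longrightarrow> h * L = cst (eps h) * L"
    using left_integral_exists by blast
  \<comment> \<open>\<open>IL\<close> is spanned by products ending in the augmentation ideal of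
    \<open>A\<close>, which annihilates the integral. Hence every \<open>g\<close> with
    \<open>g - 1\<close> in \<open>IL\<close> fixes \<open>L\<close>, although \<open>L\<close> was
    an integral only for \<open>A\<close>.\<close>
  have kill: "z * L = 0" if "z \<in> IL" for z
    using that unfolding IL_def
    by induction (auto simp: distrib_right mult.assoc L(3) Ap_def)
  have inv: "pt g * L = L" if "g \<in> G" for g
    using kill[OF full[OF that]] by (simp add: left_diff_distrib)
  have Lsupp: "L \<in> supp G" using L A_sub by auto
  have const: "lookup L g = lookup L 0" if g: "g \<in> G" for g
  proof -
    have "pt g * L = lin (\<lambda>a. pt g * pt a) L"
      by (rule klin_expand) auto
    then have "pt g * L = lin (\<lambda>a. sg (g + a) 1) L" by (simp add: mult_single)
    then have "lookup L g = lookup (lin (\<lambda>a. sg (g + a) 1) L) g" using inv[OF g] by simp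
    also have "\<dots> = (\<Sum>a\<in>keys L. lookup (sg (g + a) (lookup L a)) g)"
      by (simp add: lin_def lookup_sum)
    also have "\<dots> = (\<Sum>a\<in>keys L. lookup L a * (if a = 0 then 1 else 0))"
    proof (intro sum.cong refl)
      fix a
      have "g + a = g \<longleftrightarrow> a = 0" by (metis add.right_neutral add_left_imp_eq)
      then show "lookup (sg (g + a) (lookup L a)) g = lookup L a * (if a = 0 then 1 else 0)"
        by (simp add: lookup_single when_def)
    qed
    finally have "lookup L g = (\<Sum>a\<in>keys L. lookup L a * (if a = 0 then 1 else 0))" .
    then show ?thesis by (simp add: in_keys_iff sum.delta' if_distrib[of "\<lambda>x. _ * x"] cong: if_cong)
  qed
  define c where "c = lookup L 0"
  define E where "E = (\<Sum>g\<in>G. pt g :: 'a \<Rightarrow>\<^sub>0 'b)"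
  have "L = (\<Sum>g\<in>G. cst c * pt g)"
    using poly_sum_superset[OF finite_G, of L] Lsupp const by (simp add: supp_def c_def)
  then have LE: "L = cst c * E" by (simp add: E_def sum_distrib_left)
  then have c: "c \<noteq> 0" using L(2) by auto
  have EA: "E \<in> A"
    using ksubD(3)[OF A_ksub L(1), of "inverse c"] LE c by (simp flip: mult.assoc cst_mult)
  have cE: "comul E = (\<Sum>g\<in>G. pt (g, g))" by (simp add: E_def klin_sum[OF klin_comul])
  \<comment> \<open>Multiplying the diagonal sum by \<open>(a, b)\<close> and reindexing moves
    everything into one factor: \<open>(a - b, 0)\<close> on the left, \<open>(0, - a + b)\<close>
    on the right. So \<open>J\<close> and \<open>J'\<close> collapse to \<open>Q\<close> and
    \<open>Qi\<close>.\<close>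
  have E_left: "X * comul E = i1 (act X 1) * comul E" and E_right: "comul E * X = comul E * i2 (ract 1 X)"
    if X: "X \<in> supp (G \<times> G)" for X
  proof -
    have k1: "klin (\<lambda>X. i1 (act X 1) * comul E)" "klin (\<lambda>X. comul E * i2 (ract 1 X))"
      by (intro klin_mult_right klin_mult_left klin_comp[OF klin_tens(1) klin_act(2)] klin_comp[OF klin_tens(2) klin_ract(1)])+
    show "X * comul E = i1 (act X 1) * comul E"
    proof (rule klin_eqI[where x = X, OF _ k1(1)])
      fix ab assume "ab \<in> keys X"
      then obtain a b where ab: "ab = (a, b)" "a \<in> G" "b \<in> G" using keys_supp[OF X] by (cases ab) auto
      have "pt ab * comul E = (\<Sum>g\<in>G. pt (a + g, b + g))"
        by (simp add: cE ab sum_distrib_left mult_single)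
      also have "\<dots> = (\<Sum>g\<in>G. pt (a - b + g, g))"
        by (rule sum.reindex_bij_witness[of _ "\<lambda>g. - b + g" "\<lambda>g. b + g"])
           (auto simp: ab add_G uminus_G add.assoc[symmetric] simp flip: diff_conv_add_uminus)
      also have "\<dots> = i1 (act (pt ab) 1) * comul E"
        by (simp add: cE ab sum_distrib_left mult_single i1_eq)
      finally show "pt ab * comul E = i1 (act (pt ab) 1) * comul E" .
    qed auto
    show "comul E * X = comul E * i2 (ract 1 X)"
    proof (rule klin_eqI[where x = X, OF _ k1(2)])
      fix ab assume "ab \<in> keys X"
      then obtain a b where ab: "ab = (a, b)" "a \<in> G" "b \<in> G" using keys_supp[OF X] by (cases ab) auto
      have "comul E * pt ab = (\<Sum>g\<in>G. pt (g + a, g + b))"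
        by (simp add: cE ab sum_distrib_right mult_single)
      also have "\<dots> = (\<Sum>g\<in>G. pt (g, g + (- a + b)))"
        by (rule sum.reindex_bij_witness[of _ "\<lambda>g. g - a" "\<lambda>g. g + a"])
           (auto simp: ab add_G uminus_G add.assoc diff_conv_add_uminus simp del: add_uminus_conv_diff)
      also have "\<dots> = comul E * i2 (ract 1 (pt ab))"
        by (simp add: cE ab sum_distrib_right mult_single i2_eq)
      finally show "comul E * pt ab = comul E * i2 (ract 1 (pt ab))" .
    qed auto
  qed
  have "D E = i1 Q * (comul E * J')"
    by (simp add: D_def E_left[OF J_supp] Q_def mult.assoc)
  also have "\<dots> = i1 Q * comul E * i2 Qi"
    by (simp add: E_right[OF J'_supp] Qi_def mult.assoc)
  also have "\<dots> = (\<Sum>g\<in>G. tens (Q * pt g) (pt g * Qi))"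
    by (simp add: cE sum_distrib_left sum_distrib_right tens_mult flip: tens_pt)
  finally have DE: "D E = (\<Sum>g\<in>G. tens (Q * pt g) (pt g * Qi))" .
  have QA: "Q * pt g \<in> A" if g: "g \<in> G" for g
  proof -
    \<comment> \<open>\<open>r\<close> reads the coefficient at \<open>g\<close> after
      multiplication by \<open>Q\<close>, so on the second factors \<open>a * Qi\<close> it is the
      Kronecker delta and the slice isolates \<open>Q * g\<close>.\<close>
    define r where "r y = lookup (y * Q) g" for y
    have kr: "klinf r"
      by (simp add: klinf_def r_def distrib_right lookup_add mult.assoc)
    have "sl r (D E) = (\<Sum>a\<in>G. cst (r (pt a * Qi)) * (Q * pt a))"
      by (simp only: DE klin_sum[OF klin_sl] sl_tens[OF kr])
    also have "\<dots> = (\<Sum>a\<in>G. if a = g then Q * pt a else 0)"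
      by (intro sum.cong refl) (simp add: r_def mult.assoc lookup_single when_def)
    also have "\<dots> = Q * pt g" using g finite_G by simp
    finally show ?thesis using sl_tspan_in_A[OF kr A_D[OF EA]] by simp
  qed
  have "y \<in> A" if y: "y \<in> supp G" for y
  proof -
    have s: "Qi * y \<in> supp G" by (intro supp_mult_G supp_Q y)
    have "y = Q * (Qi * y)" by simp
    also have "\<dots> = lin (\<lambda>a. Q * pt a) (Qi * y)"
      by (rule klin_expand) auto
    also have "\<dots> \<in> A"
      using s by (intro ksub_lin[OF A_ksub] QA) (auto simp: supp_def)
    finally show ?thesis .
  qed
  then show ?thesis using A_sub by auto
qed

end

section \<open>The case where exactly the even group elements are trivial modulo the ideal\<close>

lemma tens_eqI:
  fixes x :: "_ \<Rightarrow>\<^sub>0 'k::comm_semiring_1"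
  assumes "klin F" "\<And>y. klin (\<lambda>x. g x y)" "\<And>x. klin (g x)"
    "\<And>a b. F (pt (a, b)) = g (pt a) (pt b)"
  shows "F (tens x y) = g x y"
proof (rule klin2_eqI[of "\<lambda>x y. F (tens x y)" g])
  show "klin (\<lambda>x. F (tens x y))" for y by (rule klin_comp[OF assms(1) klin_tens(1)])
  show "klin (\<lambda>y. F (tens x y))" for x by (rule klin_comp[OF assms(1) klin_tens(2)])
qed (use assms in auto)

lemma aug_cong: "(\<And>a. a \<in> keys x \<Longrightarrow> w a = w' a) \<Longrightarrow> aug w x = aug w' x"
  unfolding aug_def by (intro sum.cong) auto

lemma aug_affine: "aug (\<lambda>a. c + d * f a) x = c * eps x + d * aug f (x :: _ \<Rightarrow>\<^sub>0 'k::comm_ring_1)"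
  by (simp add: aug_def sum.distrib sum_distrib_left algebra_simps)

context twist
begin

lemma chi_cases: "chi a = 1 \<or> chi a = - 1"
  using chi_sq[of a] square_eq_1_iff by blast

lemma comm_supp:
  assumes "\<And>g. g \<in> H \<Longrightarrow> z * pt g = pt g * z" "x \<in> supp H"
  shows "z * x = x * (z :: 'h::monoid_add \<Rightarrow>\<^sub>0 'k)"
proof (rule klin_eqI[where x = x])
  show "z * pt a = pt a * z" if "a \<in> keys x" for a
    using that assms by (auto simp: supp_def)
qed auto

text \<open>The coproduct of \<open>t\<close> has coefficients only on the diagonal, whereas
  \<open>tens t t\<close> has the products of coefficients. If the coefficient at \<open>g\<close>
  is nonzero, all others vanish, and the counit makes it 1.\<close>

lemma grouplike_pt:
  fixes t :: "'g \<Rightarrow>\<^sub>0 'k"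
  assumes "comul t = tens t t" "eps t = 1" "t \<in> supp G"
  shows "\<exists>g\<in>G. t = pt g"
proof -
  have lt: "lookup (tens x y) (a, b) = lookup x a * lookup y b" for x y :: "'g \<Rightarrow>\<^sub>0 'k" and a b
  proof -
    have kl: "klin (\<lambda>z :: 'h::monoid_add \<Rightarrow>\<^sub>0 'k. cst (lookup z c) :: 'g \<Rightarrow>\<^sub>0 'k)" for c
      by (rule klinI) (simp_all add: lookup_add cst_add cst_mult)
    have "cst (lookup (tens x y) (a, b)) = (cst (lookup x a) * cst (lookup y b) :: 'g \<Rightarrow>\<^sub>0 'k)"
      by (rule tens_eqI[of "\<lambda>z. cst (lookup z (a, b))" "\<lambda>x y. cst (lookup x a) * cst (lookup y b)"])
        (auto intro: kl klin_mult_left klin_mult_right simp: lookup_single when_def)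
    then show ?thesis by (simp flip: cst_mult)
  qed
  have lc: "lookup (comul t) (a, b) = (if a = b then lookup t a else 0)" for a b
  proof -
    have "lookup (comul t) (a, b) = (\<Sum>g\<in>keys t. if g = a then (if a = b then lookup t a else 0) else 0)"
      unfolding comul_def wmap_def lin_def lookup_sum
      by (intro sum.cong refl) (simp add: lookup_single when_def)
    then show ?thesis by (simp add: in_keys_iff)
  qed
  have "t \<noteq> 0" using assms(2) by auto
  then obtain g where g: "lookup t g \<noteq> 0" by (metis lookup_zero poly_mapping_eqI)
  have "lookup t h = 0" if "h \<noteq> g" for h
    using lt[of t t g h] lc[of g h] assms(1) that g by simp
  then have "t = sg g (lookup t g)"
    by (intro poly_mapping_eqI) (auto simp: lookup_single when_def)
  moreover from this assms(2) have "lookup t g = 1" by (metis aug_sg mult_1_right)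
  moreover have "g \<in> G" using g assms(3) by (auto simp: supp_def in_keys_iff)
  ultimately show ?thesis by auto
qed

lemma u_eq_v_of_central:
  assumes eq: "\<And>h. h \<in> supp G \<Longrightarrow> thR h = thL h"
    and center: "\<And>z. z \<in> G \<Longrightarrow> (\<And>g. g \<in> G \<Longrightarrow> z + g = g + z) \<Longrightarrow> z = 0"
  shows "u = v"
proof -
  define z where "z = u' * v"
  have zs: "z \<in> supp G" unfolding z_def by (intro supp_mult_G supp_uv)
  have zc: "z * pt g = pt g * z" if "g \<in> G" for g
  proof -
    have "ch (pt g) = cst (chi g) * pt g" by (simp add: ch_def)
    then have "cst (chi g) * (u * pt g * u') = cst (chi g) * (v * pt g * v')"
      using eq[OF supp_sg[OF that, of 1]] by (simp only: thR_def thL_def scal_left mult.assoc)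
    then have "cst (chi g) * (cst (chi g) * (u * pt g * u')) = cst (chi g) * (cst (chi g) * (v * pt g * v'))"
      by simp
    then have "u * pt g * u' = v * pt g * v'" by (simp flip: mult.assoc cst_mult)
    then have "u' * (u * pt g * u') * v = u' * (v * pt g * v') * v" by simp
    then show ?thesis by (simp add: z_def mult.assoc)
  qed
  have comm: "z * x = x * z" if "x \<in> supp G" for x
    by (rule comm_supp[OF zc that])
  \<comment> \<open>Centrality identifies \<open>u' * v\<close> with \<open>v * u'\<close>, the
    element for which the group-like relation with \<open>J\<close> was derived.\<close>
  have "v = u * z" by (simp add: z_def)
  then have "v = z * u" using comm[OF supp_uv(1)] by simp
  then have tz: "v * u' = z" by (simp add: mult.assoc)
  have "tens z z * J = J * tens z z"
  proof (rule comm_supp[OF _ J_supp])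
    fix ab assume "ab \<in> G \<times> G"
    then show "tens z z * pt ab = pt ab * tens z z"
      by (cases ab) (simp add: tens_mult zc flip: tens_pt)
  qed
  then have "J * comul z = J * tens z z" using J_comul_vu' tz by simp
  then have "J' * (J * comul z) = J' * (J * tens z z)" by simp
  then have cz: "comul z = tens z z" by simp
  have "eps z = 1"
  proof -
    have "eps u' = 1" using eps_mult[of u u'] by (simp add: eps_uv aug_1)
    then show ?thesis by (simp add: z_def eps_mult eps_uv)
  qed
  then obtain g where g: "g \<in> G" "z = pt g" using grouplike_pt[OF cz _ zs] by auto
  have "g + h = h + g" if "h \<in> G" for h
  proof -
    have "pt (g + h) = (pt (h + g) :: 'g \<Rightarrow>\<^sub>0 'k)" using zc[OF that] by (simp add: g mult_single)
    then show ?thesis by (metis keys_single singleton_inject zero_neq_one)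
  qed
  then have "g = 0" using center g(1) by blast
  then have "z = 1" using g by simp
  then show "u = v" using \<open>v = u * z\<close> by simp
qed

lemma cR_tens: "cR (tens p q) = cst (aug chi q) * p" and cL_tens: "cL (tens p q) = cst (aug chi p) * q"
proof -
  show "cR (tens p q) = cst (aug chi q) * p"
    by (rule tens_eqI[of cR "\<lambda>p q. cst (aug chi q) * p"]) (auto intro!: klinf_klin klin_mult_left klin_mult_right simp: cR_def)
  show "cL (tens p q) = cst (aug chi p) * q"
    by (rule tens_eqI[of cL "\<lambda>p q. cst (aug chi p) * q"]) (auto intro!: klinf_klin klin_mult_left klin_mult_right simp: cL_def)
qed

end

context normal_sub
begin

text \<open>
  \<open>FR \<circ> D\<close> is the convolution quotient of \<open>thR\<close> by the identity. If \<open>thR\<close> fixes \<open>A\<close> it kills \<open>IL\<close>, so it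
  is determined by its values on representatives of \<open>G\<close> modulo \<open>N\<close>; similarly for \<open>FL\<close>.
\<close>

definition "FR = lin (\<lambda>(c, d). thR (pt c) * Sj (pt d))"
definition "FL = lin (\<lambda>(c, d). Sj (pt c) * thL (pt d))"

lemma klin_F: "klin FR" "klin FL"
  unfolding FR_def FL_def by (rule klin_lin)+

lemma F_tens: "FR (tens x y) = thR x * Sj y" "FL (tens x y) = Sj x * thL y"
proof -
  show "FR (tens x y) = thR x * Sj y"
    by (rule tens_eqI[of FR "\<lambda>p q. thR p * Sj q"]) (auto intro!: klin_mult_left klin_mult_right simp: FR_def)
  show "FL (tens x y) = Sj x * thL y"
    by (rule tens_eqI[of FL "\<lambda>p q. Sj p * thL q"]) (auto intro!: klin_mult_left klin_mult_right simp: FL_def)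
qed

text \<open>In Sweedler form the left side is \<open>thR(h\<^sub>1) Sj(h\<^sub>2) h\<^sub>3\<close>,
  and the antipode cancels against \<open>h\<^sub>3\<close>.\<close>

lemma thR_via_FR: "lin (\<lambda>(c, y). FR (D (pt c)) * pt y) (D h) = thR h"
proof -
  have "FR (D (pt y)) * pt d = lin (\<lambda>(c, e). thR (pt c) * Sj (pt e) * pt d) (D (pt y))" for y d
    unfolding FR_def by (rule klin_eqI[where x = "D (pt y)"]) auto
  then have "lin (\<lambda>(c, y). FR (D (pt c)) * pt y) (D h) =
      lin (\<lambda>(y, d). lin (\<lambda>(c, e). thR (pt c) * Sj (pt e) * pt d) (D (pt y))) (D h)"
    by simp
  also have "\<dots> = lin (\<lambda>(c, y). lin (\<lambda>(e, d). thR (pt c) * Sj (pt e) * pt d) (D (pt y))) (D h)"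
    using coassoc_lin[of "\<lambda>(c, e, d). thR (pt c) * Sj (pt e) * pt d" h] by simp
  also have "\<dots> = lin (\<lambda>(c, y). thR (pt c)) (D h)"
  proof -
    have "lin (\<lambda>(e, d). thR (pt c) * Sj (pt e) * pt d) X = thR (pt c) * lin (\<lambda>(e, d). Sj (pt e) * pt d) X" for c X
      by (rule klin_eqI[where x = X]) (auto simp: mult.assoc)
    then show ?thesis by (simp add: antipode_left)
  qed
  also have "\<dots> = thR (mp fst (D h))"
    by (rule klin_eqI[where x = "D h"]) (auto intro: klin_comp[OF klin_th(1) klin_wmap])
  finally show ?thesis by (simp add: counit_D)
qed

lemma thL_via_FL: "lin (\<lambda>(y, d). pt y * FL (D (pt d))) (D h) = thL h"
proof -
  have "pt y * FL (D (pt d)) = lin (\<lambda>(c, e). pt y * Sj (pt c) * thL (pt e)) (D (pt d))" for y d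
    unfolding FL_def by (rule klin_eqI[where x = "D (pt d)"]) (auto simp: mult.assoc)
  then have "lin (\<lambda>(y, d). pt y * FL (D (pt d))) (D h) =
      lin (\<lambda>(y, d). lin (\<lambda>(c, e). pt y * Sj (pt c) * thL (pt e)) (D (pt d))) (D h)"
    by simp
  also have "\<dots> = lin (\<lambda>(d, e). lin (\<lambda>(y, c). pt y * Sj (pt c) * thL (pt e)) (D (pt d))) (D h)"
    using coassoc_lin[of "\<lambda>(y, c, e). pt y * Sj (pt c) * thL (pt e)" h] by simp
  also have "\<dots> = lin (\<lambda>(d, e). thL (pt e)) (D h)"
  proof -
    have "lin (\<lambda>(y, c). pt y * Sj (pt c) * thL (pt e)) X = lin (\<lambda>(y, c). pt y * Sj (pt c)) X * thL (pt e)" for e X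
      by (rule klin_eqI[where x = X]) auto
    then show ?thesis by (simp add: antipode_right)
  qed
  also have "\<dots> = thL (mp snd (D h))"
    by (rule klin_eqI[where x = "D h"]) (auto intro: klin_comp[OF klin_th(2) klin_wmap])
  finally show ?thesis by (simp add: counit_D)
qed

lemma u_eq_v_of_even:
  assumes even: "\<And>g. g \<in> G \<Longrightarrow> chi g = 1 \<Longrightarrow> pt g - 1 \<in> IL"
    and g0: "g0 \<in> G" "chi g0 = - 1" "pt g0 - 1 \<notin> IL"
    and center: "\<And>z. z \<in> G \<Longrightarrow> (\<And>g. g \<in> G \<Longrightarrow> z + g = g + z) \<Longrightarrow> z = 0"
  shows "u = v"
proof -
  have odd: "pt g - pt g0 \<in> IL" if "g \<in> G" "chi g = - 1" for g
  proof -
    have "pt (- g0 + g) - 1 \<in> IL" using that g0 by (intro even add_G uminus_G) (auto simp: chi_add)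
    then have "pt g0 * (pt (- g0 + g) - 1) \<in> IL" by (intro IL_left supp_sg g0)
    then show ?thesis by (simp add: right_diff_distrib mult_single)
  qed
  obtain f where f: "perp f" "aug f (pt g0 - 1) = 1" using perp_separate[OF g0(3)] by blast
  have f0: "aug f 1 = f 0" for f :: "'a \<Rightarrow> 'b" by (metis aug_sg mult_1 single_one)
  have fg0: "f g0 = f 0 + 1" using f(2) by (simp add: aug_diff f0 algebra_simps)
  \<comment> \<open>On \<open>G\<close> the separating function takes the value \<open>f 0\<close>
    at even and \<open>f 0 + 1\<close> at odd elements; \<open>chi\<close> is the affine function of
    it with values 1 and -1, and constants also vanish on \<open>IL\<close>.\<close>
  have fchi: "chi g = (1 + 2 * f 0) + (- 2) * f g" if "g \<in> G" for g
  proof (cases "chi g = 1")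
    case True
    then have "aug f (pt g - 1) = 0" using even that f(1) by (simp add: perp_def)
    then show ?thesis using True by (simp add: aug_diff f0)
  next
    case False
    then have c: "chi g = - 1" using chi_cases by blast
    then have "aug f (pt g - pt g0) = 0" using odd that f(1) by (simp add: perp_def)
    then show ?thesis using c fg0 by (simp add: aug_diff)
  qed
  have chi_perp: "aug chi x = 0" if x: "x \<in> IL" for x
  proof -
    have "aug chi x = aug (\<lambda>g. (1 + 2 * f 0) + (- 2) * f g) x"
      using x IL_supp by (intro aug_cong fchi) (auto simp: supp_def)
    also have "\<dots> = 0" unfolding aug_affine using x f(1) by (simp add: IL_eps perp_def)
    finally show ?thesis .
  qed
  have chi_A: "aug chi a = eps a" if "a \<in> A" for a
    using chi_perp[of "a - cst (eps a)"] A_decomp[OF that] Ap_IL by (auto simp: aug_diff cst_def)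
  \<comment> \<open>Since \<open>chi\<close> and the counit agree on \<open>A\<close>, slicing
    \<open>D a\<close> by \<open>chi\<close> gives the same as slicing by the counit.\<close>
  have thR_A: "thR a = a" and thL_A: "thL a = a" if a: "a \<in> A" for a
  proof -
    have "cR X = mp fst X \<and> cL X = mp snd X" if "X \<in> tspan A A" for X
      using that
      by induction (auto simp: klin_0[OF klin_wmap] klin_0[OF klin_c(1)] klin_0[OF klin_c(2)]
        klin_add[OF klin_wmap] klin_add[OF klin_c(1)] klin_add[OF klin_c(2)] cR_tens cL_tens
        mp_fst_tens mp_snd_tens chi_A)
    from this[OF A_D[OF a]] show "thR a = a" "thL a = a" by (simp_all add: cR_D cL_D counit_D)
  qed
  \<comment> \<open>For \<open>y\<close> in \<open>A\<close> the value on \<open>D x * D y\<close>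
    is \<open>thR(x\<^sub>1) y\<^sub>1 Sj(y\<^sub>2) Sj(x\<^sub>2)\<close>, because
    \<open>thR\<close> fixes \<open>A\<close>. The inner pair gives the counit of \<open>y\<close>,
    which is 0 on the augmentation ideal.\<close>
  have FR_mult: "FR (X * Y) = lin (\<lambda>(x, y). thR (pt x) * lin (\<lambda>(c, d). pt c * Sj (pt d)) Y * Sj (pt y)) X"
    if "Y \<in> tspan A A" for X Y
    using that
  proof induction
    case tspan_0
    then show ?case by (simp add: klin_0[OF klin_F(1)] case_prod_unfold) (simp add: lin_def)
  next
    case (tspan_step Y p q)
    have "FR (X * tens p q) = lin (\<lambda>(x, y). thR (pt x) * (p * Sj q) * Sj (pt y)) X"
    proof (rule klin_eqI[where x = X])
      fix ab :: "'a \<times> 'a"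
      obtain a b where ab: "ab = (a, b)" by force
      have "FR (tens (pt a) (pt b) * tens p q) = thR (pt a) * thR p * (Sj q * Sj (pt b))"
        by (simp only: tens_mult F_tens th_mult Sj_mult)
      then show "FR (pt ab * tens p q) = lin (\<lambda>(x, y). thR (pt x) * (p * Sj q) * Sj (pt y)) (pt ab)"
        by (simp add: ab thR_A tspan_step.hyps mult.assoc)
    qed (auto intro: klin_comp[OF klin_F(1)])
    moreover have "lin (\<lambda>(x, y). thR (pt x) * (a + b) * Sj (pt y)) X =
      lin (\<lambda>(x, y). thR (pt x) * a * Sj (pt y)) X + lin (\<lambda>(x, y). thR (pt x) * b * Sj (pt y)) X" for a b
      by (simp add: lin_def distrib_left distrib_right case_prod_unfold sum.distrib)
    ultimately show ?case using tspan_step.IH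
      by (simp add: distrib_left klin_add[OF klin_F(1)] lin_add mS_tens)
  qed
  have FL_mult: "FL (Y * X) = lin (\<lambda>(x, y). Sj (pt x) * lin (\<lambda>(c, d). Sj (pt c) * pt d) Y * thL (pt y)) X"
    if "Y \<in> tspan A A" for X Y
    using that
  proof induction
    case tspan_0
    then show ?case by (simp add: klin_0[OF klin_F(2)] case_prod_unfold) (simp add: lin_def)
  next
    case (tspan_step Y p q)
    have mS': "lin (\<lambda>(c, d). Sj (pt c) * pt d) (tens p q) = Sj p * q" for p q
      by (rule klin2_eqI[of "\<lambda>p q. lin (\<lambda>(c, d). Sj (pt c) * pt d) (tens p q)" "\<lambda>p q. Sj p * q"])
        (auto intro: klin_comp[OF klin_lin klin_tens(1)] klin_comp[OF klin_lin klin_tens(2)])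
    have "FL (tens p q * X) = lin (\<lambda>(x, y). Sj (pt x) * (Sj p * q) * thL (pt y)) X"
    proof (rule klin_eqI[where x = X])
      fix ab :: "'a \<times> 'a"
      obtain a b where ab: "ab = (a, b)" by force
      have "FL (tens p q * tens (pt a) (pt b)) = Sj (pt a) * Sj p * (thL q * thL (pt b))"
        by (simp only: tens_mult F_tens th_mult Sj_mult)
      then show "FL (tens p q * pt ab) = lin (\<lambda>(x, y). Sj (pt x) * (Sj p * q) * thL (pt y)) (pt ab)"
        by (simp add: ab thL_A tspan_step.hyps mult.assoc)
    qed (auto intro: klin_comp[OF klin_F(2)])
    moreover have "lin (\<lambda>(x, y). Sj (pt x) * (a + b) * thL (pt y)) X =
      lin (\<lambda>(x, y). Sj (pt x) * a * thL (pt y)) X + lin (\<lambda>(x, y). Sj (pt x) * b * thL (pt y)) X" for a b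
      by (simp add: lin_def distrib_left distrib_right case_prod_unfold sum.distrib)
    ultimately show ?case using tspan_step.IH
      by (simp add: distrib_right klin_add[OF klin_F(2)] lin_add mS')
  qed
  have lin_zero: "lin (\<lambda>(x, y). 0) X = 0" for X :: "'a \<times> 'a \<Rightarrow>\<^sub>0 'b" by (simp add: lin_def)
  have FR_IL: "FR (D x) = 0" if "x \<in> IL" for x
    using that unfolding IL_def
  proof induction
    case (pspan_step z x y)
    then have "FR (D x * D y) = 0"
      by (subst FR_mult) (auto simp: Ap_def A_D antipode_right lin_zero)
    then show ?case using pspan_step by (simp add: klin_add[OF klin_D] klin_add[OF klin_F(1)] D_mult)
  qed (simp add: klin_0[OF klin_D] klin_0[OF klin_F(1)])
  have FL_IL: "FL (D x) = 0" if "x \<in> IL" for x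
    using that unfolding IL_eq_IR unfolding IR_def
  proof induction
    case (pspan_step z x y)
    then have "FL (D x * D y) = 0"
      by (subst FL_mult) (auto simp: Ap_def A_D antipode_left lin_zero)
    then show ?case using pspan_step by (simp add: klin_add[OF klin_D] klin_add[OF klin_F(2)] D_mult)
  qed (simp add: klin_0[OF klin_D] klin_0[OF klin_F(2)])
  have F1: "FR 1 = 1" "FL 1 = 1" using F_tens[of 1 1] by simp_all
  \<comment> \<open>\<open>F \<circ> D\<close> is 1 on even group elements and a fixed value
    \<open>w\<close> on odd ones. Hence \<open>p = (1 + w) / 2\<close> and
    \<open>q = (1 - w) / 2\<close>.\<close>
  have split: "\<exists>p q. p + q = 1 \<and> (\<forall>c\<in>G. F (D (pt c)) = p + cst (chi c) * q)"
    if kF: "klin F" and FIL: "\<And>x. x \<in> IL \<Longrightarrow> F (D x) = 0" and F1: "F 1 = 1"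
    for F :: "('a \<times> 'a \<Rightarrow>\<^sub>0 'b) \<Rightarrow> 'a \<Rightarrow>\<^sub>0 'b"
  proof -
    define w where "w = F (D (pt g0))"
    have "F (D (pt c)) = cst (1/2) * (1 + w) + cst (chi c) * (cst (1/2) * (1 - w))" if "c \<in> G" for c
    proof -
      have half: "cst (1/2) * x + cst (1/2) * x = x" for x :: "'a \<Rightarrow>\<^sub>0 'b"
        by (simp flip: distrib_right cst_add)
      show ?thesis
      proof (cases "chi c = 1")
        case True
        then have "F (D (pt c)) = 1"
          using FIL[OF even[OF that True]] by (simp add: klin_diff[OF klin_D] klin_diff[OF kF] F1)
        moreover have "cst (1/2) * (1 + w) + cst (1/2) * (1 - w) = cst (1/2) * 1 + cst (1/2) * 1"
          by (simp only: distrib_left right_diff_distrib) simp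
        ultimately show ?thesis using True by (simp only: half cst_1 mult_1)
      next
        case False
        then have c: "chi c = - 1" using chi_cases by blast
        have "F (D (pt c)) = w"
          using FIL[OF odd[OF that c]] by (simp add: klin_diff[OF klin_D] klin_diff[OF kF] w_def)
        moreover have "cst (1/2) * (1 + w) + cst (- 1) * (cst (1/2) * (1 - w)) = cst (1/2) * w + cst (1/2) * w"
          by (simp only: cst_uminus cst_1 distrib_left right_diff_distrib) simp
        ultimately show ?thesis using c by (simp only: half)
      qed
    qed
    moreover have "cst (1/2) * (1 + w) + cst (1/2) * (1 - w) = 1"
    proof -
      have "cst (1/2) * (1 + w) + cst (1/2) * (1 - w) = cst (1/2 + 1/2)"
        by (simp only: distrib_left right_diff_distrib cst_add) simp
      then show ?thesis by simp
    qed
    ultimately show ?thesis by blast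
  qed
  \<comment> \<open>Inserting \<open>p + chi q\<close> for \<open>FR \<circ> D\<close> gives
    \<open>thR h = p h + q thL h\<close>, and \<open>p + q = 1\<close> finishes for fixed points of
    \<open>thL\<close>.\<close>
  have RL: "thR h = h" if h: "h \<in> supp G" and "thL h = h" for h
  proof -
    obtain p q where pq: "p + q = 1" "\<And>c. c \<in> G \<Longrightarrow> FR (D (pt c)) = p + cst (chi c) * q"
      using split[OF klin_F(1) FR_IL F1(1)] by blast
    have "thR h = lin (\<lambda>(c, y). (p + cst (chi c) * q) * pt y) (D h)"
      unfolding thR_via_FR[symmetric] lin_def
      using keys_supp[OF supp_D[OF h]] by (intro sum.cong refl) (auto simp: pq)
    also have "\<dots> = p * mp snd (D h) + q * cL (D h)"
      by (rule klin_eqI[where x = "D h"])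
        (auto intro!: klin_plus klin_mult_left simp: cL_def distrib_right mult.assoc cst_pt[of _ "chi _"] scal_left simp del: cst_mult_single)
    also have "\<dots> = h"
      using that(2) pq(1) by (simp add: counit_D cL_D flip: distrib_right)
    finally show ?thesis .
  qed
  have LR: "thL h = h" if h: "h \<in> supp G" and "thR h = h" for h
  proof -
    obtain p q where pq: "p + q = 1" "\<And>c. c \<in> G \<Longrightarrow> FL (D (pt c)) = p + cst (chi c) * q"
      using split[OF klin_F(2) FL_IL F1(2)] by blast
    have "thL h = lin (\<lambda>(y, c). pt y * (p + cst (chi c) * q)) (D h)"
      unfolding thL_via_FL[symmetric] lin_def
      using keys_supp[OF supp_D[OF h]] by (intro sum.cong refl) (auto simp: pq)
    also have "\<dots> = mp fst (D h) * p + cR (D h) * q"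
      by (rule klin_eqI[where x = "D h"])
        (auto intro!: klin_plus klin_mult_right simp: cR_def distrib_left mult.assoc cst_pt[of _ "chi _"] scal_left simp del: cst_mult_single)
    also have "\<dots> = h"
      using that(2) pq(1) by (simp add: counit_D cR_D flip: distrib_left)
    finally show ?thesis .
  qed
  have "thR h = thL h" if h: "h \<in> supp G" for h
  proof -
    \<comment> \<open>\<open>h + thL h\<close> is fixed by \<open>thL\<close>, hence by
      \<open>thR\<close>, and symmetrically. Subtracting the two equations cancels the common
      composite and shows that \<open>thR h - thL h\<close> equals its own negative.\<close>
    have "thR (h + thL h) = h + thL h"
      using h by (intro RL supp_add supp_th) (simp_all add: klin_add[OF klin_th(2)] th_th add.commute)
    moreover have "thL (h + thR h) = h + thR h"
      using h by (intro LR supp_add supp_th) (simp_all add: klin_add[OF klin_th(1)] th_th add.commute)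
    ultimately have e: "thR h + thR (thL h) = h + thL h" "thL h + thR (thL h) = h + thR h"
      by (simp_all add: klin_add[OF klin_th(1)] klin_add[OF klin_th(2)] th_comm)
    define d where "d = thR h - thL h"
    have "d = (thR h + thR (thL h)) - (thL h + thR (thL h))" by (simp add: d_def)
    also have "\<dots> = - d" unfolding e by (simp add: d_def)
    finally have "d + d = 0" by (metis add.right_inverse)
    then have "cst 2 * d = 0" by (metis cst_add cst_1 distrib_right mult_1 one_add_one)
    then have "cst (1/2) * (cst 2 * d) = 0" by simp
    then have "d = 0" by (simp flip: mult.assoc cst_mult)
    then show ?thesis by (simp add: d_def)
  qed
  then show ?thesis using center by (rule u_eq_v_of_central)
qed

theorem normal_sub_trivial:
  assumes uv: "u \<noteq> v"
    and subgroups: "\<And>N. N \<subseteq> G \<Longrightarrow> 0 \<in> N \<Longrightarrow> (\<And>a b. a \<in> N \<Longrightarrow> b \<in> N \<Longrightarrow> a + b \<in> N) \<Longrightarrow>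
        (\<And>a. a \<in> N \<Longrightarrow> - a \<in> N) \<Longrightarrow> (\<And>a g. a \<in> N \<Longrightarrow> g \<in> G \<Longrightarrow> g + a - g \<in> N) \<Longrightarrow>
        N = {0} \<or> N = G \<or> N = {g \<in> G. chi g = 1}"
    and center: "\<And>z. z \<in> G \<Longrightarrow> (\<And>g. g \<in> G \<Longrightarrow> z + g = g + z) \<Longrightarrow> z = 0"
  shows "A = range cst \<or> A = supp G"
proof -
  define N where "N = {g \<in> G. pt g - 1 \<in> IL}"
  have "N = {0} \<or> N = G \<or> N = {g \<in> G. chi g = 1}"
  proof (rule subgroups)
    show "N \<subseteq> G" "0 \<in> N" by (auto simp: N_def zero_G ksubD[OF IL_ksub])
    show "a + b \<in> N" if ab: "a \<in> N" "b \<in> N" for a b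
    proof -
      have "pt a * (pt b - 1) + (pt a - 1) \<in> IL"
        using ab by (intro ksubD(2)[OF IL_ksub] IL_left supp_sg) (auto simp: N_def)
      then show ?thesis using ab by (auto simp: N_def add_G right_diff_distrib mult_single)
    qed
    show "- a \<in> N" if a: "a \<in> N" for a
    proof -
      have "pt (- a) * (pt a - 1) \<in> IL"
        using a by (intro IL_left supp_sg) (auto simp: N_def uminus_G)
      from ksub_diff[OF IL_ksub ksubD(1)[OF IL_ksub] this] have "0 - pt (- a) * (pt a - 1) \<in> IL" .
      then show ?thesis using a by (auto simp: N_def uminus_G right_diff_distrib mult_single)
    qed
    show "g + a - g \<in> N" if a: "a \<in> N" "g \<in> G" for a g
    proof -
      have "pt g * (pt a - 1) * pt (- g) \<in> IL"
        using a by (intro IL_right IL_left supp_sg) (auto simp: N_def uminus_G)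
      moreover have "g + a - g \<in> G" using a add_G[OF add_G uminus_G, of g a g] by (auto simp: N_def)
      ultimately show ?thesis
        by (simp add: N_def right_diff_distrib left_diff_distrib mult_single)
    qed
  qed
  then consider "N = {0}" | "N = G" | "N = {g \<in> G. chi g = 1}" "N \<noteq> G" by blast
  then show ?thesis
  proof cases
    case 1
    then have "A = range cst" by (intro A_eq_scalars) (auto simp: N_def)
    then show ?thesis ..
  next
    case 2
    then have "A = supp G" by (intro A_eq_supp) (auto simp: N_def)
    then show ?thesis ..
  next
    case 3
    then obtain g0 where "g0 \<in> G" "chi g0 \<noteq> 1" "pt g0 - 1 \<notin> IL" by (auto simp: N_def)
    then have "u = v" using 3 chi_cases[of g0] center by (intro u_eq_v_of_even[of g0]) (auto simp: N_def)
    then show ?thesis using uv by simp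
  qed
qed

end

section \<open>Transport to coordinate spaces\<close>

lemma linear_sum_map:
  assumes "\<And>x y. T (x + y) = T x + T y" "T (0 :: 'v::comm_monoid_add) = (0 :: 'w::comm_monoid_add)"
  shows "T (sum f I) = (\<Sum>i\<in>I. T (f i))"
  by (induction I rule: infinite_finite_induct) (auto simp: assms)

text \<open>Carries coordinate functions on \<open>C\<close> to the group ring along
  \<open>e\<close>. It is faithful only on functions vanishing outside \<open>C\<close> and for
  injective \<open>e\<close>.\<close>

definition embv :: "'a set \<Rightarrow> ('a \<Rightarrow> 'g::monoid_add) \<Rightarrow> ('a \<Rightarrow> 'k::field) \<Rightarrow> 'g \<Rightarrow>\<^sub>0 'k" where
  "embv C e f = (\<Sum>a\<in>C. sg (e a) (f a))"

lemma embv_add: "embv C e (f + f') = embv C e f + embv C e f'"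
  and embv_0: "embv C e 0 = 0"
  and embv_fscale: "embv C e (fscale c f) = cst c * embv C e f"
  by (simp_all add: embv_def single_add sum.distrib fscale_def sum_distrib_left)

lemma embv_sum: "embv C e (sum f I) = (\<Sum>i\<in>I. embv C e (f i))"
  by (rule linear_sum_map[of "embv C e"]) (simp_all add: embv_add embv_0)

lemma embv_delta: "finite C \<Longrightarrow> a \<in> C \<Longrightarrow> embv C e (delta a) = pt (e a)"
  unfolding embv_def delta_def
  by (subst sum.remove[of _ a]) (auto intro!: sum.neutral)

lemma embv_lookup:
  assumes "finite C" "inj_on e C" "a \<in> C"
  shows "lookup (embv C e f) (e a) = f a"
proof -
  have "lookup (embv C e f) (e a) = (\<Sum>b\<in>C. if b = a then f b else 0)"
    unfolding embv_def lookup_sum using assms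
    by (intro sum.cong refl) (auto simp: lookup_single when_def inj_on_eq_iff)
  then show ?thesis using assms by simp
qed

lemma embv_inj:
  assumes "finite C" "inj_on e C" "f \<in> coord_space C" "f' \<in> coord_space C" "embv C e f = embv C e f'"
  shows "f = f'"
proof
  fix a
  show "f a = f' a"
  proof (cases "a \<in> C")
    case True
    then show ?thesis using embv_lookup[OF assms(1,2)] assms(5) by metis
  next
    case False
    then show ?thesis using assms(3,4) by (simp add: coord_space_def)
  qed
qed

lemma embv_supp: "embv C e f \<in> supp (e ` C)"
  unfolding embv_def by (intro supp_sum supp_sg) auto

lemma embv_surj:
  assumes "finite C" "inj_on e C" "x \<in> supp (e ` C)"
  shows "embv C e (\<lambda>a. if a \<in> C then lookup x (e a) else 0) = x"
proof -
  have "embv C e (\<lambda>a. if a \<in> C then lookup x (e a) else 0) = (\<Sum>b\<in>e ` C. sg b (lookup x b))"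
    unfolding embv_def by (subst sum.reindex[OF assms(2)]) (simp add: o_def)
  also have "\<dots> = x" using assms poly_sum_superset[of "e ` C" x] by (simp add: supp_def)
  finally show ?thesis .
qed

lemma coord_space_closed:
  "0 \<in> coord_space B" "f \<in> coord_space B \<Longrightarrow> f' \<in> coord_space B \<Longrightarrow> f + f' \<in> coord_space B"
  "f \<in> coord_space B \<Longrightarrow> fscale c f \<in> coord_space B" "b \<in> B \<Longrightarrow> delta b \<in> coord_space B"
  by (auto simp: coord_space_def fscale_def delta_def)

lemma coord_space_sum: "(\<And>i. i \<in> I \<Longrightarrow> f i \<in> coord_space B) \<Longrightarrow> sum f I \<in> coord_space B"
  by (induction I rule: infinite_finite_induct) (auto intro: coord_space_closed)

lemma coord_space_tensor: "f \<in> coord_space B \<Longrightarrow> f' \<in> coord_space B' \<Longrightarrow> tensor f f' \<in> coord_space (B \<times> B')"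
  by (auto simp: coord_space_def tensor_def)

lemma sum_fun_eval: "(sum f I) x = (\<Sum>i\<in>I. f i x)" for f :: "'i \<Rightarrow> 'b \<Rightarrow> 'k::comm_monoid_add"
  by (induction I rule: infinite_finite_induct) auto

lemma coord_expand:
  assumes "finite B" "f \<in> coord_space B" shows "f = (\<Sum>b\<in>B. fscale (f b) (delta b))"
proof
  fix x
  have "(\<Sum>b\<in>B. fscale (f b) (delta b)) x = (\<Sum>b\<in>B. if b = x then f b else 0)"
    unfolding sum_fun_eval by (intro sum.cong refl) (auto simp: fscale_def delta_def)
  then show "f x = (\<Sum>b\<in>B. fscale (f b) (delta b)) x"
    using assms by (auto simp: coord_space_def)
qed

lemma embv_tensor:
  fixes f :: "'a \<Rightarrow> 'k::field" and e :: "'a \<Rightarrow> 'g::monoid_add" and e' :: "'b \<Rightarrow> 'h::monoid_add"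
  assumes "finite C" "finite C'"
  shows "embv (C \<times> C') (map_prod e e') (tensor f f') = tens (embv C e f) (embv C' e' f')"
proof -
  have sg: "tens (sg a c) (sg b d) = sg (a, b) (c * d)" for a :: 'g and b :: 'h and c d :: 'k
    by (simp add: tens_def mult_single)
  have "tens (embv C e f) (embv C' e' f') = (\<Sum>a\<in>C. \<Sum>b\<in>C'. tens (sg (e a) (f a)) (sg (e' b) (f' b)))"
    unfolding embv_def by (simp only: klin_sum[OF klin_tens(1)] klin_sum[OF klin_tens(2)]) (rule sum.swap)
  also have "\<dots> = embv (C \<times> C') (map_prod e e') (tensor f f')"
    by (simp add: embv_def sg sum.cartesian_product tensor_def case_prod_unfold map_prod_def)
  finally show ?thesis by simp
qed

interpretation fs: vector_space "fscale :: 'k::field \<Rightarrow> ('b \<Rightarrow> 'k) \<Rightarrow> 'b \<Rightarrow> 'k"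
  by unfold_locales (auto simp: fscale_def fun_eq_iff algebra_simps)

lemma fs_subspace: "fs.subspace V \<longleftrightarrow> 0 \<in> V \<and> (\<forall>x\<in>V. \<forall>y\<in>V. x + y \<in> V) \<and> (\<forall>c. \<forall>x\<in>V. fscale c x \<in> V)"
  by (rule fs.subspace_def)

lemma ksub_embv: assumes "fs.subspace V" shows "ksub (embv C e ` V)"
proof -
  have V: "0 \<in> V" "\<And>x y. x \<in> V \<Longrightarrow> y \<in> V \<Longrightarrow> x + y \<in> V" "\<And>c x. x \<in> V \<Longrightarrow> fscale c x \<in> V"
    using assms by (auto simp: fs_subspace)
  show ?thesis
    unfolding ksub_def
  proof (intro conjI ballI allI)
    show "0 \<in> embv C e ` V" using V(1) embv_0 by (metis imageI)
  qed (auto simp flip: embv_add embv_fscale intro!: imageI V)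
qed

locale group_twist = group G + twist "emb ` carrier G" chi "embv (carrier G \<times> carrier G) (map_prod emb emb) J"
    "embv (carrier G \<times> carrier G) (map_prod emb emb) Ji"
  for G :: "('a, 'm) monoid_scheme" (structure) and emb :: "'a \<Rightarrow> 'g::group_add" and chi :: "'g \<Rightarrow> 'k::field_char_0"
    and J Ji :: "'a \<times> 'a \<Rightarrow> 'k" +
  assumes fin: "finite (carrier G)"
    and emb_inj: "inj_on emb (carrier G)"
    and emb_mult: "x \<in> carrier G \<Longrightarrow> y \<in> carrier G \<Longrightarrow> emb (x \<otimes> y) = emb x + emb y"
    and Ji_vec: "Ji \<in> coord_space (carrier G \<times> carrier G)"
begin

abbreviation "C \<equiv> carrier G"
abbreviation "emb2 \<equiv> map_prod emb emb"
abbreviation to :: "('a \<Rightarrow> 'k) \<Rightarrow> 'g \<Rightarrow>\<^sub>0 'k" where "to \<equiv> embv C emb"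
abbreviation to2 :: "('a \<times> 'a \<Rightarrow> 'k) \<Rightarrow> 'g \<times> 'g \<Rightarrow>\<^sub>0 'k" where "to2 \<equiv> embv (C \<times> C) emb2"
abbreviation "emb3 \<equiv> map_prod emb emb2"
abbreviation to3 :: "('a \<times> 'a \<times> 'a \<Rightarrow> 'k) \<Rightarrow> 'g \<times> 'g \<times> 'g \<Rightarrow>\<^sub>0 'k" where "to3 \<equiv> embv (C \<times> C \<times> C) emb3"
abbreviation Hg :: "('k, 'a) bialg" where "Hg \<equiv> group_alg G"
abbreviation H :: "('k, 'a) bialg" where "H \<equiv> twist_bialg Hg J"

lemma emb_one: "emb \<one> = 0"
  using emb_mult[of \<one> \<one>] add_left_imp_eq[of "emb \<one>" "emb \<one>" 0] by simp

lemma emb2_inj: "inj_on emb2 (C \<times> C)" and emb3_inj: "inj_on emb3 (C \<times> C \<times> C)"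
  by (intro map_prod_inj_on emb_inj)+

lemma fin2: "finite (C \<times> C)" and fin3: "finite (C \<times> C \<times> C)"
  using fin by auto

lemma basis [simp]: "basis Hg = C" "basis H = C" "bmul H = bmul Hg" "bone H = bone Hg" "bcounit H = bcounit Hg"
  by (simp_all add: group_alg_def twist_bialg_def)

lemma to_delta [simp]: "a \<in> C \<Longrightarrow> to (delta a) = pt (emb a)"
  by (rule embv_delta[OF fin])

lemma to2_tensor [simp]: "to2 (tensor f f') = tens (to f) (to f')"
  by (rule embv_tensor[OF fin fin])

lemma to3_tensor [simp]: "to3 (tensor f X) = tens (to f) (to2 X)"
  by (rule embv_tensor[OF fin fin2])

lemma to_bmul: "to (bmul Hg f h) = to f * to h"
proof -
  have "to (bmul Hg f h) = (\<Sum>s\<in>C. \<Sum>t\<in>C. cst (f s * h t) * pt (emb s + emb t))"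
    by (simp add: group_alg_def twisted_mul_def embv_sum embv_fscale emb_mult del: cst_mult_single)
  also have "\<dots> = to f * to h"
    by (simp add: embv_def sum_product mult_single)
  finally show ?thesis .
qed

lemma bmul_vec: "bmul Hg f h \<in> coord_space C"
  unfolding group_alg_def twisted_mul_def by (auto intro!: coord_space_sum coord_space_closed)

lemma to_bone: "to (bone Hg) = 1"
  by (simp add: group_alg_def emb_one)

lemma bone_vec: "bone Hg \<in> coord_space C"
  by (simp add: group_alg_def coord_space_closed)

lemma to2_one2: "to2 (one2 Hg) = 1"
  by (simp add: one2_def to_bone)

lemma one2_vec: "one2 Hg \<in> coord_space (C \<times> C)"
  unfolding one2_def by (intro coord_space_tensor bone_vec)

lemma to2_mul2: "to2 (mul2 Hg X Y) = to2 X * to2 Y"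
proof -
  have "to2 (mul2 Hg X Y) = (\<Sum>p\<in>C\<times>C. \<Sum>q\<in>C\<times>C. cst (X p * Y q) * (pt (emb2 p) * pt (emb2 q)))"
    unfolding mul2_def basis embv_sum
  proof (intro sum.cong refl)
    fix p assume p: "p \<in> C \<times> C"
    obtain a b where ab: "p = (a, b)" "a \<in> C" "b \<in> C" using p by auto
    show "to2 (case p of (a, b) \<Rightarrow> \<Sum>(c, d)\<in>C \<times> C. fscale (X (a, b) * Y (c, d))
             (tensor (bmul Hg (delta a) (delta c)) (bmul Hg (delta b) (delta d)))) =
       (\<Sum>q\<in>C \<times> C. cst (X p * Y q) * (pt (emb2 p) * pt (emb2 q)))"
      unfolding ab prod.case embv_sum
    proof (intro sum.cong refl)
      fix q assume q: "q \<in> C \<times> C"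
      obtain c d where cd: "q = (c, d)" "c \<in> C" "d \<in> C" using q by auto
      show "to2 (case q of (c, d) \<Rightarrow> fscale (X (a, b) * Y (c, d))
             (tensor (bmul Hg (delta a) (delta c)) (bmul Hg (delta b) (delta d)))) =
          cst (X (a, b) * Y q) * (pt (emb2 (a, b)) * pt (emb2 q))"
        using ab cd by (simp add: embv_fscale to_bmul mult_single del: cst_mult_single)
    qed
  qed
  also have "\<dots> = to2 X * to2 Y"
    by (simp add: embv_def sum_product mult_single)
  finally show ?thesis .
qed

lemma mul2_vec: "mul2 Hg X Y \<in> coord_space (C \<times> C)"
  unfolding mul2_def by (auto intro!: coord_space_sum coord_space_closed coord_space_tensor bmul_vec)

lemma to_inj: "f \<in> coord_space C \<Longrightarrow> f' \<in> coord_space C \<Longrightarrow> to f = to f' \<Longrightarrow> f = f'"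
  by (rule embv_inj[OF fin emb_inj])

lemma to2_inj: "X \<in> coord_space (C \<times> C) \<Longrightarrow> X' \<in> coord_space (C \<times> C) \<Longrightarrow> to2 X = to2 X' \<Longrightarrow> X = X'"
  by (rule embv_inj[OF fin2 emb2_inj])

lemma to3_inj: "Z \<in> coord_space (C \<times> C \<times> C) \<Longrightarrow> Z' \<in> coord_space (C \<times> C \<times> C) \<Longrightarrow> to3 Z = to3 Z' \<Longrightarrow> Z = Z'"
  by (rule embv_inj[OF fin3 emb3_inj])

text \<open>\<open>inv2\<close> is a definite description: \<open>Ji\<close> gives existence, and
  uniqueness of inverses is pulled back from the group ring by injectivity of
  \<open>to2\<close>.\<close>

lemma inv2_J: "inv2 Hg J = Ji"
  unfolding inv2_def
proof (rule the_equality)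
  have J: "to2 J * to2 Ji = 1" "to2 Ji * to2 J = 1" by (rule J_J' J'_J)+
  show "Ji \<in> vecs2 Hg \<and> mul2 Hg J Ji = one2 Hg \<and> mul2 Hg Ji J = one2 Hg"
    using Ji_vec J by (auto intro!: to2_inj mul2_vec one2_vec simp: to2_mul2 to2_one2)
  fix v assume v: "v \<in> vecs2 Hg \<and> mul2 Hg J v = one2 Hg \<and> mul2 Hg v J = one2 Hg"
  then have "to2 J * to2 v = 1" by (metis to2_mul2 to2_one2)
  then have "to2 v = to2 Ji" using inverse_unique2 J(2) by blast
  then show "v = Ji" using v Ji_vec by (auto intro: to2_inj)
qed

lemma to2_comul_Hg: "to2 (bcomul Hg f) = comul (to f)"
proof -
  have "to2 (bcomul Hg f) = (\<Sum>g\<in>C. cst (f g) * tens (pt (emb g)) (pt (emb g)))"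
    by (simp add: group_alg_def embv_sum embv_fscale del: cst_mult_single tens_pt)
  also have "\<dots> = comul (to f)" by (simp add: embv_def klin_sum[OF klin_comul])
  finally show ?thesis .
qed

lemma to2_bcomul: "to2 (bcomul H f) = D (to f)"
  by (simp add: twist_bialg_def to2_mul2 to2_comul_Hg D_def inv2_J)

lemma bcomul_vec: "bcomul H f \<in> coord_space (C \<times> C)"
  by (simp add: twist_bialg_def mul2_vec)

lemma to_supp: "to f \<in> supp (emb ` C)"
  by (rule embv_supp)

definition fro where "fro x = (\<lambda>a. if a \<in> C then lookup x (emb a) else 0)"

lemma fro_vec: "fro x \<in> coord_space C"
  by (auto simp: fro_def coord_space_def)

lemma to_fro: "x \<in> supp (emb ` C) \<Longrightarrow> to (fro x) = x"
  unfolding fro_def by (rule embv_surj[OF fin emb_inj])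

lemma bcounit_eps: "bcounit Hg f = eps (to f)"
proof -
  have "klinf (eps :: ('g \<Rightarrow>\<^sub>0 'k) \<Rightarrow> 'k)" by auto
  then have "eps (to f) = (\<Sum>g\<in>C. f g)" unfolding embv_def by (simp add: klinf_sum)
  then show ?thesis by (simp add: group_alg_def)
qed

text \<open>\<open>T\<close> is any linear map into a group ring, so the same rule serves for values
  in the algebra and in its tensor cube. \<open>F\<close> has to be matched only on basis vectors,
  since a Sweedler sum evaluates it nowhere else.\<close>

lemma sweedler_transfer:
  assumes T: "\<And>x y. T (x + y) = T x + T y" "T 0 = 0" "\<And>c x. T (fscale c x) = cst c * T x"
    and F: "\<And>a b. a \<in> C \<Longrightarrow> b \<in> C \<Longrightarrow> T (F (delta a) (delta b)) = F' (emb a) (emb b)"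
  shows "T (sweedler fscale H h F) = lin (\<lambda>(p, q). F' p q) (D (to h))"
proof -
  have "T (sweedler fscale H h F) = (\<Sum>p\<in>C\<times>C. cst (bcomul H h p) * (case p of (a, b) \<Rightarrow> F' (emb a) (emb b)))"
    unfolding sweedler_def basis linear_sum_map[of T, OF T(1,2)]
    by (intro sum.cong refl) (auto simp: T(3) F)
  also have "\<dots> = (\<Sum>p\<in>C\<times>C. cst (lookup (D (to h)) (emb2 p)) * (case emb2 p of (p, q) \<Rightarrow> F' p q))"
  proof (intro sum.cong refl)
    fix p assume p: "p \<in> C \<times> C"
    show "cst (bcomul H h p) * (case p of (a, b) \<Rightarrow> F' (emb a) (emb b)) =
      cst (lookup (D (to h)) (emb2 p)) * (case emb2 p of (p, q) \<Rightarrow> F' p q)"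
      using embv_lookup[OF fin2 emb2_inj p, of "bcomul H h"] by (cases p) (simp add: to2_bcomul)
  qed
  also have "\<dots> = (\<Sum>p\<in>emb2 ` (C\<times>C). cst (lookup (D (to h)) p) * (case p of (p, q) \<Rightarrow> F' p q))"
    by (subst sum.reindex[OF emb2_inj]) simp
  also have "\<dots> = lin (\<lambda>(p, q). F' p q) (D (to h))"
    using fin embv_supp[of "C \<times> C" emb2 "bcomul H h"]
    by (intro lin_superset[symmetric]) (auto simp: to2_bcomul supp_def)
  finally show ?thesis .
qed

lemmas to_sweedler = sweedler_transfer[of to, OF embv_add embv_0 embv_fscale]
lemmas to3_sweedler = sweedler_transfer[of to3, OF embv_add embv_0 embv_fscale]

lemma sweedler_vec:
  "(\<And>a b. a \<in> C \<Longrightarrow> b \<in> C \<Longrightarrow> F (delta a) (delta b) \<in> coord_space B) \<Longrightarrow> sweedler fscale H h F \<in> coord_space B"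
  unfolding sweedler_def by (auto intro!: coord_space_sum coord_space_closed)

lemma coassoc_H: "sweedler fscale H h (\<lambda>h1 h2. sweedler fscale H h1 (\<lambda>x y. tensor x (tensor y h2))) =
        sweedler fscale H h (\<lambda>h1 h2. sweedler fscale H h2 (\<lambda>y z. tensor h1 (tensor y z)))"
proof (rule to3_inj)
  show "sweedler fscale H h (\<lambda>h1 h2. sweedler fscale H h1 (\<lambda>x y. tensor x (tensor y h2))) \<in> coord_space (C \<times> C \<times> C)"
    by (intro sweedler_vec coord_space_tensor coord_space_closed; assumption)
  show "sweedler fscale H h (\<lambda>h1 h2. sweedler fscale H h2 (\<lambda>y z. tensor h1 (tensor y z))) \<in> coord_space (C \<times> C \<times> C)"
    by (intro sweedler_vec coord_space_tensor coord_space_closed; assumption)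
  have "to3 (sweedler fscale H h (\<lambda>h1 h2. sweedler fscale H h1 (\<lambda>x y. tensor x (tensor y h2)))) =
    lin (\<lambda>(p, q). lin (\<lambda>(c, d). pt (c, d, q)) (D (pt p))) (D (to h))"
  proof (rule to3_sweedler)
    fix a b assume ab: "a \<in> C" "b \<in> C"
    then show "to3 (sweedler fscale H (delta a) (\<lambda>x y. tensor x (tensor y (delta b)))) =
      lin (\<lambda>(c, d). pt (c, d, emb b)) (D (pt (emb a)))"
      by (subst to3_sweedler[where F' = "\<lambda>c d. pt (c, d, emb b)"]) auto
  qed
  moreover have "to3 (sweedler fscale H h (\<lambda>h1 h2. sweedler fscale H h2 (\<lambda>y z. tensor h1 (tensor y z)))) =
    lin (\<lambda>(p, q). lin (\<lambda>(c, d). pt (p, c, d)) (D (pt q))) (D (to h))"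
  proof (rule to3_sweedler)
    fix a b assume ab: "a \<in> C" "b \<in> C"
    then show "to3 (sweedler fscale H (delta b) (\<lambda>y z. tensor (delta a) (tensor y z))) =
      lin (\<lambda>(c, d). pt (emb a, c, d)) (D (pt (emb b)))"
      by (subst to3_sweedler[where F' = "\<lambda>c d. pt (emb a, c, d)"]) auto
  qed
  ultimately show "to3 (sweedler fscale H h (\<lambda>h1 h2. sweedler fscale H h1 (\<lambda>x y. tensor x (tensor y h2)))) =
    to3 (sweedler fscale H h (\<lambda>h1 h2. sweedler fscale H h2 (\<lambda>y z. tensor h1 (tensor y z))))"
    using coassoc_lin[of "\<lambda>x. pt x" "to h"] by simp
qed

lemma counit_H:
  assumes "h \<in> coord_space C"
  shows "sweedler fscale H h (\<lambda>h1 h2. fscale (bcounit H h1) h2) = h"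
    "sweedler fscale H h (\<lambda>h1 h2. fscale (bcounit H h2) h1) = h"
proof -
  show "sweedler fscale H h (\<lambda>h1 h2. fscale (bcounit H h1) h2) = h"
  proof (rule to_inj[OF _ assms])
    show "sweedler fscale H h (\<lambda>h1 h2. fscale (bcounit H h1) h2) \<in> coord_space C"
      by (intro sweedler_vec coord_space_closed)
    have "to (sweedler fscale H h (\<lambda>h1 h2. fscale (bcounit H h1) h2)) = lin (\<lambda>(p, q). pt q) (D (to h))"
      by (rule to_sweedler) (simp add: embv_fscale bcounit_eps)
    then show "to (sweedler fscale H h (\<lambda>h1 h2. fscale (bcounit H h1) h2)) = to h"
      using counit_D(2)[of "to h"] by (simp add: wmap_def case_prod_unfold)
  qed
  show "sweedler fscale H h (\<lambda>h1 h2. fscale (bcounit H h2) h1) = h"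
  proof (rule to_inj[OF _ assms])
    show "sweedler fscale H h (\<lambda>h1 h2. fscale (bcounit H h2) h1) \<in> coord_space C"
      by (intro sweedler_vec coord_space_closed)
    have "to (sweedler fscale H h (\<lambda>h1 h2. fscale (bcounit H h2) h1)) = lin (\<lambda>(p, q). pt p) (D (to h))"
      by (rule to_sweedler) (simp add: embv_fscale bcounit_eps)
    then show "to (sweedler fscale H h (\<lambda>h1 h2. fscale (bcounit H h2) h1)) = to h"
      using counit_D(1)[of "to h"] by (simp add: wmap_def case_prod_unfold)
  qed
qed

lemma bialgebra_H: "bialgebra H"
proof -
  have mul2_H: "mul2 H = mul2 Hg" by (intro ext) (simp add: mul2_def)
  have one2_H: "one2 H = one2 Hg" by (simp add: one2_def)
  note vecs = bmul_vec bone_vec bcomul_vec coord_space_closed mul2_vec one2_vec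
  have D_cst: "D (cst c) = cst c" for c using klin_cst[OF klin_D, of c 1] by simp
  have eps_cst: "eps (cst c) = c" for c :: 'k by (simp add: cst_def)
  note trs = D_cst eps_cst to_bmul to_bone to2_bcomul embv_add embv_fscale bcounit_eps to2_mul2 to2_one2
  show ?thesis
    unfolding bialgebra_def bilinear_on_def linear_on_def basis(2) mul2_H one2_H
  proof (intro conjI ballI allI)
    show "finite C" by (rule fin)
    fix h :: "'a \<Rightarrow> 'k" assume h: "h \<in> coord_space C"
    show "sweedler fscale H h (\<lambda>h1 h2. sweedler fscale H h1 (\<lambda>x y. tensor x (tensor y h2))) =
        sweedler fscale H h (\<lambda>h1 h2. sweedler fscale H h2 (\<lambda>y z. tensor h1 (tensor y z)))"
      by (rule coassoc_H)
    show "sweedler fscale H h (\<lambda>h1 h2. fscale (bcounit H h1) h2) = h" by (rule counit_H(1)[OF h])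
    show "sweedler fscale H h (\<lambda>h1 h2. fscale (bcounit H h2) h1) = h" by (rule counit_H(2)[OF h])
  qed (auto intro!: to_inj to2_inj vecs simp: trs distrib_left distrib_right scal_left mult.assoc
      klin_add[OF klin_D] klin_cst[OF klin_D] D_mult aug_add aug_cst_mult eps_mult aug_1)
qed

end

section \<open>Antipode, adjoint actions and simplicity in coordinates\<close>

context group_twist
begin

lemma to_sweedler_antipode:
  assumes "\<And>a. a \<in> C \<Longrightarrow> to (T (delta a)) = T' (emb a)"
  shows "to (sweedler fscale H h (\<lambda>h1 h2. bmul H (T h1) h2)) = lin (\<lambda>(p, q). T' p * pt q) (D (to h))"
    "to (sweedler fscale H h (\<lambda>h1 h2. bmul H h1 (T h2))) = lin (\<lambda>(p, q). pt p * T' q) (D (to h))"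
  by (rule to_sweedler; simp add: to_bmul assms)+

lemma antipode_H: "is_antipode H (\<lambda>h. fro (Sj (to h)))"
proof -
  have S: "to (fro (Sj (to h))) = Sj (to h)" for h
    by (intro to_fro supp_Sj to_supp)
  have S'': "to (fro (Sj (to x) + Sj (to y))) = Sj (to x) + Sj (to y)"
    "to (fro (cst c * Sj (to x))) = cst c * Sj (to x)" for x y c
    by (intro to_fro supp_add supp_cst supp_Sj to_supp)+
  have S': "to (fro (Sj (pt (emb a)))) = Sj (pt (emb a))" if "a \<in> C" for a
    using that by (intro to_fro supp_Sj supp_sg) auto
  show ?thesis
    unfolding is_antipode_def linear_on_def basis(2)
  proof (intro conjI ballI allI)
    fix h :: "'a \<Rightarrow> 'k"
    show "sweedler fscale H h (\<lambda>h1 h2. bmul H (fro (Sj (to h1))) h2) = fscale (bcounit H h) (bone H)"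
    proof (rule to_inj)
      show "to (sweedler fscale H h (\<lambda>h1 h2. bmul H (fro (Sj (to h1))) h2)) = to (fscale (bcounit H h) (bone H))"
        by (subst to_sweedler_antipode(1)[where T' = "\<lambda>p. Sj (pt p)"])
           (simp_all add: S S' antipode_left embv_fscale to_bone bcounit_eps)
    qed (auto intro!: sweedler_vec coord_space_closed bmul_vec bone_vec)
    show "sweedler fscale H h (\<lambda>h1 h2. bmul H h1 (fro (Sj (to h2)))) = fscale (bcounit H h) (bone H)"
    proof (rule to_inj)
      show "to (sweedler fscale H h (\<lambda>h1 h2. bmul H h1 (fro (Sj (to h2))))) = to (fscale (bcounit H h) (bone H))"
        by (subst to_sweedler_antipode(2)[where T' = "\<lambda>p. Sj (pt p)"])
           (simp_all add: S S' antipode_right embv_fscale to_bone bcounit_eps)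
    qed (auto intro!: sweedler_vec coord_space_closed bmul_vec bone_vec)
  qed (auto intro!: to_inj fro_vec coord_space_closed simp: S S'' embv_add embv_fscale klin_add[OF klin_Sj] klin_cst[OF klin_Sj])
qed

text \<open>\<open>antipode\<close> is a choice, so its values are identified by uniqueness of
  convolution inverses: \<open>T(h\<^sub>1) h\<^sub>2 Sj(h\<^sub>3)\<close> is bracketed in both
  ways.\<close>

lemma antipode_unique:
  assumes "is_antipode H T" "h \<in> coord_space C"
  shows "to (T h) = Sj (to h)"
proof -
  have lin_add_T: "T (x + y) = T x + T y" if "x \<in> coord_space C" "y \<in> coord_space C" for x y
    using assms(1) that by (auto simp: is_antipode_def linear_on_def)
  have lin_sc_T: "T (fscale c x) = fscale c (T x)" if "x \<in> coord_space C" for x c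
    using assms(1) that by (auto simp: is_antipode_def linear_on_def)
  have T: "sweedler fscale H h (\<lambda>h1 h2. bmul H (T h1) h2) = fscale (bcounit H h) (bone H)" if "h \<in> coord_space C" for h
    using assms(1) that by (auto simp: is_antipode_def)
  \<comment> \<open>\<open>T\<close> acts on coordinate vectors; here its values on basis vectors
    are reindexed by the embedded group elements, so that coassociativity in the group ring
    applies.\<close>
  define T' where "T' p = to (T (delta (inv_into C emb p)))" for p
  have T': "to (T (delta a)) = T' (emb a)" if "a \<in> C" for a
    using that emb_inj by (simp add: T'_def)
  have T0: "T 0 = 0"
    using lin_add_T[of 0 0] by (simp add: coord_space_closed)
  have sumT: "T (sum f I) = (\<Sum>i\<in>I. T (f i))" if "\<And>i. i \<in> I \<Longrightarrow> f i \<in> coord_space C" for f :: "'a \<Rightarrow> 'a \<Rightarrow> 'k" and I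
    using that
    by (induction I rule: infinite_finite_induct) (simp_all add: lin_add_T coord_space_sum T0)
  have toT: "to (T h) = lin T' (to h)"
  proof -
    have "T h = T (\<Sum>b\<in>C. fscale (h b) (delta b))"
      using coord_expand[OF fin assms(2)] by (rule arg_cong)
    also have "\<dots> = (\<Sum>b\<in>C. T (fscale (h b) (delta b)))"
      by (rule sumT) (auto intro: coord_space_closed)
    also have "\<dots> = (\<Sum>b\<in>C. fscale (h b) (T (delta b)))"
      by (intro sum.cong refl lin_sc_T) (auto intro: coord_space_closed)
    finally have "to (T h) = (\<Sum>b\<in>C. cst (h b) * T' (emb b))"
      by (simp add: embv_sum embv_fscale T')
    also have "\<dots> = lin T' (to h)"
      by (simp add: embv_def klin_sum[OF klin_lin])
    finally show ?thesis .
  qed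
  have conv: "lin (\<lambda>(p, q). T' p * pt q) (D (pt a)) = 1" if a: "a \<in> emb ` C" for a
  proof -
    obtain g where g: "g \<in> C" "a = emb g" using a by auto
    have "lin (\<lambda>(p, q). T' p * pt q) (D (to (delta g))) = to (sweedler fscale H (delta g) (\<lambda>h1 h2. bmul H (T h1) h2))"
      by (rule to_sweedler_antipode(1)[symmetric]) (rule T')
    also have "\<dots> = to (fscale (bcounit H (delta g)) (bone H))"
      by (simp only: T[OF coord_space_closed(4)[OF g(1)]])
    finally show ?thesis using g by (simp add: embv_fscale bcounit_eps to_bone)
  qed
  let ?x = "to h"
  have "lin (\<lambda>(a, b). lin (\<lambda>(c, d). T' c * pt d * Sj (pt b)) (D (pt a))) (D ?x) =
     lin (\<lambda>(a, b). Sj (pt b)) (D ?x)"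
  proof -
    have "lin (\<lambda>(c, d). T' c * pt d * Sj (pt b)) X = lin (\<lambda>(c, d). T' c * pt d) X * Sj (pt b)"
      for b and X :: "'g \<times> 'g \<Rightarrow>\<^sub>0 'k"
      by (rule klin_eqI[where x = X]) auto
    then show ?thesis
      using keys_supp[OF supp_D[OF to_supp]] unfolding lin_def[of _ "D ?x"]
      by (intro sum.cong refl) (auto simp: conv)
  qed
  also have "\<dots> = Sj (mp snd (D ?x))"
    by (rule klin_eqI[where x = "D ?x"]) (auto intro: klin_comp[OF klin_Sj klin_wmap])
  finally have 1: "lin (\<lambda>(a, b). lin (\<lambda>(c, d). T' c * pt d * Sj (pt b)) (D (pt a))) (D ?x) = Sj ?x"
    by (simp add: counit_D)
  have "lin (\<lambda>(a, b). lin (\<lambda>(c, d). T' c * pt d * Sj (pt b)) (D (pt a))) (D ?x) =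
    lin (\<lambda>(a, b). lin (\<lambda>(c, d). T' a * pt c * Sj (pt d)) (D (pt b))) (D ?x)"
    using coassoc_lin[of "\<lambda>(c, d, b). T' c * pt d * Sj (pt b)" ?x] by simp
  also have "\<dots> = lin (\<lambda>(a, b). T' a) (D ?x)"
  proof -
    have "lin (\<lambda>(c, d). T' a * pt c * Sj (pt d)) X = T' a * lin (\<lambda>(c, d). pt c * Sj (pt d)) X"
      for a and X :: "'g \<times> 'g \<Rightarrow>\<^sub>0 'k"
      by (rule klin_eqI[where x = X]) (auto simp: mult.assoc)
    then show ?thesis by (simp add: antipode_right)
  qed
  also have "\<dots> = lin T' (mp fst (D ?x))"
    by (rule klin_eqI[where x = "D ?x"]) (auto intro: klin_comp[OF klin_lin klin_wmap])
  finally show ?thesis using 1 by (simp add: counit_D toT)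
qed

lemma is_antipode_antipode: "is_antipode H (antipode H)"
  unfolding antipode_def by (rule someI[of "is_antipode H", OF antipode_H])

lemma to_antipode: "h \<in> coord_space C \<Longrightarrow> to (antipode H h) = Sj (to h)"
  by (rule antipode_unique[OF is_antipode_antipode])

lemma antipode_vec: "h \<in> coord_space C \<Longrightarrow> antipode H h \<in> coord_space C"
  using is_antipode_antipode by (simp add: is_antipode_def)

lemma hopf_H: "hopf_algebra H"
  unfolding hopf_algebra_def using bialgebra_H antipode_H by blast

lemma to_left_adjoint: "to (left_adjoint H h a) = ladj (to h) (to a)"
proof -
  have "to (left_adjoint H h a) = lin (\<lambda>(p, q). pt p * (to a * Sj (pt q))) (D (to h))"
    unfolding left_adjoint_def
    by (rule to_sweedler) (simp add: to_bmul to_antipode coord_space_closed)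
  also have "\<dots> = ladj (to h) (to a)"
    unfolding ladj_def by (rule klin_eqI[where x = "D (to h)"]) (auto simp: Sj_def mult.assoc)
  finally show ?thesis .
qed

lemma to_right_adjoint: "to (right_adjoint H h a) = radj (to h) (to a)"
proof -
  have "to (right_adjoint H h a) = lin (\<lambda>(p, q). Sj (pt p) * (to a * pt q)) (D (to h))"
    unfolding right_adjoint_def
    by (rule to_sweedler) (simp add: to_bmul to_antipode coord_space_closed)
  also have "\<dots> = radj (to h) (to a)"
    unfolding radj_def by (rule klin_eqI[where x = "D (to h)"]) (auto simp: Sj_def mult.assoc)
  finally show ?thesis .
qed

lemma left_adjoint_vec: "left_adjoint H h a \<in> coord_space C"
  unfolding left_adjoint_def by (rule sweedler_vec) (auto intro: bmul_vec)

lemma span_tspan: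
  assumes "X \<in> fs.span {tensor a b |a b. a \<in> A \<and> b \<in> A}" "fs.subspace A"
  shows "to2 X \<in> tspan (to ` A) (to ` A)"
  using assms(1)
proof (induction rule: fs.span_induct_alt)
  case base
  show ?case by (simp only: embv_0 tspan.tspan_0)
next
  case (step c x y)
  then obtain a b where ab: "x = tensor a b" "a \<in> A" "b \<in> A" by auto
  have "fscale c a \<in> A" using assms(2) ab by (simp add: fs_subspace)
  then have "tens (to (fscale c a)) (to b) \<in> tspan (to ` A) (to ` A)"
    using ab by (intro tspan_tens) auto
  then show ?case using step.IH
    by (simp only: ab embv_add embv_fscale tens_cst to2_tensor tspan_add)
qed

lemma tspan_span:
  assumes "Y \<in> tspan (to ` A) (to ` A)"
  shows "\<exists>X \<in> fs.span {tensor a b |a b. a \<in> A \<and> b \<in> A}. to2 X = Y"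
  using assms
proof induction
  case tspan_0
  then show ?case using fs.span_zero embv_0 by blast
next
  case (tspan_step Y x y)
  then obtain X a b where X: "X \<in> fs.span {tensor a b |a b. a \<in> A \<and> b \<in> A}" "to2 X = Y"
    and ab: "a \<in> A" "b \<in> A" "x = to a" "y = to b" by auto
  have "X + tensor a b \<in> fs.span {tensor a b |a b. a \<in> A \<and> b \<in> A}"
    by (rule fs.span_add[OF X(1) fs.span_base]) (use ab in auto)
  moreover have "to2 (X + tensor a b) = Y + tens x y"
    by (simp only: embv_add to2_tensor X(2) ab(3,4))
  ultimately show ?case by blast
qed

lemma ex_to: "x \<in> supp (emb ` C) \<Longrightarrow> \<exists>h\<in>coord_space C. x = to h"
  using to_fro fro_vec by metis

lemma normal_sub_of_normal:
  assumes "normal_hopf_subalgebra A H"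
  shows "normal_sub (emb ` C) chi (to2 J) (to2 Ji) (to ` A)"
proof
  have h: "hopf_subalgebra A H" and st: "(\<forall>h\<in>coord_space C. \<forall>a\<in>A. left_adjoint H h a \<in> A) \<or>
      (\<forall>h\<in>coord_space C. \<forall>a\<in>A. right_adjoint H h a \<in> A)"
    using assms by (auto simp: normal_hopf_subalgebra_def)
  have sub: "A \<subseteq> coord_space C" and ss: "fs.subspace A" and one: "bone Hg \<in> A"
    and mult: "\<And>x y. x \<in> A \<Longrightarrow> y \<in> A \<Longrightarrow> bmul Hg x y \<in> A"
    and com: "\<And>x. x \<in> A \<Longrightarrow> bcomul H x \<in> fs.span {tensor a b |a b. a \<in> A \<and> b \<in> A}"
    and anti: "\<And>x. x \<in> A \<Longrightarrow> antipode H x \<in> A"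
    using h by (auto simp: hopf_subalgebra_def)
  show "to ` A \<subseteq> supp (emb ` C)" using to_supp by auto
  show "ksub (to ` A)" by (rule ksub_embv[OF ss])
  show "1 \<in> to ` A" using one to_bone by (metis imageI)
  show "x * y \<in> to ` A" if "x \<in> to ` A" "y \<in> to ` A" for x y
    using that mult by (auto simp flip: to_bmul)
  show "D x \<in> tspan (to ` A) (to ` A)" if "x \<in> to ` A" for x
    using that com span_tspan[OF _ ss] by (auto simp flip: to2_bcomul)
  show "Sj x \<in> to ` A" if x: "x \<in> to ` A" for x
  proof -
    obtain a where a: "a \<in> A" "x = to a" using x by auto
    then have "Sj x = to (antipode H a)" using sub to_antipode by auto
    then show ?thesis using anti a by auto
  qed
  from st show "(\<forall>h\<in>supp (emb ` C). \<forall>a\<in>to ` A. ladj h a \<in> to ` A) \<or> (\<forall>h\<in>supp (emb ` C). \<forall>a\<in>to ` A. radj h a \<in> to ` A)"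
  proof
    assume l: "\<forall>h\<in>coord_space C. \<forall>a\<in>A. left_adjoint H h a \<in> A"
    have "ladj h b \<in> to ` A" if h: "h \<in> supp (emb ` C)" and b: "b \<in> to ` A" for h b
    proof -
      obtain f where f: "f \<in> coord_space C" "h = to f" using ex_to[OF h] by auto
      obtain a where a: "a \<in> A" "b = to a" using b by auto
      have "ladj h b = to (left_adjoint H f a)" by (simp add: f a to_left_adjoint)
      then show ?thesis using l f a by auto
    qed
    then show ?thesis by blast
  next
    assume l: "\<forall>h\<in>coord_space C. \<forall>a\<in>A. right_adjoint H h a \<in> A"
    have "radj h b \<in> to ` A" if h: "h \<in> supp (emb ` C)" and b: "b \<in> to ` A" for h b
    proof -
      obtain f where f: "f \<in> coord_space C" "h = to f" using ex_to[OF h] by auto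
      obtain a where a: "a \<in> A" "b = to a" using b by auto
      have "radj h b = to (right_adjoint H f a)" by (simp add: f a to_right_adjoint)
      then show ?thesis using l f a by auto
    qed
    then show ?thesis by blast
  qed
qed

lemma trivial_images:
  assumes "A \<subseteq> coord_space C"
  shows "to ` A = range cst \<longleftrightarrow> A = fs.span {bone Hg}" "to ` A = supp (emb ` C) \<longleftrightarrow> A = coord_space C"
proof -
  have full: "to ` coord_space C = supp (emb ` C)"
    using to_supp ex_to by auto
  have sp: "fs.span {bone Hg} = range (\<lambda>c. fscale c (bone Hg))"
    by (rule fs.span_singleton)
  have span: "to ` fs.span {bone Hg} = range cst"
    unfolding sp by (simp add: image_image embv_fscale to_bone)
  have span_sub: "fs.span {bone Hg} \<subseteq> coord_space C"
    unfolding sp by (auto intro!: coord_space_closed bone_vec)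
  have inj: "inj_on to (coord_space C)" by (auto intro!: inj_onI to_inj)
  have eq: "to ` A = to ` B \<longleftrightarrow> A = B" if "B \<subseteq> coord_space C" for B
    using inj_on_image_eq_iff[OF inj assms that] .
  show "to ` A = range cst \<longleftrightarrow> A = fs.span {bone Hg}" using eq[OF span_sub] span by simp
  show "to ` A = supp (emb ` C) \<longleftrightarrow> A = coord_space C" using eq[of "coord_space C"] full by simp
qed

definition "FixH = {f \<in> coord_space C. to f \<in> Fix}"

lemma to_FixH: "to ` FixH = Fix"
proof
  show "Fix \<subseteq> to ` FixH"
  proof
    fix x assume x: "x \<in> Fix"
    then obtain h where "h \<in> coord_space C" "x = to h" using ex_to[of x] by (auto simp: Fix_def)
    then show "x \<in> to ` FixH" using x by (auto simp: FixH_def)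
  qed
qed (auto simp: FixH_def)

lemma normal_FixH:
  assumes "u = v" shows "normal_hopf_subalgebra FixH H"
  unfolding normal_hopf_subalgebra_def hopf_subalgebra_def
proof (intro conjI ballI disjI1)
  show "FixH \<subseteq> vecs H" by (auto simp: FixH_def)
  show "fs.subspace FixH"
    using Fix_ksub by (auto simp: fs_subspace FixH_def coord_space_closed embv_0 embv_add embv_fscale ksubD)
  show "bone H \<in> FixH" by (auto simp: FixH_def bone_vec to_bone Fix_1)
  show "bmul H x y \<in> FixH" if "x \<in> FixH" "y \<in> FixH" for x y
    using that by (auto simp: FixH_def bmul_vec to_bmul Fix_mult)
  show "bcomul H x \<in> fs.span {tensor a b |a b. a \<in> FixH \<and> b \<in> FixH}" if x: "x \<in> FixH" for x
  proof -
    have "D (to x) \<in> tspan Fix Fix" using x by (intro Fix_D assms) (simp add: FixH_def)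
    then have "to2 (bcomul H x) \<in> tspan (to ` FixH) (to ` FixH)"
      by (simp only: to2_bcomul to_FixH)
    then obtain X where X: "X \<in> fs.span {tensor a b |a b. a \<in> FixH \<and> b \<in> FixH}" "to2 X = to2 (bcomul H x)"
      using tspan_span by blast
    \<comment> \<open>\<open>to2\<close> is injective only on coordinate vectors, so the preimage
      \<open>X\<close> is located there before it is identified with the coproduct.\<close>
    have "fs.span {tensor a b |a b. a \<in> FixH \<and> b \<in> FixH} \<subseteq> coord_space (C \<times> C)"
      by (intro fs.span_minimal) (auto simp: FixH_def fs_subspace coord_space_closed intro: coord_space_tensor)
    then have "X = bcomul H x" using X by (intro to2_inj bcomul_vec) auto
    then show ?thesis using X by simp
  qed
  show "antipode H x \<in> FixH" if "x \<in> FixH" for x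
    using that by (auto simp: FixH_def antipode_vec to_antipode Fix_Sj[OF assms])
  show "left_adjoint H h a \<in> FixH" if "h \<in> vecs H" "a \<in> FixH" for h a
    using that by (auto simp: FixH_def left_adjoint_vec to_left_adjoint intro!: Fix_ladj[OF assms] to_supp)
qed

theorem simple_iff:
  assumes subgroups: "\<And>N. N \<subseteq> emb ` C \<Longrightarrow> 0 \<in> N \<Longrightarrow> (\<And>a b. a \<in> N \<Longrightarrow> b \<in> N \<Longrightarrow> a + b \<in> N) \<Longrightarrow>
        (\<And>a. a \<in> N \<Longrightarrow> - a \<in> N) \<Longrightarrow> (\<And>a g. a \<in> N \<Longrightarrow> g \<in> emb ` C \<Longrightarrow> g + a - g \<in> N) \<Longrightarrow>
        N = {0} \<or> N = emb ` C \<or> N = {g \<in> emb ` C. chi g = 1}"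
    and center: "\<And>z. z \<in> emb ` C \<Longrightarrow> (\<And>g. g \<in> emb ` C \<Longrightarrow> z + g = g + z) \<Longrightarrow> z = 0"
    and noncomm: "a \<in> C" "b \<in> C" "a \<otimes> b \<noteq> b \<otimes> a"
    and odd: "g \<in> C" "chi (emb g) \<noteq> 1"
  shows "simple_hopf_algebra H \<longleftrightarrow> u \<noteq> v"
proof
  assume s: "simple_hopf_algebra H"
  show "u \<noteq> v"
  proof
    assume uv: "u = v"
    have "FixH = fs.span {bone H} \<or> FixH = vecs H"
      using s normal_FixH[OF uv] by (simp add: simple_hopf_algebra_def)
    moreover have "FixH \<subseteq> coord_space C" by (auto simp: FixH_def)
    ultimately have "Fix = range cst \<or> Fix = supp (emb ` C)"
      using trivial_images[of FixH] to_FixH by simp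
    moreover have "Fix \<noteq> supp (emb ` C)" using odd by (intro Fix_neq_supp[of "emb g"]) auto
    moreover have "Fix \<noteq> range cst"
    proof (rule Fix_neq_cst[of "emb a" "emb b"])
      show "emb a + emb b \<noteq> emb b + emb a"
        using noncomm emb_inj by (simp add: inj_on_eq_iff flip: emb_mult)
    qed (use noncomm in auto)
    ultimately show False by blast
  qed
next
  assume uv: "u \<noteq> v"
  have "A = fs.span {bone H} \<or> A = vecs H" if n: "normal_hopf_subalgebra A H" for A
  proof -
    interpret ns: normal_sub "emb ` C" chi "to2 J" "to2 Ji" "to ` A"
      by (rule normal_sub_of_normal[OF n])
    have "to ` A = range cst \<or> to ` A = supp (emb ` C)"
      using uv subgroups center by (rule ns.normal_sub_trivial)
    moreover have "A \<subseteq> coord_space C"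
      using n by (auto simp: normal_hopf_subalgebra_def hopf_subalgebra_def)
    ultimately show ?thesis using trivial_images[of A] by simp
  qed
  then show "simple_hopf_algebra H" using hopf_H by (simp add: simple_hopf_algebra_def)
qed

end

section \<open>Twists from Hopf cocycles\<close>

locale fun_cocycle = group G for G :: "('a, 'm) monoid_scheme" (structure) +
  fixes \<sigma> :: "('a \<Rightarrow> 'k::field) \<Rightarrow> ('a \<Rightarrow> 'k) \<Rightarrow> 'k"
  assumes finG: "finite (carrier G)"
    and sig: "hopf_2cocycle (fun_alg G) \<sigma>"
begin

abbreviation "CG \<equiv> carrier G"
abbreviation "s \<equiv> (\<lambda>g h. \<sigma> (delta g) (delta h))"

lemma basis_fun [simp]: "basis (fun_alg G) = CG"
  by (simp add: fun_alg_def)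

lemma sig_bilin: "bilinear_on fscale (*) (coord_space CG) \<sigma>"
  using sig by (simp add: hopf_2cocycle_def)

lemma bilin_0:
  assumes "bilinear_on fscale (*) (coord_space CG) \<tau>" "f \<in> coord_space CG"
  shows "\<tau> 0 f = (0 :: 'k)" "\<tau> f 0 = 0"
proof -
  have "\<tau> (0 + 0) f = \<tau> 0 f + \<tau> 0 f" "\<tau> f (0 + 0) = \<tau> f 0 + \<tau> f 0"
    using assms coord_space_closed(1) unfolding bilinear_on_def linear_on_def by blast+
  then show "\<tau> 0 f = (0 :: 'k)" "\<tau> f 0 = 0" by (simp_all only: add_0_left add_cancel_right_right)
qed

lemma bilin_sum:
  assumes b: "bilinear_on fscale (*) (coord_space CG) \<tau>" and "f \<in> coord_space CG" "\<And>i. i \<in> I \<Longrightarrow> h i \<in> coord_space CG"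
  shows "\<tau> f (\<Sum>i\<in>I. fscale (c i) (h i)) = (\<Sum>i\<in>I. c i * (\<tau> f (h i) :: 'k))"
    "\<tau> (\<Sum>i\<in>I. fscale (c i) (h i)) f = (\<Sum>i\<in>I. c i * \<tau> (h i) f)"
proof -
  have sc: "\<tau> f (fscale c x) = c * \<tau> f x" "\<tau> (fscale c x) f = c * \<tau> x f"
    if "x \<in> coord_space CG" for x c
    using b assms(2) that unfolding bilinear_on_def linear_on_def by blast+
  have ad: "\<tau> f (x + y) = \<tau> f x + \<tau> f y" "\<tau> (x + y) f = \<tau> x f + \<tau> y f"
    if "x \<in> coord_space CG" "y \<in> coord_space CG" for x y
    using b assms(2) that unfolding bilinear_on_def linear_on_def by blast+
  show "\<tau> f (\<Sum>i\<in>I. fscale (c i) (h i)) = (\<Sum>i\<in>I. c i * \<tau> f (h i))"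
    "\<tau> (\<Sum>i\<in>I. fscale (c i) (h i)) f = (\<Sum>i\<in>I. c i * \<tau> (h i) f)"
    using assms(3)
    by (induction I rule: infinite_finite_induct)
       (simp_all add: bilin_0[OF b assms(2)] ad sc coord_space_sum coord_space_closed)
qed

lemma sweedler_fun_delta:
  "sweedler (*) (fun_alg G) (delta a) F = (\<Sum>x\<in>CG. \<Sum>y\<in>CG. if x \<otimes> y = a then F (delta x) (delta y) else (0 :: 'k))"
proof -
  have "sweedler (*) (fun_alg G) (delta a) F = (\<Sum>p\<in>CG\<times>CG. case p of (x, y) \<Rightarrow> if x \<otimes> y = a then F (delta x) (delta y) else 0)"
    unfolding sweedler_def by (intro sum.cong) (auto simp: fun_alg_def delta_def)
  then show ?thesis by (simp add: sum.cartesian_product)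
qed

lemma sum_over_products:
  "(\<Sum>a\<in>CG. \<Sum>x\<in>CG. \<Sum>y\<in>CG. if x \<otimes> y = a then F a x y else 0) = (\<Sum>x\<in>CG. \<Sum>y\<in>CG. F (x \<otimes> y) x y)"
  for F :: "'a \<Rightarrow> 'a \<Rightarrow> 'a \<Rightarrow> 'w::comm_monoid_add"
proof -
  have "(\<Sum>a\<in>CG. \<Sum>x\<in>CG. \<Sum>y\<in>CG. if x \<otimes> y = a then F a x y else 0) =
      (\<Sum>x\<in>CG. \<Sum>a\<in>CG. \<Sum>y\<in>CG. if x \<otimes> y = a then F a x y else 0)"
    by (rule sum.swap)
  also have "\<dots> = (\<Sum>x\<in>CG. \<Sum>y\<in>CG. \<Sum>a\<in>CG. if x \<otimes> y = a then F a x y else 0)"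
    by (intro sum.cong refl sum.swap)
  also have "\<dots> = (\<Sum>x\<in>CG. \<Sum>y\<in>CG. F (x \<otimes> y) x y)"
    using finG by (intro sum.cong refl) (simp add: sum.delta)
  finally show ?thesis .
qed

text \<open>Summing over \<open>a\<close>, \<open>b\<close> and all their factorizations is summing
  freely over the factors. \<open>K\<close> is an additive slot, instantiated by placing a
  coefficient at a group element.\<close>

lemma sum_over_products2:
  assumes K: "\<And>a b x y. K a b (x + y) = K a b x + (K a b y :: 'w::comm_monoid_add)" "\<And>a b. K a b 0 = 0"
  shows "(\<Sum>a\<in>CG. \<Sum>b\<in>CG. K a b (\<Sum>x\<in>CG. \<Sum>y\<in>CG. if x \<otimes> y = a then
        \<Sum>z\<in>CG. \<Sum>w\<in>CG. if z \<otimes> w = b then V x y z w else 0 else (0 :: 'v::comm_monoid_add))) =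
    (\<Sum>x\<in>CG. \<Sum>y\<in>CG. \<Sum>z\<in>CG. \<Sum>w\<in>CG. K (x \<otimes> y) (z \<otimes> w) (V x y z w))"
proof -
  have Ks: "K a b (sum f I) = (\<Sum>i\<in>I. K a b (f i))" for a b and f :: "'a \<Rightarrow> 'v" and I
    by (rule linear_sum_map[of "K a b"]) (simp_all add: K)
  have Kif: "K a b (if P then c else 0) = (if P then K a b c else 0)" for a b P c by (simp add: K)
  have "(\<Sum>a\<in>CG. \<Sum>b\<in>CG. K a b (\<Sum>x\<in>CG. \<Sum>y\<in>CG. if x \<otimes> y = a then
        \<Sum>z\<in>CG. \<Sum>w\<in>CG. if z \<otimes> w = b then V x y z w else 0 else 0)) =
    (\<Sum>a\<in>CG. \<Sum>x\<in>CG. \<Sum>y\<in>CG. if x \<otimes> y = a then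
        \<Sum>b\<in>CG. \<Sum>z\<in>CG. \<Sum>w\<in>CG. if z \<otimes> w = b then K a b (V x y z w) else 0 else 0)"
  proof (rule sum.cong[OF refl])
    fix a
    have "(\<Sum>b\<in>CG. K a b (\<Sum>x\<in>CG. \<Sum>y\<in>CG. if x \<otimes> y = a then
        \<Sum>z\<in>CG. \<Sum>w\<in>CG. if z \<otimes> w = b then V x y z w else 0 else 0)) =
      (\<Sum>b\<in>CG. \<Sum>x\<in>CG. \<Sum>y\<in>CG. if x \<otimes> y = a then
        \<Sum>z\<in>CG. \<Sum>w\<in>CG. if z \<otimes> w = b then K a b (V x y z w) else 0 else 0)"
      by (simp only: Ks Kif)
    also have "\<dots> = (\<Sum>x\<in>CG. \<Sum>b\<in>CG. \<Sum>y\<in>CG. if x \<otimes> y = a then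
        \<Sum>z\<in>CG. \<Sum>w\<in>CG. if z \<otimes> w = b then K a b (V x y z w) else 0 else 0)"
      by (rule sum.swap)
    also have "\<dots> = (\<Sum>x\<in>CG. \<Sum>y\<in>CG. \<Sum>b\<in>CG. if x \<otimes> y = a then
        \<Sum>z\<in>CG. \<Sum>w\<in>CG. if z \<otimes> w = b then K a b (V x y z w) else 0 else 0)"
      by (intro sum.cong refl sum.swap)
    also have "\<dots> = (\<Sum>x\<in>CG. \<Sum>y\<in>CG. if x \<otimes> y = a then
        \<Sum>b\<in>CG. \<Sum>z\<in>CG. \<Sum>w\<in>CG. if z \<otimes> w = b then K a b (V x y z w) else 0 else 0)"
      by (intro sum.cong refl) auto
    finally show "(\<Sum>b\<in>CG. K a b (\<Sum>x\<in>CG. \<Sum>y\<in>CG. if x \<otimes> y = a then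
        \<Sum>z\<in>CG. \<Sum>w\<in>CG. if z \<otimes> w = b then V x y z w else 0 else 0)) =
      (\<Sum>x\<in>CG. \<Sum>y\<in>CG. if x \<otimes> y = a then
        \<Sum>b\<in>CG. \<Sum>z\<in>CG. \<Sum>w\<in>CG. if z \<otimes> w = b then K a b (V x y z w) else 0 else 0)" .
  qed
  also have "\<dots> = (\<Sum>x\<in>CG. \<Sum>y\<in>CG. \<Sum>b\<in>CG. \<Sum>z\<in>CG. \<Sum>w\<in>CG. if z \<otimes> w = b then K (x \<otimes> y) b (V x y z w) else 0)"
    by (rule sum_over_products)
  also have "\<dots> = (\<Sum>x\<in>CG. \<Sum>y\<in>CG. \<Sum>z\<in>CG. \<Sum>w\<in>CG. K (x \<otimes> y) (z \<otimes> w) (V x y z w))"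
    by (intro sum.cong refl sum_over_products)
  finally show ?thesis .
qed

definition tw where "tw \<tau> = (\<lambda>(g, h). if g \<in> CG \<and> h \<in> CG then \<tau> (delta g) (delta h) else (0 :: 'k))"

lemma tw_vec: "tw \<tau> \<in> coord_space (CG \<times> CG)"
  by (auto simp: tw_def coord_space_def)

lemma twist_of_cocycle_eq: "twist_of_cocycle G \<sigma> = tw \<sigma>"
proof -
  have "tw \<sigma> = (\<Sum>p\<in>CG\<times>CG. fscale (tw \<sigma> p) (delta p))"
    using finG by (intro coord_expand tw_vec) auto
  also have "\<dots> = (\<Sum>g\<in>CG. \<Sum>h\<in>CG. fscale (\<sigma> (delta g) (delta h)) (tensor (delta g) (delta h)))"
  proof -
    have "tensor (delta a) (delta b) = (delta (a, b) :: 'a \<times> 'a \<Rightarrow> 'k)" for a b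
      by (auto simp: tensor_def delta_def fun_eq_iff)
    then show ?thesis unfolding sum.cartesian_product
      by (intro sum.cong refl) (auto simp: tw_def)
  qed
  finally show ?thesis by (simp add: twist_of_cocycle_def)
qed

end

locale fun_cocycle_emb = fun_cocycle G \<sigma>
  for G :: "('a, 'm) monoid_scheme" (structure) and \<sigma> :: "('a \<Rightarrow> 'k::field_char_0) \<Rightarrow> ('a \<Rightarrow> 'k) \<Rightarrow> 'k" +
  fixes emb :: "'a \<Rightarrow> 'g::group_add" and chi :: "'g \<Rightarrow> 'k"
  assumes emb_inj: "inj_on emb (carrier G)"
    and emb_mult: "x \<in> carrier G \<Longrightarrow> y \<in> carrier G \<Longrightarrow> emb (x \<otimes> y) = emb x + emb y"
    and chi_add: "chi (a + b) = chi a * chi b"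
    and chi_sq: "chi a * chi a = 1"
begin

abbreviation "embp \<equiv> map_prod emb emb"
abbreviation tot :: "('a \<times> 'a \<Rightarrow> 'k) \<Rightarrow> 'g \<times> 'g \<Rightarrow>\<^sub>0 'k" where "tot \<equiv> embv (CG \<times> CG) embp"

lemma to2_tw: "tot (tw \<tau>) = (\<Sum>x\<in>CG. \<Sum>z\<in>CG. sg (emb x, emb z) (\<tau> (delta x) (delta z)))"
  unfolding embv_def sum.cartesian_product by (intro sum.cong refl) (auto simp: tw_def)

lemma emb_one: "emb \<one> = 0"
  using emb_mult[of \<one> \<one>] add_left_imp_eq[of "emb \<one>" "emb \<one>" 0] by simp

lemma sg_sum: "sg a (sum f I) = (\<Sum>i\<in>I. sg a (f i :: 'k))" for a :: 'h
  by (rule linear_sum_map[of "sg a"]) (simp_all add: single_add)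

text \<open>The coefficient of the product at \<open>(a, b)\<close> is the convolution of the two
  forms at the basis vectors of \<open>a\<close> and \<open>b\<close>, because the coproduct of
  \<open>delta a\<close> runs over the factorizations of \<open>a\<close>.\<close>

lemma tw_inverse:
  assumes conv: "\<And>f g. f \<in> coord_space CG \<Longrightarrow> g \<in> coord_space CG \<Longrightarrow>
      sweedler (*) (fun_alg G) f (\<lambda>h1 h2. sweedler (*) (fun_alg G) g (\<lambda>g1 g2. \<tau> h1 g1 * \<tau>' h2 g2)) =
        bcounit (fun_alg G) f * bcounit (fun_alg G) g"
  shows "tot (tw \<tau>) * tot (tw \<tau>') = 1"
proof -
  let ?V = "\<lambda>x y z w. \<tau> (delta x) (delta z) * \<tau>' (delta y) (delta w)"
  have val: "(\<Sum>x\<in>CG. \<Sum>y\<in>CG. if x \<otimes> y = a then \<Sum>z\<in>CG. \<Sum>w\<in>CG. if z \<otimes> w = b then ?V x y z w else 0 else 0)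
      = (if a = \<one> \<and> b = \<one> then 1 else 0)" if "a \<in> CG" "b \<in> CG" for a b
  proof -
    have "bcounit (fun_alg G) (delta a) * bcounit (fun_alg G) (delta b) = (if a = \<one> \<and> b = \<one> then 1 else (0 :: 'k))"
      by (auto simp: fun_alg_def delta_def)
    then show ?thesis
      using conv[OF coord_space_closed(4)[OF that(1)] coord_space_closed(4)[OF that(2)]]
      by (simp only: sweedler_fun_delta)
  qed
  have "tot (tw \<tau>) * tot (tw \<tau>') =
    (\<Sum>x\<in>CG. \<Sum>z\<in>CG. \<Sum>y\<in>CG. \<Sum>w\<in>CG. sg (emb (x \<otimes> y), emb (z \<otimes> w)) (?V x y z w))"
    unfolding to2_tw
    by (simp only: sum_distrib_right) (simp add: sum_distrib_left mult_single emb_mult)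
  also have "\<dots> = (\<Sum>x\<in>CG. \<Sum>y\<in>CG. \<Sum>z\<in>CG. \<Sum>w\<in>CG. sg (emb (x \<otimes> y), emb (z \<otimes> w)) (?V x y z w))"
    by (intro sum.cong refl sum.swap)
  also have "\<dots> = (\<Sum>a\<in>CG. \<Sum>b\<in>CG. sg (emb a, emb b) (\<Sum>x\<in>CG. \<Sum>y\<in>CG. if x \<otimes> y = a then
      \<Sum>z\<in>CG. \<Sum>w\<in>CG. if z \<otimes> w = b then ?V x y z w else 0 else 0))"
    by (rule sum_over_products2[symmetric]) (simp_all add: single_add)
  also have "\<dots> = (\<Sum>a\<in>CG. \<Sum>b\<in>CG. if a = \<one> \<and> b = \<one> then 1 else 0)"
    by (intro sum.cong refl) (simp add: val emb_one zero_prod_def[symmetric])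
  also have "\<dots> = (\<Sum>a\<in>CG. if a = \<one> then 1 else 0)"
    using finG by (intro sum.cong refl) auto
  also have "\<dots> = 1" using finG by simp
  finally show ?thesis .
qed

text \<open>The basis vectors of the function algebra are orthogonal idempotents, so the products
  inside the Hopf cocycle condition contribute only for \<open>y = w\<close>.\<close>

lemma cocycle_id:
  assumes "a \<in> CG" "b \<in> CG" "c \<in> CG"
  shows "(\<Sum>x\<in>CG. \<Sum>y\<in>CG. if x \<otimes> y = a then \<Sum>z\<in>CG. \<Sum>w\<in>CG. if z \<otimes> w = b then
        (if y = w then s x z * s y c else 0) else 0 else 0) =
    (\<Sum>x\<in>CG. \<Sum>y\<in>CG. if x \<otimes> y = b then \<Sum>z\<in>CG. \<Sum>w\<in>CG. if z \<otimes> w = c then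
        (if y = w then s x z * s a y else 0) else 0 else 0)"
proof -
  have dm: "bmul (fun_alg G) (delta y) (delta w) = (if y = w then delta y else (0 :: 'a \<Rightarrow> 'k))" for y w
    by (auto simp: fun_alg_def delta_def fun_eq_iff)
  have z: "\<sigma> 0 (delta c) = 0" "\<sigma> (delta a) 0 = 0"
    by (rule bilin_0(1)[OF sig_bilin coord_space_closed(4)[OF assms(3)]]
        bilin_0(2)[OF sig_bilin coord_space_closed(4)[OF assms(1)]])+
  have "sweedler (*) (fun_alg G) (delta a) (\<lambda>h1 h2. sweedler (*) (fun_alg G) (delta b)
       (\<lambda>g1 g2. \<sigma> h1 g1 * \<sigma> (bmul (fun_alg G) h2 g2) (delta c))) =
    sweedler (*) (fun_alg G) (delta b) (\<lambda>g1 g2. sweedler (*) (fun_alg G) (delta c)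
       (\<lambda>l1 l2. \<sigma> g1 l1 * \<sigma> (delta a) (bmul (fun_alg G) g2 l2)))"
    using sig coord_space_closed(4)[OF assms(1)] coord_space_closed(4)[OF assms(2)] coord_space_closed(4)[OF assms(3)]
    unfolding hopf_2cocycle_def basis_fun by blast
  then show ?thesis
    by (simp only: sweedler_fun_delta dm if_distrib[of "\<lambda>f. \<sigma> f (delta c)"] if_distrib[of "\<sigma> (delta a)"] z
       if_distrib[of "\<lambda>t. _ * t"] mult_zero_right)
qed

lemma sum_perm_left: "(\<Sum>c\<in>CG. \<Sum>x\<in>CG. \<Sum>y\<in>CG. \<Sum>z\<in>CG. f c x y z) = (\<Sum>x\<in>CG. \<Sum>z\<in>CG. \<Sum>y\<in>CG. \<Sum>c\<in>CG. f c x y z)"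
  for f :: "'a \<Rightarrow> 'a \<Rightarrow> 'a \<Rightarrow> 'a \<Rightarrow> 'w::comm_monoid_add"
  unfolding sum.cartesian_product
  by (rule sum.reindex_bij_witness[of _ "\<lambda>(x, z, y, c). (c, x, y, z)" "\<lambda>(c, x, y, z). (x, z, y, c)"]) auto

lemma sum_perm_right: "(\<Sum>a\<in>CG. \<Sum>x\<in>CG. \<Sum>y\<in>CG. \<Sum>z\<in>CG. f a x y z) = (\<Sum>x\<in>CG. \<Sum>z\<in>CG. \<Sum>a\<in>CG. \<Sum>y\<in>CG. f a x y z)"
  for f :: "'a \<Rightarrow> 'a \<Rightarrow> 'a \<Rightarrow> 'a \<Rightarrow> 'w::comm_monoid_add"
  unfolding sum.cartesian_product
  by (rule sum.reindex_bij_witness[of _ "\<lambda>(x, z, a, y). (a, x, y, z)" "\<lambda>(a, x, y, z). (x, z, a, y)"]) auto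

text \<open>The coefficients of the two sides at \<open>(a, b, c)\<close> are the two sides of the
  Hopf cocycle condition at the corresponding basis vectors; the rest is reordering of sums.\<close>

lemma tw_cocycle: "in12 (tot (tw \<sigma>)) * dup12 (tot (tw \<sigma>)) = in23 (tot (tw \<sigma>)) * dup23 (tot (tw \<sigma>))"
proof -
  let ?L = "\<lambda>a b c. \<Sum>x\<in>CG. \<Sum>y\<in>CG. if x \<otimes> y = a then \<Sum>z\<in>CG. \<Sum>w\<in>CG. if z \<otimes> w = b then
        (if y = w then s x z * s y c else 0) else 0 else 0"
  let ?R = "\<lambda>a b c. \<Sum>x\<in>CG. \<Sum>y\<in>CG. if x \<otimes> y = b then \<Sum>z\<in>CG. \<Sum>w\<in>CG. if z \<otimes> w = c then
        (if y = w then s x z * s a y else 0) else 0 else 0"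
  have sgif: "sg a (if P then c else 0) = (if P then sg a c else 0)" for a :: "'g \<times> 'g \<times> 'g" and P and c :: 'k by simp
  have "in12 (tot (tw \<sigma>)) * dup12 (tot (tw \<sigma>)) =
    (\<Sum>x\<in>CG. \<Sum>z\<in>CG. \<Sum>y\<in>CG. \<Sum>c\<in>CG. sg (emb (x \<otimes> y), emb (z \<otimes> y), emb c) (s x z * s y c))"
    unfolding to2_tw
    by (simp only: klin_sum[OF klin_wmap] sum_distrib_right) (simp add: sum_distrib_left mult_single emb_mult)
  also have "\<dots> = (\<Sum>c\<in>CG. \<Sum>x\<in>CG. \<Sum>y\<in>CG. \<Sum>z\<in>CG. sg (emb (x \<otimes> y), emb (z \<otimes> y), emb c) (s x z * s y c))"
    by (rule sum_perm_left[symmetric])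
  also have "\<dots> = (\<Sum>c\<in>CG. \<Sum>x\<in>CG. \<Sum>y\<in>CG. \<Sum>z\<in>CG. \<Sum>w\<in>CG.
      sg (emb (x \<otimes> y), emb (z \<otimes> w), emb c) (if y = w then s x z * s y c else 0))"
    using finG by (intro sum.cong refl) (simp add: sgif sum.delta)
  also have "\<dots> = (\<Sum>c\<in>CG. \<Sum>a\<in>CG. \<Sum>b\<in>CG. sg (emb a, emb b, emb c) (?L a b c))"
    by (intro sum.cong refl sum_over_products2[symmetric]) (simp_all add: single_add)
  also have "\<dots> = (\<Sum>c\<in>CG. \<Sum>a\<in>CG. \<Sum>b\<in>CG. sg (emb a, emb b, emb c) (?R a b c))"
    by (intro sum.cong refl) (simp only: cocycle_id)
  also have "\<dots> = (\<Sum>a\<in>CG. \<Sum>c\<in>CG. \<Sum>b\<in>CG. sg (emb a, emb b, emb c) (?R a b c))"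
    by (rule sum.swap)
  also have "\<dots> = (\<Sum>a\<in>CG. \<Sum>b\<in>CG. \<Sum>c\<in>CG. sg (emb a, emb b, emb c) (?R a b c))"
    by (intro sum.cong refl sum.swap)
  also have "\<dots> = (\<Sum>a\<in>CG. \<Sum>x\<in>CG. \<Sum>y\<in>CG. \<Sum>z\<in>CG. \<Sum>w\<in>CG.
      sg (emb a, emb (x \<otimes> y), emb (z \<otimes> w)) (if y = w then s x z * s a y else 0))"
    by (intro sum.cong refl sum_over_products2) (simp_all add: single_add)
  also have "\<dots> = (\<Sum>a\<in>CG. \<Sum>x\<in>CG. \<Sum>y\<in>CG. \<Sum>z\<in>CG. sg (emb a, emb (x \<otimes> y), emb (z \<otimes> y)) (s x z * s a y))"
    using finG by (intro sum.cong refl) (simp add: sgif sum.delta)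
  also have "\<dots> = (\<Sum>x\<in>CG. \<Sum>z\<in>CG. \<Sum>a\<in>CG. \<Sum>y\<in>CG. sg (emb a, emb (x \<otimes> y), emb (z \<otimes> y)) (s x z * s a y))"
    by (rule sum_perm_right)
  also have "\<dots> = in23 (tot (tw \<sigma>)) * dup23 (tot (tw \<sigma>))"
    unfolding to2_tw
    by (simp only: klin_sum[OF klin_wmap] sum_distrib_right) (simp add: sum_distrib_left mult_single emb_mult)
  finally show ?thesis .
qed

lemma bone_fun: "bone (fun_alg G) = (\<Sum>h\<in>CG. fscale 1 (delta h))"
proof -
  have "bone (fun_alg G) = (\<Sum>h\<in>CG. fscale (bone (fun_alg G) h) (delta h))"
    by (rule coord_expand[OF finG]) (auto simp: fun_alg_def coord_space_def)
  also have "\<dots> = (\<Sum>h\<in>CG. fscale 1 (delta h))"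
    by (intro sum.cong refl) (simp add: fun_alg_def)
  finally show ?thesis .
qed

lemma tw_counit: "mp fst (tot (tw \<sigma>)) = 1" "mp snd (tot (tw \<sigma>)) = 1"
proof -
  have norm: "(\<Sum>h\<in>CG. s g h) = (if g = \<one> then 1 else 0)" "(\<Sum>h\<in>CG. s h g) = (if g = \<one> then 1 else 0)" if g: "g \<in> CG" for g
  proof -
    have "\<sigma> (delta g) (bone (fun_alg G)) = bcounit (fun_alg G) (delta g)"
      "\<sigma> (bone (fun_alg G)) (delta g) = bcounit (fun_alg G) (delta g)"
      using sig coord_space_closed(4)[OF g] by (auto simp: hopf_2cocycle_def)
    moreover have "bcounit (fun_alg G) (delta g) = (if g = \<one> then 1 else (0 :: 'k))"
      by (auto simp: fun_alg_def delta_def)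
    ultimately have "(\<Sum>h\<in>CG. 1 * s g h) = (if g = \<one> then 1 else 0)" "(\<Sum>h\<in>CG. 1 * s h g) = (if g = \<one> then 1 else 0)"
      using bilin_sum[OF sig_bilin coord_space_closed(4)[OF g], of CG delta "\<lambda>_. 1"] coord_space_closed(4)
      unfolding bone_fun by (metis (no_types, lifting))+
    then show "(\<Sum>h\<in>CG. s g h) = (if g = \<one> then 1 else 0)" "(\<Sum>h\<in>CG. s h g) = (if g = \<one> then 1 else 0)"
      by (simp_all only: mult_1)
  qed
  have "mp fst (tot (tw \<sigma>)) = (\<Sum>x\<in>CG. sg (emb x) (\<Sum>z\<in>CG. s x z))"
    unfolding to2_tw by (simp add: klin_sum[OF klin_wmap] sg_sum)
  also have "\<dots> = (\<Sum>x\<in>CG. if x = \<one> then 1 else 0)"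
    by (intro sum.cong refl) (simp add: norm emb_one)
  finally show "mp fst (tot (tw \<sigma>)) = 1" using finG by simp
  have "mp snd (tot (tw \<sigma>)) = (\<Sum>x\<in>CG. \<Sum>z\<in>CG. sg (emb z) (s x z))"
    unfolding to2_tw by (simp add: klin_sum[OF klin_wmap])
  also have "\<dots> = (\<Sum>z\<in>CG. \<Sum>x\<in>CG. sg (emb z) (s x z))"
    by (rule sum.swap)
  also have "\<dots> = (\<Sum>z\<in>CG. if z = \<one> then 1 else 0)"
    by (intro sum.cong refl) (simp add: norm emb_one flip: sg_sum)
  finally show "mp snd (tot (tw \<sigma>)) = 1" using finG by simp
qed

lemma group_twist_of_cocycle:
  assumes "convolution_invertible (fun_alg G) \<sigma>"
  shows "\<exists>Ji. group_twist G emb chi (twist_of_cocycle G \<sigma>) Ji"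
proof -
  obtain \<tau> where \<tau>: "\<And>f g. f \<in> coord_space CG \<Longrightarrow> g \<in> coord_space CG \<Longrightarrow>
      sweedler (*) (fun_alg G) f (\<lambda>h1 h2. sweedler (*) (fun_alg G) g (\<lambda>g1 g2. \<sigma> h1 g1 * \<tau> h2 g2)) =
        bcounit (fun_alg G) f * bcounit (fun_alg G) g"
    "\<And>f g. f \<in> coord_space CG \<Longrightarrow> g \<in> coord_space CG \<Longrightarrow>
      sweedler (*) (fun_alg G) f (\<lambda>h1 h2. sweedler (*) (fun_alg G) g (\<lambda>g1 g2. \<tau> h1 g1 * \<sigma> h2 g2)) =
        bcounit (fun_alg G) f * bcounit (fun_alg G) g"
    using assms by (auto simp: convolution_invertible_def)
  have e: "emb (inv x) = - emb x" if "x \<in> CG" for x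
    using emb_mult[of x "inv x"] that by (simp add: emb_one) (metis minus_unique)
  have "group_twist G emb chi (tw \<sigma>) (tw \<tau>)"
  proof
    show "a + b \<in> emb ` CG" if "a \<in> emb ` CG" "b \<in> emb ` CG" for a b
      using that by (auto simp flip: emb_mult)
    show "- a \<in> emb ` CG" if "a \<in> emb ` CG" for a
      using that by (auto simp flip: e)
    show "0 \<in> emb ` CG" using emb_one by (metis imageI one_closed)
    have "embp ` (CG \<times> CG) = emb ` CG \<times> emb ` CG" by auto
    then show "tot (tw \<sigma>) \<in> supp (emb ` CG \<times> emb ` CG)" "tot (tw \<tau>) \<in> supp (emb ` CG \<times> emb ` CG)"
      using embv_supp[of "CG \<times> CG" embp] by auto
    show "tot (tw \<sigma>) * tot (tw \<tau>) = 1" by (rule tw_inverse[OF \<tau>(1)])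
    show "tot (tw \<tau>) * tot (tw \<sigma>) = 1" by (rule tw_inverse[OF \<tau>(2)])
  qed (auto simp: finG emb_inj emb_mult chi_add chi_sq tw_vec tw_counit tw_cocycle)
  then show ?thesis unfolding twist_of_cocycle_eq by blast
qed

definition "chiv = (\<lambda>g. if g \<in> CG then chi (emb g) else 0)"

text \<open>The coefficients of \<open>u\<close> and \<open>v\<close> at \<open>g\<close> are
  \<open>\<sigma> (delta g) chiv\<close> and \<open>\<sigma> chiv (delta g)\<close>, the character
  being the sum of its values times the basis vectors.\<close>

lemma u_eq_v_iff:
  assumes "group_twist G emb chi (twist_of_cocycle G \<sigma>) Ji"
  shows "twist.u chi (tot (twist_of_cocycle G \<sigma>)) = twist.v chi (tot (twist_of_cocycle G \<sigma>)) \<longleftrightarrow>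
    (\<forall>g\<in>CG. \<sigma> (delta g) chiv = \<sigma> chiv (delta g))"
proof -
  interpret group_twist G emb chi "twist_of_cocycle G \<sigma>" Ji by (rule assms)
  have "chiv \<in> coord_space CG" by (auto simp: chiv_def coord_space_def)
  from coord_expand[OF finG this] have "chiv = (\<Sum>h\<in>CG. fscale (chiv h) (delta h))" .
  also have "\<dots> = (\<Sum>h\<in>CG. fscale (chi (emb h)) (delta h))"
    by (intro sum.cong refl) (simp add: chiv_def)
  finally have chiv: "chiv = (\<Sum>h\<in>CG. fscale (chi (emb h)) (delta h))" .
  have sig1: "\<sigma> (delta g) chiv = (\<Sum>h\<in>CG. chi (emb h) * s g h)" "\<sigma> chiv (delta g) = (\<Sum>h\<in>CG. chi (emb h) * s h g)"
    if "g \<in> CG" for g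
    unfolding chiv by (rule bilin_sum[OF sig_bilin]; auto intro: coord_space_closed that)+
  have "u = (\<Sum>g\<in>CG. sg (emb g) (\<sigma> (delta g) chiv))"
    unfolding u_def cR_def unfolding twist_of_cocycle_eq to2_tw
    by (simp add: klin_sum[OF klin_wmap] sig1 sg_sum mult.commute)
  then have u: "u = embv CG emb (\<lambda>g. if g \<in> CG then \<sigma> (delta g) chiv else 0)"
    unfolding embv_def by (simp cong: sum.cong)
  have "v = (\<Sum>x\<in>CG. \<Sum>z\<in>CG. sg (emb z) (s x z * chi (emb x)))"
    unfolding v_def cL_def unfolding twist_of_cocycle_eq to2_tw
    by (simp add: klin_sum[OF klin_wmap])
  also have "\<dots> = (\<Sum>z\<in>CG. \<Sum>x\<in>CG. sg (emb z) (s x z * chi (emb x)))"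
    by (rule sum.swap)
  also have "\<dots> = (\<Sum>g\<in>CG. sg (emb g) (\<sigma> chiv (delta g)))"
    by (intro sum.cong refl) (simp add: sig1 mult.commute flip: sg_sum)
  finally have v: "v = embv CG emb (\<lambda>g. if g \<in> CG then \<sigma> chiv (delta g) else 0)"
    unfolding embv_def by (simp cong: sum.cong)
  show ?thesis
  proof
    assume "u = v"
    then have "(\<lambda>g. if g \<in> CG then \<sigma> (delta g) chiv else 0) = (\<lambda>g. if g \<in> CG then \<sigma> chiv (delta g) else 0)"
      unfolding u v by (intro embv_inj[OF finG emb_inj]) (auto simp: coord_space_def)
    then show "\<forall>g\<in>CG. \<sigma> (delta g) chiv = \<sigma> chiv (delta g)" by (metis (no_types, lifting))
  next
    assume "\<forall>g\<in>CG. \<sigma> (delta g) chiv = \<sigma> chiv (delta g)"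
    then show "u = v" unfolding u v by (intro arg_cong[of _ _ "embv CG emb"] ext) auto
  qed
qed

end

section \<open>The Galois object\<close>

locale twisted_group_alg = group K for K :: "('a, 'm) monoid_scheme" (structure) +
  fixes \<alpha> :: "'a \<Rightarrow> 'a \<Rightarrow> 'k::field"
  assumes finK: "finite (carrier K)"
    and cocyc: "group_2cocycle K \<alpha>"
begin

abbreviation "SK \<equiv> carrier K"
abbreviation "V \<equiv> coord_space SK"
abbreviation m :: "('a \<Rightarrow> 'k) \<Rightarrow> ('a \<Rightarrow> 'k) \<Rightarrow> 'a \<Rightarrow> 'k" where "m \<equiv> twisted_mul K \<alpha>"
abbreviation "act1 \<equiv> twisted_action K \<alpha>"
abbreviation "one1 \<equiv> twisted_one K \<alpha>"

lemma cocycle_nonzero: "s \<in> SK \<Longrightarrow> t \<in> SK \<Longrightarrow> \<alpha> s t \<noteq> 0"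
  and coc: "s \<in> SK \<Longrightarrow> t \<in> SK \<Longrightarrow> r \<in> SK \<Longrightarrow> \<alpha> s t * \<alpha> (s \<otimes> t) r = \<alpha> t r * \<alpha> s (t \<otimes> r)"
  using cocyc by (auto simp: group_2cocycle_def)

text \<open>The cocycle is not normalized, but its identity with two arguments equal to the unit
  makes its values against the unit constant, so \<open>delta \<one>\<close> is a scalar multiple of
  the identity.\<close>

lemma cocycle_one: "s \<in> SK \<Longrightarrow> \<alpha> \<one> s = \<alpha> \<one> \<one>" "s \<in> SK \<Longrightarrow> \<alpha> s \<one> = \<alpha> \<one> \<one>"
  using coc[of \<one> \<one> s] coc[of s \<one> \<one>] cocycle_nonzero[of \<one> s] cocycle_nonzero[of s \<one>] by auto

lemma cocycle_inv_swap: "s \<in> SK \<Longrightarrow> \<alpha> (inv s) s = \<alpha> s (inv s)"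
  using coc[of s "inv s" s] cocycle_nonzero[of \<one> \<one>] cocycle_one(1)[of s] cocycle_one(2)[of s] by simp

lemma m_add: "m (u + u') v = m u v + m u' v" "m u (v + v') = m u v + m u v'"
  and m_fscale: "m (fscale c u) v = fscale c (m u v)" "m u (fscale c v) = fscale c (m u v)"
  by (rule ext; simp add: twisted_mul_def sum_fun_eval fscale_def algebra_simps sum.distrib sum_distrib_left)+

lemma m_0: "m 0 v = 0" "m u 0 = 0"
proof -
  have z: "fscale 0 f = 0" for f :: "'a \<Rightarrow> 'k" by (simp add: fscale_def fun_eq_iff)
  have "m (fscale 0 0) v = fscale 0 (m 0 v)" "m u (fscale 0 0) = fscale 0 (m u 0)"
    by (rule m_fscale)+
  then show "m 0 v = 0" "m u 0 = 0" by (simp_all only: z)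
qed

lemma m_V: "m u v \<in> V"
  unfolding twisted_mul_def by (intro coord_space_sum coord_space_closed) auto

lemma m_delta: "s \<in> SK \<Longrightarrow> t \<in> SK \<Longrightarrow> m (delta s) (delta t) = fscale (\<alpha> s t) (delta (s \<otimes> t))"
proof -
  assume st: "s \<in> SK" "t \<in> SK"
  have "m (delta s) (delta t) = (\<Sum>x\<in>SK. \<Sum>y\<in>SK. if y = t then (if x = s then fscale (\<alpha> s t) (delta (s \<otimes> t)) else 0) else 0)"
    unfolding twisted_mul_def by (intro sum.cong refl) (auto simp: delta_def fscale_def fun_eq_iff)
  also have "\<dots> = fscale (\<alpha> s t) (delta (s \<otimes> t))" using st finK by (simp only: sum.delta) simp
  finally show ?thesis .
qed

lemma V_induct [consumes 1, case_names delta add scale]: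
  assumes "u \<in> V" "\<And>s. s \<in> SK \<Longrightarrow> P (delta s)" "\<And>x y. P x \<Longrightarrow> P y \<Longrightarrow> P (x + y)" "\<And>c x. P x \<Longrightarrow> P (fscale c x)"
  shows "P u"
proof -
  have P0: "P 0"
  proof -
    have "P (fscale 0 (delta \<one>))" using assms(2,4) by blast
    moreover have "fscale 0 (delta \<one>) = (0 :: 'a \<Rightarrow> 'k)" by (simp add: fscale_def fun_eq_iff)
    ultimately show ?thesis by simp
  qed
  have "P (\<Sum>s\<in>I. fscale (u s) (delta s))" if "I \<subseteq> SK" for I
  proof -
    have "finite I" using that finK finite_subset by blast
    then show ?thesis using that
    proof (induction I rule: finite_induct)
      case (insert x I)
      then have "P (fscale (u x) (delta x) + (\<Sum>s\<in>I. fscale (u s) (delta s)))"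
        by (intro assms(3)[OF assms(4)[OF assms(2)]]) auto
      then show ?case by (simp only: sum.insert[OF insert.hyps])
    qed (simp only: sum.empty P0)
  qed
  from this[of SK] show ?thesis using coord_expand[OF finK assms(1)] by simp
qed

lemma tm_assoc: assumes "u \<in> V" "v \<in> V" "w \<in> V" shows "m (m u v) w = m u (m v w)"
  using assms(1)
proof (induction rule: V_induct)
  case (delta s)
  show ?case using assms(2)
  proof (induction rule: V_induct)
    case (delta t)
    show ?case using assms(3)
    proof (induction rule: V_induct)
      case (delta r)
      have "fscale (\<alpha> s t) (fscale (\<alpha> (s \<otimes> t) r) x) = fscale (\<alpha> t r) (fscale (\<alpha> s (t \<otimes> r)) x)" for x :: "'a \<Rightarrow> 'k"
        using coc[OF \<open>s \<in> SK\<close> \<open>t \<in> SK\<close> \<open>r \<in> SK\<close>] by (simp add: fscale_def flip: mult.assoc)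
      then show ?case
        using \<open>s \<in> SK\<close> \<open>t \<in> SK\<close> \<open>r \<in> SK\<close> by (simp add: m_delta m_fscale m_assoc)
    qed (simp_all only: m_add m_fscale)
  qed (simp_all only: m_add m_fscale)
qed (simp_all only: m_add m_fscale)

lemma delta_one: "delta \<one> = fscale (\<alpha> \<one> \<one>) one1"
  using cocycle_nonzero[of \<one> \<one>] by (simp add: twisted_one_def fscale_def fun_eq_iff)

lemma m_one: assumes "u \<in> V" shows "m one1 u = u" "m u one1 = u"
proof -
  have "m one1 u = u \<and> m u one1 = u"
    using assms
  proof (induction rule: V_induct)
    case (delta s)
    then have "m (delta \<one>) (delta s) = fscale (\<alpha> \<one> \<one>) (delta s)" "m (delta s) (delta \<one>) = fscale (\<alpha> \<one> \<one>) (delta s)"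
      using cocycle_one(1)[OF delta] cocycle_one(2)[OF delta] by (simp_all add: m_delta)
    then show ?case
      unfolding twisted_one_def m_fscale using cocycle_nonzero[of \<one> \<one>] by (simp add: fscale_def mult.assoc[symmetric])
  qed (simp_all only: m_add m_fscale)
  then show "m one1 u = u" "m u one1 = u" by auto
qed

lemma delta_inverse:
  assumes s: "s \<in> SK"
  shows "twisted_inv K \<alpha> (delta s) \<in> V" "m (delta s) (twisted_inv K \<alpha> (delta s)) = one1"
    "m (twisted_inv K \<alpha> (delta s)) (delta s) = one1"
proof -
  \<comment> \<open>The product of the basis vectors at \<open>s\<close> and \<open>inv s\<close> is
    \<open>\<alpha> s (inv s)\<close> times \<open>delta \<one>\<close>, which is
    \<open>\<alpha> \<one> \<one>\<close> times the identity; both scalars must be divided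
    out.\<close>
  let ?w = "fscale (inverse (\<alpha> s (inv s) * \<alpha> \<one> \<one>)) (delta (inv s)) :: 'a \<Rightarrow> 'k"
  let ?P = "\<lambda>v. v \<in> V \<and> m (delta s) v = one1 \<and> m v (delta s) = one1"
  have "?P ?w"
  proof (intro conjI)
    show "?w \<in> V" using s by (intro coord_space_closed) auto
    have n: "\<alpha> s (inv s) \<noteq> 0" "\<alpha> \<one> \<one> \<noteq> 0" using s cocycle_nonzero by auto
    have "m (delta s) ?w = fscale (inverse (\<alpha> s (inv s) * \<alpha> \<one> \<one>)) (fscale (\<alpha> s (inv s)) (delta \<one>))"
      using s by (simp only: m_fscale m_delta inv_closed r_inv)
    also have "\<dots> = one1" unfolding twisted_one_def using n by (auto simp: fscale_def)
    finally show "m (delta s) ?w = one1" .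
    have "m ?w (delta s) = fscale (inverse (\<alpha> s (inv s) * \<alpha> \<one> \<one>)) (fscale (\<alpha> s (inv s)) (delta \<one>))"
      using s by (simp only: m_fscale m_delta inv_closed l_inv cocycle_inv_swap)
    also have "\<dots> = one1" unfolding twisted_one_def using n by (auto simp: fscale_def)
    finally show "m ?w (delta s) = one1" .
  qed
  moreover have "v = v'" if "?P v" "?P v'" for v v'
  proof -
    have "v = m (m v' (delta s)) v" using that by (simp add: m_one)
    also have "\<dots> = m v' (m (delta s) v)" using that s by (intro tm_assoc coord_space_closed) auto
    also have "\<dots> = v'" using that by (simp add: m_one)
    finally show ?thesis .
  qed
  ultimately have "?P (THE v. ?P v)" by (intro theI[of ?P ?w]) blast+
  then show "twisted_inv K \<alpha> (delta s) \<in> V" "m (delta s) (twisted_inv K \<alpha> (delta s)) = one1"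
    "m (twisted_inv K \<alpha> (delta s)) (delta s) = one1"
    by (simp_all only: twisted_inv_def)
qed

lemma act1_V: "act1 s u \<in> V"
  unfolding twisted_action_def by (rule m_V)

lemma act1_fscale: "act1 s (fscale c u) = fscale c (act1 s u)"
  unfolding twisted_action_def by (simp only: m_fscale)

text \<open>Multiplying by \<open>delta s\<close> on the right removes the inverse, so statements
  about the action become equations between products.\<close>

lemma act1_iff:
  assumes "s \<in> SK" "u \<in> V" "y \<in> V"
  shows "y = act1 s u \<longleftrightarrow> m y (delta s) = m (delta s) u"
proof
  note d = coord_space_closed(4)[OF assms(1)] and i = delta_inverse[OF assms(1)]
  assume "y = act1 s u"
  then have "m y (delta s) = m (m (delta s) u) (m (twisted_inv K \<alpha> (delta s)) (delta s))"
    unfolding twisted_action_def by (simp only: tm_assoc m_V d i)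
  then show "m y (delta s) = m (delta s) u" by (simp only: i m_one m_V)
next
  note d = coord_space_closed(4)[OF assms(1)] and i = delta_inverse[OF assms(1)]
  assume *: "m y (delta s) = m (delta s) u"
  have "y = m y (m (delta s) (twisted_inv K \<alpha> (delta s)))" using assms by (simp only: i m_one)
  also have "\<dots> = m (m y (delta s)) (twisted_inv K \<alpha> (delta s))" using assms by (simp only: tm_assoc d i)
  finally show "y = act1 s u" unfolding * twisted_action_def .
qed

lemma act1_mult:
  assumes "s \<in> SK" "t \<in> SK" "u \<in> V"
  shows "act1 (s \<otimes> t) u = act1 s (act1 t u)"
proof -
  note d = coord_space_closed(4)[OF assms(1)] coord_space_closed(4)[OF assms(2)]
  let ?z = "act1 t u" and ?y = "act1 s (act1 t u)"
  have z: "m ?z (delta t) = m (delta t) u" using act1_iff[OF assms(2,3) act1_V] by blast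
  have y: "m ?y (delta s) = m (delta s) ?z" using act1_iff[OF assms(1) act1_V act1_V] by blast
  have "m ?y (m (delta s) (delta t)) = m (m ?y (delta s)) (delta t)"
    by (simp only: tm_assoc act1_V d)
  also have "\<dots> = m (delta s) (m (delta t) u)"
    unfolding y by (simp only: tm_assoc act1_V d z)
  also have "\<dots> = m (m (delta s) (delta t)) u"
    using assms(3) by (simp only: tm_assoc d)
  finally have "fscale (\<alpha> s t) (m ?y (delta (s \<otimes> t))) = fscale (\<alpha> s t) (m (delta (s \<otimes> t)) u)"
    using assms by (simp only: m_delta m_fscale)
  then have "m ?y (delta (s \<otimes> t)) = m (delta (s \<otimes> t)) u"
    using cocycle_nonzero[OF assms(1,2)] by (simp add: fscale_def fun_eq_iff)
  then show ?thesis using act1_iff[of "s \<otimes> t" u ?y] assms act1_V by simp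
qed

lemma m_delta_one_comm: "w \<in> V \<Longrightarrow> m w (delta \<one>) = m (delta \<one>) w"
  unfolding delta_one by (simp only: m_fscale m_one)

lemma act1_one: "u \<in> V \<Longrightarrow> act1 \<one> u = u"
  using act1_iff[of \<one> u u] m_delta_one_comm[of u] by simp

lemma m_delta_left: "t \<in> SK \<Longrightarrow> s \<in> SK \<Longrightarrow> m (delta t) w (t \<otimes> s) = \<alpha> t s * w s"
  and m_delta_right: "t \<in> SK \<Longrightarrow> s \<in> SK \<Longrightarrow> m w (delta t) (s \<otimes> t) = \<alpha> s t * w s"
proof -
  assume ts: "t \<in> SK" "s \<in> SK"
  have "m (delta t) w (t \<otimes> s) = (\<Sum>x\<in>SK. \<Sum>y\<in>SK. if x = t then (if y = s then \<alpha> t s * w s else 0) else 0)"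
    unfolding twisted_mul_def sum_fun_eval using ts by (intro sum.cong refl) (auto simp: delta_def fscale_def)
  also have "\<dots> = (\<Sum>x\<in>SK. if x = t then \<alpha> t s * w s else 0)"
    using finK ts by (intro sum.cong refl) auto
  finally show "m (delta t) w (t \<otimes> s) = \<alpha> t s * w s" using finK ts by simp
  have "m w (delta t) (s \<otimes> t) = (\<Sum>x\<in>SK. \<Sum>y\<in>SK. if y = t then (if x = s then \<alpha> s t * w s else 0) else 0)"
    unfolding twisted_mul_def sum_fun_eval using ts by (intro sum.cong refl) (auto simp: delta_def fscale_def)
  also have "\<dots> = (\<Sum>x\<in>SK. if x = s then \<alpha> s t * w s else 0)"
    using finK ts by (intro sum.cong refl) auto
  finally show "m w (delta t) (s \<otimes> t) = \<alpha> s t * w s" using finK ts by simp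
qed

text \<open>For commuting \<open>s\<close> and \<open>t\<close>, comparing coefficients at
  \<open>s \<otimes> t\<close> gives \<open>\<alpha> t s * w s = \<alpha> s t * w s\<close>.
  Non-degeneracy provides, for each \<open>s\<close> other than the unit, some \<open>t\<close> for
  which these two cocycle values differ.\<close>

lemma center_scalar:
  assumes nd: "nondegenerate_cocycle K \<alpha>" and w: "w \<in> V"
    and c: "\<And>t. t \<in> SK \<Longrightarrow> m (delta t) w = m w (delta t)"
  shows "w = fscale (w \<one>) (delta \<one>)"
proof
  fix s
  show "w s = fscale (w \<one>) (delta \<one>) s"
  proof (cases "s \<in> SK \<and> s \<noteq> \<one>")
    case True
    then obtain t where t: "t \<in> SK" "s \<otimes> t = t \<otimes> s" "\<alpha> s t \<noteq> \<alpha> t s"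
      using nd unfolding nondegenerate_cocycle_def by blast
    then have "\<alpha> t s * w s = \<alpha> s t * w s"
      using m_delta_left[of t s w] m_delta_right[of t s w] c[OF t(1)] True by metis
    then have "w s = 0" using t(3) by (metis mult_right_cancel)
    then show ?thesis using True by (simp add: fscale_def delta_def)
  next
    case False
    then consider "s = \<one>" | "s \<notin> SK" "s \<noteq> \<one>" by blast
    then show ?thesis
    proof cases
      case 2
      then have "w s = 0" using w by (simp add: coord_space_def)
      then show ?thesis using 2 by (simp add: fscale_def delta_def)
    qed (simp add: fscale_def delta_def)
  qed
qed

end

lemma (in fun_cocycle) cleft_mul_eval:
  "ca_mul (cleft_object (fun_alg G) \<sigma>) h g x =
    (if x \<in> CG then \<Sum>a\<in>CG. \<Sum>c\<in>CG. h (a \<otimes> x) * g (c \<otimes> x) * s a c else 0)"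
proof -
  have "ca_mul (cleft_object (fun_alg G) \<sigma>) h g x =
     (\<Sum>a\<in>CG. \<Sum>b\<in>CG. \<Sum>c\<in>CG. \<Sum>d\<in>CG. if b = x then (if d = x then h (a \<otimes> x) * g (c \<otimes> x) * s a c else 0) else 0)"
    unfolding cleft_object_def sweedler_def
    by (simp add: sum_fun_eval sum.cartesian_product[symmetric] sum_distrib_left fscale_def fun_alg_def)
       (intro sum.cong refl, auto simp: delta_def)
  also have "\<dots> = (\<Sum>a\<in>CG. \<Sum>b\<in>CG. if b = x then (\<Sum>c\<in>CG. \<Sum>d\<in>CG. if d = x then h (a \<otimes> x) * g (c \<otimes> x) * s a c else 0) else 0)"
    by (intro sum.cong refl) auto
  also have "\<dots> = (if x \<in> CG then \<Sum>a\<in>CG. \<Sum>c\<in>CG. h (a \<otimes> x) * g (c \<otimes> x) * s a c else 0)"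
    using finG by (simp add: sum.delta)
  finally show ?thesis .
qed

theorem (in fun_cocycle) character_central_iff:
  assumes S: "subgroup S G"
    and al: "group_2cocycle (G\<lparr>carrier := S\<rparr>) \<alpha>" "nondegenerate_cocycle (G\<lparr>carrier := S\<rparr>) \<alpha>"
    and iso: "comod_alg_iso (fun_alg G) (galois_object G S \<alpha>) (cleft_object (fun_alg G) \<sigma>)"
    and X: "X \<in> coord_space CG" "\<And>g. g \<in> CG \<Longrightarrow> X g \<noteq> 0"
      "\<And>g h. g \<in> CG \<Longrightarrow> h \<in> CG \<Longrightarrow> X (g \<otimes> h) = X g * X h"
  shows "(\<forall>g\<in>CG. \<sigma> (delta g) X = \<sigma> X (delta g)) \<longleftrightarrow> (\<forall>s\<in>S. X s = 1)"
proof -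
  let ?K = "G\<lparr>carrier := S\<rparr>" and ?M = "galois_object G S \<alpha>" and ?N = "cleft_object (fun_alg G) \<sigma>"
  have SG: "S \<subseteq> CG" using S by (rule subgroup.subset)
  interpret T: twisted_group_alg ?K \<alpha>
  proof (intro twisted_group_alg.intro twisted_group_alg_axioms.intro)
    show "group ?K" by (rule subgroup.subgroup_is_group[OF S is_group])
    show "finite (carrier ?K)" using finite_subset[OF SG finG] by simp
  qed (rule al)
  have [simp]: "carrier ?K = S" "mult ?K = mult G" "one ?K = \<one>" by simp_all
  have carM: "f \<in> ca_carrier ?M \<longleftrightarrow> (\<forall>g\<in>CG. f g \<in> T.V) \<and> (\<forall>g. g \<notin> CG \<longrightarrow> f g = 0) \<and>
      (\<forall>s\<in>S. \<forall>g\<in>CG. f (s \<otimes> g) = T.act1 s (f g))" for f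
    by (simp add: galois_object_def Let_def)
  have mulM: "ca_mul ?M f f' g = T.m (f g) (f' g)" and scM: "ca_scale ?M c f g = fscale c (f g)"
    and coM: "ca_coact ?M f g h = (if h \<in> CG then f (h \<otimes> g) else 0)" for f f' g h c
    by (simp_all add: galois_object_def Let_def)
  have carN: "ca_carrier ?N = coord_space CG" and scN: "ca_scale ?N = fscale"
    and coN: "ca_coact ?N f b a = (if a \<in> CG \<and> b \<in> CG then f (a \<otimes> b) else 0)" for f a b
    by (simp_all add: cleft_object_def fun_alg_def)
  obtain \<phi> where bij: "bij_betw \<phi> (ca_carrier ?M) (ca_carrier ?N)"
    and lin: "linear_on (ca_scale ?M) (ca_scale ?N) (ca_carrier ?M) \<phi>"
    and mul: "\<And>x y. x \<in> ca_carrier ?M \<Longrightarrow> y \<in> ca_carrier ?M \<Longrightarrow> \<phi> (ca_mul ?M x y) = ca_mul ?N (\<phi> x) (\<phi> y)"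
    and co: "\<And>x b. x \<in> ca_carrier ?M \<Longrightarrow> b \<in> CG \<Longrightarrow> ca_coact ?N (\<phi> x) b = \<phi> (ca_coact ?M x b)"
    using iso unfolding comod_alg_iso_def by (auto simp: basis_fun)
  have inj: "x = y" if "x \<in> ca_carrier ?M" "y \<in> ca_carrier ?M" "\<phi> x = \<phi> y" for x y
    using bij that by (meson bij_betw_imp_inj_on inj_onD)
  have surj: "\<exists>x\<in>ca_carrier ?M. \<phi> x = f" if "f \<in> coord_space CG" for f
    using bij that by (metis carN bij_betw_imp_surj_on imageE)
  have phi_sc: "\<phi> (ca_scale ?M c x) = fscale c (\<phi> x)" if "x \<in> ca_carrier ?M" for c x
    using lin that by (simp add: linear_on_def scN)
  have phi_N: "\<phi> x \<in> coord_space CG" if "x \<in> ca_carrier ?M" for x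
    using bij that by (metis carN bij_betwE)
  \<comment> \<open>This lets injectivity of the isomorphism be applied to products. It holds
    because \<open>s\<close> acts by conjugation, hence multiplicatively.\<close>
  have mulM_car: "ca_mul ?M x y \<in> ca_carrier ?M" if xy: "x \<in> ca_carrier ?M" "y \<in> ca_carrier ?M" for x y
  proof -
    have "T.m (T.act1 s a) (T.act1 s b) = T.act1 s (T.m a b)" if s: "s \<in> S" and ab: "a \<in> T.V" "b \<in> T.V" for s a b
    proof -
      have d: "delta s \<in> T.V" using s by (simp add: coord_space_closed)
      have sK: "s \<in> carrier ?K" using s by simp
      have b: "T.m (T.act1 s b) (delta s) = T.m (delta s) b" and a: "T.m (T.act1 s a) (delta s) = T.m (delta s) a"
        using T.act1_iff[OF sK ab(2) T.act1_V] T.act1_iff[OF sK ab(1) T.act1_V] by blast+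
      have "T.m (T.m (T.act1 s a) (T.act1 s b)) (delta s) = T.m (T.act1 s a) (T.m (delta s) b)"
        by (simp only: T.tm_assoc T.act1_V d b)
      also have "\<dots> = T.m (T.m (T.act1 s a) (delta s)) b" using ab by (simp only: T.tm_assoc T.act1_V d)
      also have "\<dots> = T.m (delta s) (T.m a b)" using ab by (simp only: a T.tm_assoc d)
      finally show ?thesis using T.act1_iff[OF sK T.m_V T.m_V] by blast
    qed
    then show ?thesis using xy
      unfolding carM mulM by (auto simp: T.m_V[simplified] T.m_0)
  qed
  obtain y where y: "y \<in> ca_carrier ?M" "\<phi> y = X" using surj X(1) by blast
  \<comment> \<open>A character is a weight vector for the coaction: right translation by
    \<open>b\<close> scales it by \<open>X b\<close>. The comodule isomorphism carries this property
    over to \<open>y\<close>.\<close>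
  have y_eq: "y (h \<otimes> b) = fscale (X b) (y h)" if hb: "h \<in> CG" "b \<in> CG" for h b
  proof -
    have "ca_coact ?N X b = fscale (X b) X"
    proof
      fix a show "ca_coact ?N X b a = fscale (X b) X a"
        using X(1,3) hb(2) unfolding coN by (auto simp: fscale_def coord_space_def mult.commute)
    qed
    then have "\<phi> (ca_coact ?M y b) = \<phi> (ca_scale ?M (X b) y)"
      using co[OF y(1) hb(2)] phi_sc[OF y(1)] y(2) by simp
    moreover have "ca_coact ?M y b \<in> ca_carrier ?M"
      using y(1) hb(2) SG unfolding carM coM by (auto simp: m_assoc subset_iff)
    moreover have "ca_scale ?M (X b) y \<in> ca_carrier ?M"
    proof -
      have "fscale (X b) (0 :: 'a \<Rightarrow> 'k) = 0" by (simp add: fscale_def fun_eq_iff)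
      moreover have "\<And>g. g \<in> CG \<Longrightarrow> y g \<in> T.V" "\<And>g. g \<notin> CG \<Longrightarrow> y g = 0"
        "\<And>s g. s \<in> S \<Longrightarrow> g \<in> CG \<Longrightarrow> y (s \<otimes> g) = T.act1 s (y g)"
        using y(1) unfolding carM by blast+
      ultimately show ?thesis unfolding carM scM
        by (intro conjI ballI allI impI) (simp_all only: coord_space_closed T.act1_fscale simp_thms)
    qed
    ultimately have "ca_coact ?M y b = ca_scale ?M (X b) y" by (intro inj)
    then have "ca_coact ?M y b h = ca_scale ?M (X b) y h" by simp
    then show ?thesis using hb by (simp add: coM scM)
  qed
  define y0 where "y0 = y \<one>"
  have y0: "y0 \<in> T.V" using y(1) by (simp add: y0_def carM)
  have yb: "y b = fscale (X b) y0" if "b \<in> CG" for b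
    using y_eq[OF one_closed that] that by (simp add: y0_def)
  \<comment> \<open>Both sides are the value of \<open>y\<close> at \<open>s\<close>, computed once
    by equivariance under \<open>S\<close> and once by the weight property.\<close>
  have y_S: "T.act1 s y0 = fscale (X s) y0" if s: "s \<in> S" for s
  proof -
    have sG: "s \<in> CG" using s SG by auto
    have "y (s \<otimes> \<one>) = T.act1 s y0" using y(1) s unfolding carM y0_def by blast
    then show ?thesis using yb[OF sG] sG by simp
  qed
  have y0_nz: "y0 \<noteq> 0"
  proof
    assume z: "y0 = 0"
    have "y = ca_scale ?M 0 y"
    proof
      fix g show "y g = ca_scale ?M 0 y g"
        using yb[of g] y(1) z unfolding carM scM by (cases "g \<in> CG") (auto simp: fscale_def fun_eq_iff)
    qed
    then have "X = fscale 0 X" using phi_sc[OF y(1), of 0] y(2) by simp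
    then have "X \<one> = 0" by (simp add: fscale_def fun_eq_iff)
    then show False using X(2) by auto
  qed
  \<comment> \<open>Since \<open>X (a \<otimes> x) = X a * X x\<close>, the nonzero factor
    \<open>X x\<close> comes out, and one sum reassembles \<open>X\<close> inside the bilinear
    form.\<close>
  have cleft_X: "ca_mul ?N f X x = (if x \<in> CG then X x * (\<Sum>a\<in>CG. f (a \<otimes> x) * \<sigma> (delta a) X) else 0)"
    "ca_mul ?N X f x = (if x \<in> CG then X x * (\<Sum>a\<in>CG. f (a \<otimes> x) * \<sigma> X (delta a)) else 0)" for f x
  proof -
    have Xe: "X = (\<Sum>c\<in>CG. fscale (X c) (delta c))" by (rule coord_expand[OF finG X(1)])
    have sX: "\<sigma> (delta a) X = (\<Sum>c\<in>CG. X c * s a c)" "\<sigma> X (delta a) = (\<Sum>c\<in>CG. X c * s c a)" if "a \<in> CG" for a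
      using bilin_sum[OF sig_bilin coord_space_closed(4)[OF that] coord_space_closed(4), of CG "\<lambda>c. c" X] Xe by simp_all
    show "ca_mul ?N f X x = (if x \<in> CG then X x * (\<Sum>a\<in>CG. f (a \<otimes> x) * \<sigma> (delta a) X) else 0)"
      unfolding cleft_mul_eval
      by (auto simp: X(3) sX sum_distrib_left mult_ac intro!: sum.cong)
    show "ca_mul ?N X f x = (if x \<in> CG then X x * (\<Sum>a\<in>CG. f (a \<otimes> x) * \<sigma> X (delta a)) else 0)"
    proof (cases "x \<in> CG")
      case True
      have "ca_mul ?N X f x = (\<Sum>a\<in>CG. \<Sum>c\<in>CG. X (a \<otimes> x) * f (c \<otimes> x) * s a c)"
        using True by (simp only: cleft_mul_eval if_True)
      also have "\<dots> = (\<Sum>c\<in>CG. \<Sum>a\<in>CG. X (a \<otimes> x) * f (c \<otimes> x) * s a c)"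
        by (rule sum.swap)
      also have "\<dots> = (\<Sum>c\<in>CG. X x * (f (c \<otimes> x) * \<sigma> X (delta c)))"
      proof (rule sum.cong[OF refl])
        fix c assume c: "c \<in> CG"
        have "(\<Sum>a\<in>CG. X (a \<otimes> x) * f (c \<otimes> x) * s a c) = (\<Sum>a\<in>CG. (X x * f (c \<otimes> x)) * (X a * s a c))"
          using True by (intro sum.cong refl) (simp add: X(3) mult_ac)
        then show "(\<Sum>a\<in>CG. X (a \<otimes> x) * f (c \<otimes> x) * s a c) = X x * (f (c \<otimes> x) * \<sigma> X (delta c))"
          using c by (simp add: sX(2) sum_distrib_left mult.assoc)
      qed
      finally show ?thesis using True by (simp add: sum_distrib_left)
    qed (simp add: cleft_mul_eval)
  qed
  have "(\<forall>g\<in>CG. \<sigma> (delta g) X = \<sigma> X (delta g)) \<longleftrightarrow> (\<forall>f\<in>coord_space CG. ca_mul ?N f X = ca_mul ?N X f)"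
  proof
    assume "\<forall>g\<in>CG. \<sigma> (delta g) X = \<sigma> X (delta g)"
    then show "\<forall>f\<in>coord_space CG. ca_mul ?N f X = ca_mul ?N X f"
      by (auto simp: fun_eq_iff cleft_X)
  next
    assume *: "\<forall>f\<in>coord_space CG. ca_mul ?N f X = ca_mul ?N X f"
    show "\<forall>g\<in>CG. \<sigma> (delta g) X = \<sigma> X (delta g)"
    proof
      fix g assume g: "g \<in> CG"
      have d: "(\<Sum>a\<in>CG. delta g (a \<otimes> \<one>) * F a) = F g" for F :: "'a \<Rightarrow> 'k"
      proof -
        have "(\<Sum>a\<in>CG. delta g (a \<otimes> \<one>) * F a) = (\<Sum>a\<in>CG. if a = g then F a else 0)"
          by (intro sum.cong refl) (auto simp: delta_def)
        then show ?thesis using g finG by simp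
      qed
      \<comment> \<open>At the unit element only the term for \<open>g\<close> survives, and
        \<open>X \<one>\<close> can be cancelled.\<close>
      have "ca_mul ?N (delta g) X \<one> = ca_mul ?N X (delta g) \<one>"
        using * coord_space_closed(4)[OF g] by (metis (no_types, lifting))
      then show "\<sigma> (delta g) X = \<sigma> X (delta g)"
        using X(2)[OF one_closed] by (simp only: cleft_X d one_closed if_True mult_cancel_left) simp
    qed
  qed
  also have "\<dots> \<longleftrightarrow> (\<forall>f\<in>ca_carrier ?M. ca_mul ?M f y = ca_mul ?M y f)"
  proof
    assume *: "\<forall>f\<in>coord_space CG. ca_mul ?N f X = ca_mul ?N X f"
    show "\<forall>f\<in>ca_carrier ?M. ca_mul ?M f y = ca_mul ?M y f"
    proof
      fix f assume f: "f \<in> ca_carrier ?M"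
      then have "\<phi> (ca_mul ?M f y) = \<phi> (ca_mul ?M y f)"
        using * phi_N[OF f] by (simp add: mul y)
      then show "ca_mul ?M f y = ca_mul ?M y f" using f y(1) by (intro inj mulM_car)
    qed
  next
    assume *: "\<forall>f\<in>ca_carrier ?M. ca_mul ?M f y = ca_mul ?M y f"
    show "\<forall>f\<in>coord_space CG. ca_mul ?N f X = ca_mul ?N X f"
    proof
      fix f :: "'a \<Rightarrow> 'k" assume "f \<in> coord_space CG"
      then obtain x where x: "x \<in> ca_carrier ?M" "\<phi> x = f" using surj by blast
      then show "ca_mul ?N f X = ca_mul ?N X f"
        using mul[OF x(1) y(1)] mul[OF y(1) x(1)] * y(2) by simp
    qed
  qed
  also have "\<dots> \<longleftrightarrow> (\<forall>s\<in>S. X s = 1)"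
  proof
    assume *: "\<forall>f\<in>ca_carrier ?M. ca_mul ?M f y = ca_mul ?M y f"
    have comm: "T.m w y0 = T.m y0 w" if w: "w \<in> T.V" for w
    proof -
      \<comment> \<open>An equivariant function may be prescribed on the coset \<open>S\<close> by
        its value at the unit and set to zero on the other cosets. Hence every \<open>w\<close>
        occurs as such a value, and \<open>y0\<close> commutes with everything.\<close>
      define f where "f = (\<lambda>h. if h \<in> S then T.act1 h w else 0)"
      have "f \<in> ca_carrier ?M"
        unfolding carM
      proof (intro conjI ballI allI impI)
        show "f g \<in> T.V" for g by (auto simp: f_def T.act1_V[simplified] coord_space_closed)
        show "f g = 0" if "g \<notin> CG" for g using that SG by (auto simp: f_def)
        fix t g assume t: "t \<in> S" and g: "g \<in> CG"
        show "f (t \<otimes> g) = T.act1 t (f g)"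
        proof (cases "g \<in> S")
          case True
          then show ?thesis using t w T.act1_mult[of t g w] subgroup.m_closed[OF S t True] by (simp add: f_def)
        next
          case False
          have "t \<otimes> g \<notin> S"
          proof
            assume "t \<otimes> g \<in> S"
            then have "inv t \<otimes> (t \<otimes> g) \<in> S"
              using S t subgroup.m_inv_closed subgroup.m_closed by metis
            moreover have "inv t \<otimes> (t \<otimes> g) = g" using t g SG by (simp add: subset_iff flip: m_assoc)
            ultimately show False using False by simp
          qed
          moreover have "T.act1 t 0 = 0" by (simp only: twisted_action_def T.m_0)
          ultimately show ?thesis using False by (simp add: f_def)
        qed
      qed
      then have "ca_mul ?M f y \<one> = ca_mul ?M y f \<one>" using * by simp
      moreover have "f \<one> = w"
        using T.act1_one[OF w] subgroup.one_closed[OF S] by (simp add: f_def)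
      ultimately show ?thesis by (simp add: mulM y0_def)
    qed
    show "\<forall>s\<in>S. X s = 1"
    proof
      fix s assume s: "s \<in> S"
      then have "T.m y0 (delta s) = T.m (delta s) y0" using comm[of "delta s"] by (simp add: coord_space_closed)
      then have "y0 = T.act1 s y0" using T.act1_iff[of s y0 y0] y0 s by simp
      then have "y0 = fscale (X s) y0" using y_S[OF s] by simp
      moreover obtain r where "y0 r \<noteq> 0" using y0_nz by (auto simp: fun_eq_iff)
      ultimately show "X s = 1" by (metis fscale_def mult_cancel_right1)
    qed
  next
    assume *: "\<forall>s\<in>S. X s = 1"
    have "T.m (delta t) y0 = T.m y0 (delta t)" if t: "t \<in> S" for t
    proof -
      have "y0 = T.act1 t y0" using y_S[OF t] * t by (simp add: fscale_def)
      then show ?thesis using T.act1_iff[of t y0 y0] y0 t by simp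
    qed
    then have "y0 = fscale (y0 \<one>) (delta \<one>)" using T.center_scalar[OF al(2) y0] by simp
    then obtain c where c: "y0 = fscale c (delta \<one>)" by blast
    show "\<forall>f\<in>ca_carrier ?M. ca_mul ?M f y = ca_mul ?M y f"
    proof (intro ballI ext)
      fix f g x assume f: "f \<in> ca_carrier ?M"
      show "ca_mul ?M f y g x = ca_mul ?M y f g x"
      proof (cases "g \<in> CG")
        case True
        then have "f g \<in> T.V" using f by (simp add: carM)
        then have "T.m (f g) (delta \<one>) = T.m (delta \<one>) (f g)" using T.m_delta_one_comm[of "f g"] by simp
        then show ?thesis using True by (simp only: mulM yb c T.m_fscale)
      next
        case False
        then show ?thesis using f y(1) by (simp add: mulM carM)
      qed
    qed
  qed
  finally show ?thesis .
qed

section \<open>The symmetric group\<close>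

text \<open>The symmetric groups of all degrees are embedded in one group, written additively.\<close>

typedef fperm = "{p :: nat \<Rightarrow> nat. permutation p}"
  using permutation_id by blast

lemma permutation_Rep [simp]: "permutation (Rep_fperm x)"
  using Rep_fperm by simp

instantiation fperm :: group_add
begin

definition "0 = Abs_fperm id"
definition "x + y = Abs_fperm (Rep_fperm x \<circ> Rep_fperm y)"
definition "- x = Abs_fperm (inv' (Rep_fperm x))"
definition "x - y = x + - (y :: fperm)"

lemma Rep_fperm_simps [simp]:
  "Rep_fperm 0 = id" "Rep_fperm (x + y) = Rep_fperm x \<circ> Rep_fperm y" "Rep_fperm (- x) = inv' (Rep_fperm x)"
  by (simp_all add: zero_fperm_def plus_fperm_def uminus_fperm_def Abs_fperm_inverse
      permutation_id permutation_compose permutation_inverse)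

instance
proof
  fix a b c :: fperm
  show "a + b + c = a + (b + c)" "0 + a = a" "a + 0 = a" "a + - b = a - b"
    by (simp_all add: Rep_fperm_inject[symmetric] o_assoc minus_fperm_def)
  show "- a + a = 0"
    using permutation_inverse_works(1)[OF permutation_Rep, of a] by (simp add: Rep_fperm_inject[symmetric])
qed

end

definition sgn_fperm :: "fperm \<Rightarrow> 'k::field_char_0" where
  "sgn_fperm x = of_int (sign (Rep_fperm x))"

lemma sgn_fperm_add: "sgn_fperm (x + y) = sgn_fperm x * sgn_fperm y"
  by (simp add: sgn_fperm_def sign_compose)

lemma sgn_fperm_sq: "sgn_fperm x * sgn_fperm x = 1"
  by (simp add: sgn_fperm_def sign_def)

text \<open>Three successive transpositions put one point each into place; the later ones do not
  disturb the targets already reached.\<close>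

lemma permutes_three:
  assumes "x \<in> A" "y \<in> A" "z \<in> A" "x' \<in> A" "y' \<in> A" "z' \<in> A"
    and "x \<noteq> y" "x \<noteq> z" "y \<noteq> z" "x' \<noteq> y'" "x' \<noteq> z'" "y' \<noteq> z'"
  shows "\<exists>g. g permutes A \<and> g x = x' \<and> g y = y' \<and> g z = z'"
proof -
  define g1 where "g1 = transpose x x'"
  define g2 where "g2 = transpose (g1 y) y' \<circ> g1"
  define g3 where "g3 = transpose (g2 z) z' \<circ> g2"
  have g1: "g1 permutes A" "g1 x = x'" unfolding g1_def using assms by (auto intro: permutes_swap_id)
  have y1: "g1 y \<in> A" "g1 y \<noteq> x'"
    using permutes_in_image[OF g1(1)] permutes_inj[OF g1(1)] assms g1(2) by (auto dest: injD)
  have g2: "g2 permutes A" "g2 x = x'" "g2 y = y'"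
    unfolding g2_def using g1 y1 assms by (auto intro!: permutes_compose permutes_swap_id simp: transpose_def)
  have z2: "g2 z \<in> A" "g2 z \<noteq> x'" "g2 z \<noteq> y'"
    using permutes_in_image[OF g2(1)] permutes_inj[OF g2(1)] assms g2 by (auto dest: injD)
  have "g3 permutes A" "g3 x = x'" "g3 y = y'" "g3 z = z'"
    unfolding g3_def using g2 z2 assms by (auto intro!: permutes_compose permutes_swap_id simp: transpose_def)
  then show ?thesis by blast
qed

lemma conj_transpose: "bij g \<Longrightarrow> g \<circ> transpose a b \<circ> inv' g = transpose (g a) (g b)"
  by (rule ext) (auto simp: transpose_def bij_inv_eq_iff bij_is_surj surj_f_inv_f dest: bij_is_inj injD)

lemma ex_avoid:
  assumes "finite B" "card B < card A"
  shows "\<exists>x\<in>A. x \<notin> B"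
  using assms by (meson card_mono leD subsetI)

text \<open>From a nontrivial element a 3-cycle in \<open>N\<close> is produced. All 3-cycles are
  conjugate in \<open>P\<close> and generate the alternating group, which has index two.\<close>

lemma normal_subgroups_sym:
  fixes n :: nat
  defines "P \<equiv> {p. p permutes {1..n}}"
  assumes n: "n \<ge> 5" and N: "N \<subseteq> P" "id \<in> N" "\<And>p q. p \<in> N \<Longrightarrow> q \<in> N \<Longrightarrow> p \<circ> q \<in> N"
    "\<And>p. p \<in> N \<Longrightarrow> inv' p \<in> N" "\<And>p g. p \<in> N \<Longrightarrow> g \<in> P \<Longrightarrow> g \<circ> p \<circ> inv' g \<in> N"
  shows "N = {id} \<or> N = P \<or> N = {p \<in> P. evenperm p}"
proof (cases "N = {id}")
  case False
  let ?A = "{1..n}"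
  have tp: "transpose a b \<in> P" if "a \<in> ?A" "b \<in> ?A" for a b
    using permutes_swap_id[OF that] by (simp add: P_def)
  have bij: "bij g" if "g \<in> P" for g using that permutes_bij by (auto simp: P_def)
  obtain p where p: "p \<in> N" "p \<noteq> id" using False N(2) by auto
  then have pP: "p permutes ?A" using N(1) by (auto simp: P_def)
  obtain a where a: "p a \<noteq> a" using p(2) by (auto simp: fun_eq_iff)
  then have aA: "a \<in> ?A" using pP by (metis permutes_not_in)
  define b where "b = p a"
  have bA: "b \<in> ?A" and ab: "a \<noteq> b" using permutes_in_image[OF pP] aA a by (auto simp: b_def)
  have "card {a, b} < card ?A" using n card_insert_le_m1[of 2 "{b}" a] by (auto simp: card_insert_if)
  then obtain c where c: "c \<in> ?A" "c \<noteq> a" "c \<noteq> b" using ex_avoid[of "{a, b}" ?A] by auto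
  define d where "d = p c"
  have dA: "d \<in> ?A" using permutes_in_image[OF pP] c by (simp add: d_def)
  have db: "d \<noteq> b" using permutes_inj[OF pP] c by (auto simp: d_def b_def dest: injD)
  \<comment> \<open>This is the commutator of \<open>p\<close> with the transposition of
    \<open>a\<close> and \<open>c\<close>. It is not the identity, because \<open>b\<close> differs
    from both \<open>a\<close> and \<open>c\<close>.\<close>
  have k: "transpose b d \<circ> transpose a c \<in> N"
  proof -
    have "transpose a c \<circ> inv' p \<circ> inv' (transpose a c) \<in> N"
      using N(4)[OF p(1)] tp[OF aA c(1)] by (rule N(5))
    then have "p \<circ> (transpose a c \<circ> inv' p \<circ> inv' (transpose a c)) \<in> N" using p(1) N(3) by blast
    moreover have "p \<circ> (transpose a c \<circ> inv' p \<circ> inv' (transpose a c)) = transpose b d \<circ> transpose a c"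
      using conj_transpose[OF permutes_bij[OF pP], of a c] by (simp add: o_assoc b_def d_def)
    ultimately show ?thesis by simp
  qed
  have "\<exists>x y z. x \<in> ?A \<and> y \<in> ?A \<and> z \<in> ?A \<and> x \<noteq> y \<and> x \<noteq> z \<and> y \<noteq> z \<and> transpose x y \<circ> transpose x z \<in> N"
  proof -
    consider "d = a" | "d = c" | "d \<noteq> a" "d \<noteq> c" by blast
    then show ?thesis
    proof cases
      case 1
      then have "transpose a b \<circ> transpose a c \<in> N" using k by (simp add: transpose_commute)
      then show ?thesis using aA bA c ab by blast
    next
      case 2
      then have "transpose c b \<circ> transpose c a \<in> N" using k by (simp add: transpose_commute)
      then show ?thesis using aA bA c ab by (metis (no_types))
    next
      case 3
      have "card {a, b, c, d} < card ?A" using n by (auto simp: card_insert_if)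
      \<comment> \<open>The two transpositions are disjoint here, and a fifth letter is needed,
        which is where the bound on \<open>n\<close> enters: multiplying by the conjugate under the
        transposition of \<open>d\<close> and \<open>e\<close> cancels the second transposition and
        leaves a 3-cycle.\<close>
      then obtain e where e: "e \<in> ?A" "e \<notin> {a, b, c, d}" using ex_avoid[of "{a, b, c, d}" ?A] by blast
      define g where "g = transpose d e"
      have gP: "g \<in> P" unfolding g_def using dA e by (intro tp)
      have "g \<circ> (transpose b d \<circ> transpose a c) \<circ> inv' g = (g \<circ> transpose b d \<circ> inv' g) \<circ> (g \<circ> transpose a c \<circ> inv' g)"
        using bij[OF gP] by (simp add: fun_eq_iff bij_is_inj)
      also have "\<dots> = transpose b e \<circ> transpose a c"
        unfolding conj_transpose[OF bij[OF gP]] using e 3 db by (auto simp: g_def transpose_def)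
      finally have "transpose b e \<circ> transpose a c \<in> N" using N(5)[OF k gP] by simp
      then have "(transpose b d \<circ> transpose a c) \<circ> (transpose b e \<circ> transpose a c) \<in> N" using k N(3) by blast
      moreover have "(transpose b d \<circ> transpose a c) \<circ> (transpose b e \<circ> transpose a c) = transpose b d \<circ> transpose b e"
        using e 3 db ab c by (auto simp: fun_eq_iff transpose_def)
      ultimately have "transpose b d \<circ> transpose b e \<in> N" by simp
      then show ?thesis using bA dA e db by (metis insertCI)
    qed
  qed
  then obtain x y z where xyz: "x \<in> ?A" "y \<in> ?A" "z \<in> ?A" "x \<noteq> y" "x \<noteq> z" "y \<noteq> z"
    and t: "transpose x y \<circ> transpose x z \<in> N" by blast
  have three: "transpose x' y' \<circ> transpose x' z' \<in> N"
    if h: "x' \<in> ?A" "y' \<in> ?A" "z' \<in> ?A" "x' \<noteq> y'" "x' \<noteq> z'" "y' \<noteq> z'" for x' y' z'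
  proof -
    obtain g where g: "g permutes ?A" "g x = x'" "g y = y'" "g z = z'"
      using permutes_three[OF xyz(1-3) h(1-3) xyz(4-6) h(4-6)] by blast
    have gP: "g \<in> P" using g by (simp add: P_def)
    have "g \<circ> (transpose x y \<circ> transpose x z) \<circ> inv' g = (g \<circ> transpose x y \<circ> inv' g) \<circ> (g \<circ> transpose x z \<circ> inv' g)"
      using bij[OF gP] by (simp add: fun_eq_iff bij_is_inj)
    then show ?thesis using N(5)[OF t gP] conj_transpose[OF bij[OF gP]] g by simp
  qed
  have "three_cycles n \<subseteq> N"
  proof
    fix q assume "q \<in> three_cycles n"
    then obtain cs where cs: "q = cycle_of_list cs" "cycle cs" "length cs = 3" "set cs \<subseteq> ?A" by auto
    then obtain i j l where "cs = [i, j, l]"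
      by (auto simp: numeral_3_eq_3 length_Suc_conv)
    then have q: "q = transpose j i \<circ> transpose j l" and d: "i \<noteq> j" "i \<noteq> l" "j \<noteq> l" "i \<in> ?A" "j \<in> ?A" "l \<in> ?A"
      using cs by (auto simp: transpose_commute)
    show "q \<in> N" unfolding q using d by (intro three) auto
  qed
  then have gen: "generate (alt_group n) (three_cycles n) \<subseteq> N"
  proof (intro subsetI)
    fix q assume "three_cycles n \<subseteq> N" "q \<in> generate (alt_group n) (three_cycles n)"
    from this(2,1) show "q \<in> N"
    proof (induction rule: generate.induct)
      case one
      show ?case unfolding alt_group_one by (rule N(2))
    next
      case (incl h)
      then show ?case by auto
    next
      case (inv h)
      then have "h \<in> carrier (alt_group n)" using three_cycles_incl by blast
      then show ?case using inv N(4) by (auto simp: alt_group_inv_equality)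
    next
      case (eng h1 h2)
      then show ?case unfolding alt_group_mult by (blast intro: N(3))
    qed
  qed
  then have alt: "q \<in> N" if "q \<in> P" "evenperm q" for q
    using that alt_group_carrier[of q n] alt_group_carrier_as_three_cycles[of n] by (auto simp: P_def)
  have perm: "permutation q" if "q \<in> P" for q
    using that by (auto simp: P_def permutation_permutes)
  show ?thesis
  proof (cases "\<exists>g\<in>N. \<not> evenperm g")
    case True
    then obtain g where g: "g \<in> N" "\<not> evenperm g" by blast
    have gP: "g \<in> P" using g N(1) by auto
    \<comment> \<open>One odd element suffices: for odd \<open>h\<close> the quotient by
      \<open>g\<close> is even and therefore already in \<open>N\<close>.\<close>
    have "h \<in> N" if h: "h \<in> P" for h
    proof (cases "evenperm h")
      case False
      have hg: "h \<circ> inv' g \<in> P" using h gP by (auto simp: P_def intro: permutes_compose permutes_inv)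
      have "evenperm (h \<circ> inv' g)"
        using False g perm[OF h] perm[OF gP] by (simp add: evenperm_comp evenperm_inv permutation_inverse)
      then have "(h \<circ> inv' g) \<circ> g \<in> N" using alt[OF hg] g N(3) by blast
      moreover have "(h \<circ> inv' g) \<circ> g = h" using bij[OF gP] by (simp add: fun_eq_iff bij_is_inj)
      ultimately show ?thesis by simp
    qed (use h alt in blast)
    then show ?thesis using N(1) by blast
  next
    case False
    then show ?thesis using N(1) alt by blast
  qed
qed simp

theorem corollary6p5:
  fixes n :: nat
    and S :: "(nat \<Rightarrow> nat) set"
    and \<alpha> :: "(nat \<Rightarrow> nat) \<Rightarrow> (nat \<Rightarrow> nat) \<Rightarrow> 'k::{alg_closed_field, field_char_0}"
    and J :: "(nat \<Rightarrow> nat) \<times> (nat \<Rightarrow> nat) \<Rightarrow> 'k"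
  assumes "n \<ge> 5"
    and "subgroup S (sym_group n)"
    and "group_2cocycle ((sym_group n)\<lparr>carrier := S\<rparr>) \<alpha>"
    and "nondegenerate_cocycle ((sym_group n)\<lparr>carrier := S\<rparr>) \<alpha>"
    and "associated_twist (sym_group n) S \<alpha> J"
  shows "simple_hopf_algebra (twist_bialg (group_alg (sym_group n)) J) \<longleftrightarrow>
           \<not> S \<subseteq> carrier (alt_group n)"
proof -
  let ?G = "sym_group n" and ?A = "{1..n}"
  obtain \<sigma> where \<sigma>: "hopf_2cocycle (fun_alg ?G) \<sigma>" "convolution_invertible (fun_alg ?G) \<sigma>"
    "comod_alg_iso (fun_alg ?G) (galois_object ?G S \<alpha>) (cleft_object (fun_alg ?G) \<sigma>)"
    and J: "J = twist_of_cocycle ?G \<sigma>"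
    using assms(5) by (auto simp: associated_twist_def)
  have car: "carrier ?G = {p. p permutes ?A}" using sym_group_carrier by blast
  have perm: "permutation p" if "p \<in> carrier ?G" for p using that by (rule sym_group_carrier')
  have Rep: "Rep_fperm (Abs_fperm p) = p" if "p \<in> carrier ?G" for p
    using perm[OF that] by (simp add: Abs_fperm_inverse)
  interpret F: fun_cocycle_emb ?G \<sigma> Abs_fperm sgn_fperm
  proof (intro fun_cocycle_emb.intro fun_cocycle.intro fun_cocycle_axioms.intro fun_cocycle_emb_axioms.intro)
    show "group ?G" by (rule sym_group_is_group)
    show "finite (carrier ?G)" unfolding car by (rule finite_permutations) simp
    show "inj_on Abs_fperm (carrier ?G)" by (rule inj_on_inverseI[of _ Rep_fperm]) (rule Rep)
    show "Abs_fperm (x \<otimes>\<^bsub>?G\<^esub> y) = Abs_fperm x + Abs_fperm y" if "x \<in> carrier ?G" "y \<in> carrier ?G" for x y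
      using that by (simp add: plus_fperm_def Rep sym_group_mult)
  qed (rule \<sigma> sgn_fperm_add sgn_fperm_sq)+
  obtain Ji where gt: "group_twist ?G Abs_fperm sgn_fperm J Ji"
    using F.group_twist_of_cocycle[OF \<sigma>(2)] J by blast
  interpret T: group_twist ?G Abs_fperm sgn_fperm J Ji by (rule gt)
  have sgn: "sgn_fperm (Abs_fperm p) = (of_int (sign p) :: 'k)" if "p \<in> carrier ?G" for p
    using Rep[OF that] by (simp add: sgn_fperm_def)
  have sgn_eq1: "sgn_fperm (Abs_fperm p) = (1 :: 'k) \<longleftrightarrow> evenperm p" if "p \<in> carrier ?G" for p
    using sgn[OF that] by (auto simp: sign_def)
  have tr: "transpose a b \<in> carrier ?G" if "a \<in> ?A" "b \<in> ?A" for a b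
    unfolding car using permutes_swap_id[OF that] by simp
  have "simple_hopf_algebra (twist_bialg (group_alg ?G) J) \<longleftrightarrow> T.u \<noteq> T.v"
  proof (rule T.simple_iff)
    fix N assume N: "N \<subseteq> Abs_fperm ` carrier ?G" "0 \<in> N" "\<And>a b. a \<in> N \<Longrightarrow> b \<in> N \<Longrightarrow> a + b \<in> N"
      "\<And>a. a \<in> N \<Longrightarrow> - a \<in> N" "\<And>a g. a \<in> N \<Longrightarrow> g \<in> Abs_fperm ` carrier ?G \<Longrightarrow> g + a - g \<in> N"
    define M where "M = Rep_fperm ` N"
    have M: "M = {id} \<or> M = {p. p permutes ?A} \<or> M = {p \<in> {p. p permutes ?A}. evenperm p}"
    proof (rule normal_subgroups_sym[OF assms(1)])
      show "M \<subseteq> {p. p permutes ?A}" using N(1) Rep by (auto simp: M_def car)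
      show "id \<in> M" using N(2) unfolding M_def by (metis Rep_fperm_simps(1) imageI)
      show "p \<circ> q \<in> M" if "p \<in> M" "q \<in> M" for p q
        using that N(3) unfolding M_def by (metis (no_types, lifting) Rep_fperm_simps(2) imageE imageI)
      show "inv' p \<in> M" if "p \<in> M" for p
        using that N(4) unfolding M_def by (metis (no_types, lifting) Rep_fperm_simps(3) imageE imageI)
      show "g \<circ> p \<circ> inv' g \<in> M" if pM: "p \<in> M" and gP: "g \<in> {p. p permutes ?A}" for p g
      proof -
        obtain a where a: "a \<in> N" "p = Rep_fperm a" using pM by (auto simp: M_def)
        have "Abs_fperm g + a - Abs_fperm g \<in> N" using N(5)[OF a(1)] gP car by blast
        then have "Rep_fperm (Abs_fperm g + a + - Abs_fperm g) \<in> M" unfolding M_def by simp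
        then show ?thesis using Rep[of g] gP car a(2)
          by (simp del: add_uminus_conv_diff)
      qed
    qed
    have NM: "N = Abs_fperm ` M" by (auto simp: M_def image_image Rep_fperm_inverse)
    show "N = {0} \<or> N = Abs_fperm ` carrier ?G \<or> N = {g \<in> Abs_fperm ` carrier ?G. sgn_fperm g = (1 :: 'k)}"
      using M sgn_eq1 unfolding NM car by (auto simp: zero_fperm_def)
  next
    fix z assume z: "z \<in> Abs_fperm ` carrier ?G" "\<And>g. g \<in> Abs_fperm ` carrier ?G \<Longrightarrow> z + g = g + z"
    obtain p where p: "p \<in> carrier ?G" "z = Abs_fperm p" using z(1) by blast
    have pP: "p permutes ?A" using p(1) car by simp
    have "p a = a" for a
    proof (rule ccontr)
      assume a: "p a \<noteq> a"
      then have aA: "a \<in> ?A" using pP by (metis permutes_not_in)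
      have paA: "p a \<in> ?A" using permutes_in_image[OF pP] aA by simp
      have "card {a, p a} < card ?A" using assms(1) a by simp
      then obtain c where c: "c \<in> ?A" "c \<noteq> a" "c \<noteq> p a" using ex_avoid[of "{a, p a}" ?A] by auto
      \<comment> \<open>This transposition fixes \<open>a\<close> but moves \<open>p a\<close> to
        \<open>c\<close>, so it cannot commute with \<open>p\<close>.\<close>
      let ?t = "transpose (p a) c"
      have t: "?t \<in> carrier ?G" using paA c(1) by (rule tr)
      then have "Rep_fperm (z + Abs_fperm ?t) a = Rep_fperm (Abs_fperm ?t + z) a" using z(2) by simp
      then have "p (?t a) = ?t (p a)" using p by (simp add: Rep t)
      then show False using a c by (simp add: transpose_def split: if_splits)
    qed
    then have "p = id" by (simp add: fun_eq_iff)
    then show "z = 0" using p by (simp add: zero_fperm_def)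
  next
    have i: "1 \<in> ?A" "2 \<in> ?A" "3 \<in> ?A" using assms(1) by auto
    show "transpose 1 2 \<in> carrier ?G" "transpose 2 3 \<in> carrier ?G" "transpose 1 2 \<in> carrier ?G"
      using i by (auto intro: tr)
    have "(transpose 1 2 \<circ> transpose 2 3) 1 \<noteq> (transpose 2 3 \<circ> transpose (1 :: nat) 2) (1 :: nat)"
      by (simp add: transpose_def)
    then show "transpose 1 2 \<otimes>\<^bsub>?G\<^esub> transpose 2 3 \<noteq> transpose 2 3 \<otimes>\<^bsub>?G\<^esub> transpose 1 2"
      by (metis sym_group_mult)
    show "sgn_fperm (Abs_fperm (transpose 1 2)) \<noteq> (1 :: 'k)"
      using sgn_eq1[OF tr[OF i(1,2)]] by (simp add: evenperm_swap)
  qed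
  also have "\<dots> \<longleftrightarrow> \<not> (\<forall>g\<in>carrier ?G. \<sigma> (delta g) F.chiv = \<sigma> F.chiv (delta g))"
    using F.u_eq_v_iff[of Ji] gt J by simp
  also have "(\<forall>g\<in>carrier ?G. \<sigma> (delta g) F.chiv = \<sigma> F.chiv (delta g)) \<longleftrightarrow> (\<forall>s\<in>S. F.chiv s = 1)"
  proof (rule F.character_central_iff[OF assms(2-4) \<sigma>(3)])
    show "F.chiv \<in> coord_space (carrier ?G)" by (auto simp: F.chiv_def coord_space_def)
    show "F.chiv g \<noteq> 0" if "g \<in> carrier ?G" for g
      using that sgn[OF that] by (simp add: F.chiv_def sign_def)
    show "F.chiv (g \<otimes>\<^bsub>?G\<^esub> h) = F.chiv g * F.chiv h" if "g \<in> carrier ?G" "h \<in> carrier ?G" for g h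
      using that by (simp add: F.chiv_def F.emb_mult sgn_fperm_add group.is_monoid[OF sym_group_is_group] monoid.m_closed)
  qed
  also have "(\<forall>s\<in>S. F.chiv s = 1) \<longleftrightarrow> S \<subseteq> carrier (alt_group n)"
  proof -
    have "F.chiv s = 1 \<longleftrightarrow> s \<in> carrier (alt_group n)" if "s \<in> S" for s
    proof -
      have s: "s \<in> carrier ?G" using subgroup.subset[OF assms(2)] that by blast
      then show ?thesis using sgn_eq1[OF s] car by (simp add: F.chiv_def alt_group_carrier)
    qed
    then show ?thesis by blast
  qed
  finally show ?thesis .
qed

end
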